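(* Let $G=(V,E)$ be a finite simple graph with a fixed total order on $V$, and let $\lambda$ be a partition. Write $\overline{X}_G=\sum_{\mu}c_\mu\,\overline{p}_\mu$ for the unique expansion of $\overline{X}_G$ in the $\overline{p}$-basis (sum over all partitions $\mu$). Then $(-1)^{|\lambda|-\ell(\lambda)}c_\lambda$ equals the number of families $(M_k)_{k\ge1}$ satisfying: (i) for each odd $k$, $M_k$ is a set of $i_k(\lambda)$ distinct Lyndon heaps on $G$, each of size $k$; (ii) for each even $k$, $M_k$ is a multiset of $i_k(\lambda)$ Lyndon heaps on $G$ (repetition allowed), each of size $k/2^j$ for some integer $j\ge 0$ such that $k/2^j$ is even; (iii) every vertex of $G$ is used by at least one Lyndon heap appearing in some $M_k$. Equivalently, $$(-1)^{|\lambda|-\ell(\lambda)}c_\lambda=\sum_{W\subseteq V}(-1)^{|V\setminus W|}\prod_{k\text{ odd}}\binom{|\mathcal{L}_{G|_W}(k)|}{i_k(\lambda)}\prod_{k\text{ even}}\left(\!\!\binom{\sum_{j\ge0,\ k/2^j\text{ even}}|\mathcal{L}_{G|_W}(k/2^j)|}{i_k(\lambda)}\!\!\right),$$ where $\left(\!\binom{n}{r}\!\right)=\binom{n+r-1}{r}$. In particular this coefficient is a nonnegative integer.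
   Context: Graphs are finite, simple, unweighted. $G|_W$ is the induced subgraph on $W$. For a partition $\lambda$, $\ell(\lambda)$ is its number of parts, $|\lambda|$ the sum of parts, and $i_k(\lambda)$ the number of parts equal to $k$. Kromatic symmetric function: a proper set coloring of $G$ is a map $\kappa$ from $V$ to nonempty subsets of $\mathbb{Z}_{>0}$ such that adjacent vertices receive disjoint sets; $\overline{X}_G(x_1,x_2,\dots)=\sum_\kappa\prod_{v\in V}\prod_{i\in\kappa(v)}x_i$, summed over proper set colorings. The $K$-theoretic power sums: $1+\overline{p}_k=\prod_{i\ge1}(1+x_i^k)$, $\overline{p}_\lambda=\overline{p}_{\lambda_1}\cdots\overline{p}_{\lambda_{\ell(\lambda)}}$; every symmetric power series has a unique expansion as a (possibly infinite) linear combination of the $\overline{p}_\lambda$. Heaps: fix a total order on $V$. A heap on $G$ is an equivalence class of finite words over the alphabet $V$ under the equivalence generated by $\cdots uv\cdots\sim\cdots vu\cdots$ whenever $u\neq v$ are nonadjacent in $G$. Its size is the word length; a vertex is used by a heap if it occurs as a letter. Composition $H_1\circ H_2$ is the class of the concatenation of representatives. Occurrences of letters are called pieces; in a representative $a_1\cdots a_m$, set piece $i\prec$ piece $j$ if $i<j$ and $a_i,a_j$ are equal or adjacent in $G$; the transitive closure is a partial order on pieces, independent of the representative. A pyramid is a heap with exactly one minimal piece. A heap is periodic if it equals $K\circ\cdots\circ K$ ($m>1$ times) for some heap $K$, aperiodic otherwise. Rotation: for a piece $p$ of a heap $H$, the pieces $\succeq p$ form a heap $V_p$ with $H=U\circ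 V_p$; set $A_p(H)=V_p\circ U$. Iterating $A_p$ eventually stabilizes at a pyramid $A_p^\infty(H)$ with unique minimal piece $p$. Two pyramids are rotation-equivalent if one is $A_p^\infty$ of the other for some piece $p$; this is an equivalence relation, and within a class either all pyramids are periodic or all are aperiodic. The standard word of a heap is the lexicographically maximal word in its class. A Lyndon heap is an aperiodic pyramid whose standard word is lexicographically minimal among the standard words of the pyramids in its rotation class. $\mathcal{L}_G(k)$ denotes the set of Lyndon heaps of size $k$ on $G$. *)

theory Defs
  imports Complex_Main "HOL-Library.Multiset"
begin

text \<open>A finite simple graph is given by a finite vertex set V and a symmetric,
irreflexive adjacency predicate E living on V. The total order on V is the
order of the type 'a (class linorder).\<close>

definition simple_graph :: "'a set \<Rightarrow> ('a \<Rightarrow> 'a \<Rightarrow> bool) \<Rightarrow> bool" where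
  "simple_graph V E \<longleftrightarrow> finite V \<and> (\<forall>u v. E u v \<longrightarrow> u \<in> V \<and> v \<in> V)
     \<and> (\<forall>u v. E u v \<longrightarrow> E v u) \<and> (\<forall>u. \<not> E u u)"

definition induced :: "('a \<Rightarrow> 'a \<Rightarrow> bool) \<Rightarrow> 'a set \<Rightarrow> 'a \<Rightarrow> 'a \<Rightarrow> bool" where
  "induced E W u v \<longleftrightarrow> E u v \<and> u \<in> W \<and> v \<in> W"

definition is_partition :: "nat list \<Rightarrow> bool" where
  "is_partition la \<longleftrightarrow> sorted_wrt (\<ge>) la \<and> 0 \<notin> set la"

definition mult_part :: "nat \<Rightarrow> nat list \<Rightarrow> nat" where
  "mult_part k la = count (mset la) k"

text \<open>Variables are indexed by nat; a monomial is a finitely supported exponent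
vector alpha.\<close>

definition monomial :: "(nat \<Rightarrow> nat) \<Rightarrow> bool" where
  "monomial \<alpha> \<longleftrightarrow> finite {i. \<alpha> i \<noteq> 0}"

definition mdeg :: "(nat \<Rightarrow> nat) \<Rightarrow> nat" where
  "mdeg \<alpha> = (\<Sum>i\<in>{i. \<alpha> i \<noteq> 0}. \<alpha> i)"

definition proper_set_coloring :: "'a set \<Rightarrow> ('a \<Rightarrow> 'a \<Rightarrow> bool) \<Rightarrow> ('a \<Rightarrow> nat set) \<Rightarrow> bool" where
  "proper_set_coloring V E \<kappa> \<longleftrightarrow> (\<forall>v\<in>V. \<kappa> v \<noteq> {}) \<and> (\<forall>v. v \<notin> V \<longrightarrow> \<kappa> v = {})
     \<and> (\<forall>u\<in>V. \<forall>v\<in>V. E u v \<longrightarrow> \<kappa> u \<inter> \<kappa> v = {})"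

definition kromatic_coeff :: "'a set \<Rightarrow> ('a \<Rightarrow> 'a \<Rightarrow> bool) \<Rightarrow> (nat \<Rightarrow> nat) \<Rightarrow> nat" where
  "kromatic_coeff V E \<alpha> = card {\<kappa>. proper_set_coloring V E \<kappa> \<and>
       (\<forall>i. card {v\<in>V. i \<in> \<kappa> v} = \<alpha> i)}"

text \<open>Coefficient of x^alpha in pbar_mu = prod_j (prod_i (1 + x_i^(mu_j)) - 1):
each factor pbar_k is the sum over nonempty finite sets S of prod_(i in S) x_i^k.\<close>
definition pbar_coeff :: "nat list \<Rightarrow> (nat \<Rightarrow> nat) \<Rightarrow> nat" where
  "pbar_coeff \<mu> \<alpha> = card {Ss :: nat set list. length Ss = length \<mu> \<and>
       (\<forall>S\<in>set Ss. S \<noteq> {} \<and> finite S) \<and>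
       (\<forall>i. \<alpha> i = (\<Sum>j<length \<mu>. if i \<in> Ss ! j then \<mu> ! j else 0))}"

text \<open>c is the family of coefficients of the pbar-expansion of the Kromatic
symmetric function: equality coefficientwise (only partitions with
|mu| <= deg alpha can contribute to x^alpha).\<close>
definition is_pbar_expansion ::
  "'a set \<Rightarrow> ('a \<Rightarrow> 'a \<Rightarrow> bool) \<Rightarrow> (nat list \<Rightarrow> rat) \<Rightarrow> bool" where
  "is_pbar_expansion V E c \<longleftrightarrow> (\<forall>\<alpha>. monomial \<alpha> \<longrightarrow>
     of_nat (kromatic_coeff V E \<alpha>) =
       (\<Sum>\<mu>\<in>{\<mu>. is_partition \<mu> \<and> sum_list \<mu> \<le> mdeg \<alpha>}. c \<mu> * of_nat (pbar_coeff \<mu> \<alpha>)))"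

definition comm_step :: "('a \<Rightarrow> 'a \<Rightarrow> bool) \<Rightarrow> 'a list \<Rightarrow> 'a list \<Rightarrow> bool" where
  "comm_step E xs ys \<longleftrightarrow> (\<exists>p u v s. u \<noteq> v \<and> \<not> E u v \<and> \<not> E v u \<and>
      xs = p @ [u, v] @ s \<and> ys = p @ [v, u] @ s)"

text \<open>A heap is represented by its equivalence class of words.\<close>
definition heap_class :: "('a \<Rightarrow> 'a \<Rightarrow> bool) \<Rightarrow> 'a list \<Rightarrow> 'a list set" where
  "heap_class E w = {w'. (\<lambda>x y. comm_step E x y \<or> comm_step E y x)\<^sup>*\<^sup>* w w'}"

definition prec :: "('a \<Rightarrow> 'a \<Rightarrow> bool) \<Rightarrow> 'a list \<Rightarrow> nat \<Rightarrow> nat \<Rightarrow> bool" where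
  "prec E w i j \<longleftrightarrow> i < j \<and> j < length w \<and> (w ! i = w ! j \<or> E (w ! i) (w ! j))"

definition pyramid :: "('a \<Rightarrow> 'a \<Rightarrow> bool) \<Rightarrow> 'a list set \<Rightarrow> bool" where
  "pyramid E H \<longleftrightarrow> (\<exists>w\<in>H. card {j. j < length w \<and> (\<forall>i. \<not> (prec E w)\<^sup>+\<^sup>+ i j)} = 1)"

definition periodic :: "('a \<Rightarrow> 'a \<Rightarrow> bool) \<Rightarrow> 'a list set \<Rightarrow> bool" where
  "periodic E H \<longleftrightarrow> (\<exists>k m. m > 1 \<and> H = heap_class E (concat (replicate m k)))"

text \<open>One rotation step A_p on a representative word w at piece (position) i:
the pieces above p (forming V_p) are moved in front of the rest U.  After the step the
piece p sits at position 0.\<close>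
definition rot :: "('a \<Rightarrow> 'a \<Rightarrow> bool) \<Rightarrow> 'a list \<Rightarrow> nat \<Rightarrow> 'a list" where
  "rot E w i = nths w {j. (prec E w)\<^sup>*\<^sup>* i j} @ nths w {j. \<not> (prec E w)\<^sup>*\<^sup>* i j}"

text \<open>Q is A_p^infinity(P) for some piece p of P: iterate A_p until it
stabilizes at a pyramid with unique minimal piece p.\<close>
definition rotation_equiv :: "('a \<Rightarrow> 'a \<Rightarrow> bool) \<Rightarrow> 'a list set \<Rightarrow> 'a list set \<Rightarrow> bool" where
  "rotation_equiv E P Q \<longleftrightarrow> (\<exists>w\<in>P. \<exists>i<length w. \<exists>n.
      let w' = ((\<lambda>u. rot E u 0) ^^ n) (rot E w i) in
      (\<forall>j<length w'. (prec E w')\<^sup>*\<^sup>* 0 j) \<and> Q = heap_class E w')"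

definition lex_le :: "'a::linorder list \<Rightarrow> 'a list \<Rightarrow> bool" where
  "lex_le xs ys \<longleftrightarrow> xs = ys \<or> (xs, ys) \<in> lexord {(x, y). x < y}"

definition std_word :: "'a::linorder list set \<Rightarrow> 'a list" where
  "std_word H = (THE w. w \<in> H \<and> (\<forall>w'\<in>H. lex_le w' w))"

definition lyndon :: "('a::linorder \<Rightarrow> 'a \<Rightarrow> bool) \<Rightarrow> 'a list set \<Rightarrow> bool" where
  "lyndon E H \<longleftrightarrow> pyramid E H \<and> \<not> periodic E H \<and>
     (\<forall>Q. rotation_equiv E H Q \<longrightarrow> lex_le (std_word H) (std_word Q))"

definition lyndon_heaps :: "('a::linorder \<Rightarrow> 'a \<Rightarrow> bool) \<Rightarrow> 'a set \<Rightarrow> nat \<Rightarrow> 'a list set set" where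
  "lyndon_heaps E W k = {H. \<exists>w. set w \<subseteq> W \<and> length w = k \<and>
      H = heap_class (induced E W) w \<and> lyndon (induced E W) H}"

definition uses :: "'a list set \<Rightarrow> 'a \<Rightarrow> bool" where
  "uses H v \<longleftrightarrow> (\<exists>w\<in>H. v \<in> set w)"

definition multichoose :: "nat \<Rightarrow> nat \<Rightarrow> nat" where
  "multichoose n r = (n + r - 1) choose r"

definition lyndon_families ::
  "'a::linorder set \<Rightarrow> ('a \<Rightarrow> 'a \<Rightarrow> bool) \<Rightarrow> nat list \<Rightarrow> (nat \<Rightarrow> 'a list set multiset) set" where
  "lyndon_families V E la = {M. (\<forall>k. size (M k) = mult_part k la) \<and>
     (\<forall>k. odd k \<longrightarrow> (\<forall>H. count (M k) H \<le> 1) \<and> (\<forall>H\<in>#M k. H \<in> lyndon_heaps E V k)) \<and>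
     (\<forall>k. even k \<longrightarrow> (\<forall>H\<in>#M k. \<exists>j. 2 ^ j dvd k \<and> even (k div 2 ^ j) \<and>
                          H \<in> lyndon_heaps E V (k div 2 ^ j))) \<and>
     (\<forall>v\<in>V. \<exists>k. \<exists>H\<in>#M k. uses H v)}"

end

theory Submission
  imports Defs "HOL-Computational_Algebra.Computational_Algebra" "HOL-Library.FuncSet"
begin

text \<open>Allowing empty colour sets, set colourings of the induced graph on W are counted by the
  product over the variables x of the independence polynomial I(x) of W, and inclusion-exclusion
  over W recovers the Kromatic function. By Cartier and Foata, 1 / I(-t) counts heaps; pointing a
  heap at a piece splits it as U \<circ> P with P a pyramid, so the logarithmic derivative of the heap
  series counts pyramids. Every pyramid is uniquely a power of an aperiodic one, and a rotation class
  of aperiodic pyramids of size k has exactly k elements, one for each piece. Hence I(-t) is the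
  product over k of (1 - t^k)^L(k), where L(k) counts Lyndon heaps. Substituting -t for t and using
  1 / (1 - t^k) = (1 + t^k) (1 + t^(2k)) (1 + t^(4k)) ... for even k, one gets I(x) as a product of
  powers of 1 + x^k; multiplying over the variables turns 1 + x^k into 1 + pbar_k, and the binomial
  series gives the coefficients.\<close>

section \<open>Words\<close>

text \<open>Two obstacles shape the development. The iterated rotations in
  \<open>rotation_equiv\<close> act on positions of words and are awkward to compose or invert. They
  are replaced by conjugacy of heaps, u X = X w with X supported on u (\<open>conj_by\<close>),
  which composes and has inverses; a pyramid conjugate to u is determined by its base v and by the
  number of copies of v in X modulo that in u. If two rotations of h coincide, some X commutes with
  h, and comparing letter ratios in the projections shows that h is periodic; this is why an
  aperiodic class of size k has k members. The other obstacle is that the exponent of 1 + t^k may be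
  negative for even k, so the product is not a finite set of choices. Identities about such products
  are counted for natural exponents, where each factor is a box taken or left, and carried over to
  rational exponents because both sides are polynomials in them. Negative exponents are also the
  source of the multisets and, through (-1)^r (-S choose r), of the sign. Since c is an arbitrary
  family with the expansion property, uniqueness of the expansion is needed; it comes from
  triangularity on the monomials of partitions.\<close>

abbreviation word_pow :: "'a list \<Rightarrow> nat \<Rightarrow> 'a list" where
  "word_pow w n \<equiv> concat (replicate n w)"

lemma word_pow_add: "word_pow w (m + n) = word_pow w m @ word_pow w n"
  by (simp add: replicate_add)

lemma word_pow_mult: "word_pow (word_pow w m) n = word_pow w (m * n)"
  by (induction n) (simp_all add: word_pow_add)

lemma word_pow_commute: "word_pow w n @ w = w @ word_pow w n"
  by (induction n) auto

lemma length_word_pow [simp]: "length (word_pow w n) = n * length w"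
  by (induction n) auto

lemma filter_word_pow: "filter P (word_pow w n) = word_pow (filter P w) n"
  by (induction n) auto

lemma set_word_pow: "n > 0 \<Longrightarrow> set (word_pow w n) = set w"
  by (induction n) auto

lemma count_list_word_pow [simp]: "count_list (word_pow w n) a = n * count_list w a"
  by (induction n) auto

text \<open>Both x and y commute with the common power W, so x y and y x are each the prefix of W W
  of length |x| + |y|.\<close>

lemma word_pow_eq_imp_commute:
  assumes "word_pow x a = word_pow y b" "a > 0" "b > 0"
  shows "x @ y = y @ x"
proof -
  define W where "W = word_pow x a"
  have W1: "x @ W = W @ x" unfolding W_def by (simp add: word_pow_commute)
  have W2: "y @ W = W @ y" unfolding W_def assms(1) by (simp add: word_pow_commute)
  have len: "length x \<le> length W" "length y \<le> length W"
    using assms by (simp_all add: W_def) (metis length_word_pow mult_le_cancel1 less_le_trans le_add1 mult_Suc Suc_pred)+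
  have *: "take (length x + length y) (W @ W) = u @ v"
    if "u @ W = W @ u" "v @ W = W @ v" "length u + length v = length x + length y" for u v
  proof -
    have "(u @ v) @ (W @ W) = (W @ W) @ (u @ v)"
      using that(1,2) by (metis append.assoc)
    hence "take (length x + length y) ((u @ v) @ (W @ W)) = take (length x + length y) ((W @ W) @ (u @ v))"
      by simp
    thus ?thesis using that(3) len by (simp del: append_assoc)
  qed
  show ?thesis using *[OF W1 W2] *[OF W2 W1] by simp
qed

lemma word_pow_eq_common_root:
  assumes "word_pow x a = word_pow y b" "a > 0" "b > 0"
  obtains z m n where "x = word_pow z m" "y = word_pow z n"
  using comm_append_are_replicate[OF word_pow_eq_imp_commute[OF assms]] that by metis

text \<open>Copies of x are stripped from the front of u until the rest of u is a prefix of x, say x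
  = u s; then y = (s u)^m.\<close>

lemma word_pow_conjugate:
  assumes "word_pow x m @ u = u @ y"
  shows "\<exists>z. y = word_pow z m"
proof (cases "x = [] \<or> m = 0")
  case True
  hence "word_pow x m = []" by auto
  with assms have "y = []" by simp
  hence "y = word_pow [] m" by simp
  thus ?thesis ..
next
  case False
  show ?thesis using assms
  proof (induction u rule: length_induct)
    case (1 u)
    obtain k where k: "m = Suc k" using False by (cases m) auto
    have eq: "x @ (word_pow x k @ u) = u @ y" using 1(2) k by simp
    then obtain s where "(x = u @ s \<and> s @ word_pow x k @ u = y) \<or> (u = x @ s \<and> word_pow x k @ u = s @ y)"
      by (auto simp: append_eq_append_conv2)
    thus ?case
    proof
      assume s: "x = u @ s \<and> s @ word_pow x k @ u = y"
      have "s @ word_pow (u @ s) j @ u = word_pow (s @ u) (Suc j)" for j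
        by (induction j) auto
      thus ?thesis using s k by metis
    next
      assume s: "u = x @ s \<and> word_pow x k @ u = s @ y"
      hence "word_pow x m @ s = s @ y"
        using k by (metis append.assoc concat.simps(2) replicate_Suc word_pow_commute)
      moreover have "length s < length u" using s False by simp
      ultimately show ?thesis using 1(1) by blast
    qed
  qed
qed

text \<open>With a = b it records the number of copies of a single letter; since \<open>dep\<close>
  is reflexive, letter counts are part of the projections that define \<open>teq\<close>.\<close>

definition proj :: "'a \<Rightarrow> 'a \<Rightarrow> 'a list \<Rightarrow> 'a list" where
  "proj a b = filter (\<lambda>x. x = a \<or> x = b)"

lemma proj_simps [simp]:
  "proj a b [] = []"
  "proj a b (x # w) = (if x = a \<or> x = b then x # proj a b w else proj a b w)"
  "proj a b (u @ v) = proj a b u @ proj a b v"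
  by (auto simp: proj_def)

lemma proj_word_pow [simp]: "proj a b (word_pow w n) = word_pow (proj a b w) n"
  by (simp add: proj_def filter_word_pow)

lemma count_list_proj [simp]:
  "count_list (proj a b w) a = count_list w a" "count_list (proj a b w) b = count_list w b"
  by (induction w) auto

lemma proj_eq_Nil_iff: "proj a b w = [] \<longleftrightarrow> a \<notin> set w \<and> b \<notin> set w"
  by (auto simp: proj_def filter_empty_conv)

lemma length_proj_le: "length (proj a b w) \<le> length w"
  by (simp add: proj_def)

lemma set_proj: "set (proj a b w) = set w \<inter> {a, b}"
  by (auto simp: proj_def)

section \<open>Traces\<close>

locale dependence =
  fixes E :: "'a \<Rightarrow> 'a \<Rightarrow> bool"
  assumes E_sym: "E u v \<Longrightarrow> E v u"
begin

definition dep :: "'a \<Rightarrow> 'a \<Rightarrow> bool" where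
  "dep a b \<longleftrightarrow> a = b \<or> E a b"

lemma dep_refl [simp]: "dep a a" by (simp add: dep_def)
lemma dep_sym: "dep a b \<Longrightarrow> dep b a" using E_sym by (auto simp: dep_def)
lemma dep_commute: "dep a b \<longleftrightarrow> dep b a" using dep_sym by blast

text \<open>Equality of traces is expressed by the projections to pairs of dependent letters, which
  turns cancellation and root extraction into statements about words.\<close>
definition teq :: "'a list \<Rightarrow> 'a list \<Rightarrow> bool" (infix "\<approx>" 50) where
  "u \<approx> v \<longleftrightarrow> (\<forall>a b. dep a b \<longrightarrow> proj a b u = proj a b v)"

lemma teqI: "(\<And>a b. dep a b \<Longrightarrow> proj a b u = proj a b v) \<Longrightarrow> u \<approx> v"
  by (simp add: teq_def)
lemma teqD: "u \<approx> v \<Longrightarrow> dep a b \<Longrightarrow> proj a b u = proj a b v"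
  by (simp add: teq_def)

lemma teq_refl [simp]: "u \<approx> u" by (simp add: teq_def)
lemma teq_sym: "u \<approx> v \<Longrightarrow> v \<approx> u" by (simp add: teq_def)
lemma teq_trans [trans]: "u \<approx> v \<Longrightarrow> v \<approx> w \<Longrightarrow> u \<approx> w" by (simp add: teq_def)
lemma teq_append: "u \<approx> v \<Longrightarrow> u' \<approx> v' \<Longrightarrow> u @ u' \<approx> v @ v'" by (simp add: teq_def)
lemma teq_append_cancel_left [simp]: "w @ u \<approx> w @ v \<longleftrightarrow> u \<approx> v" by (auto simp: teq_def)
lemma teq_append_cancel_right [simp]: "u @ w \<approx> v @ w \<longleftrightarrow> u \<approx> v" by (auto simp: teq_def)
lemma teq_Cons_cancel [simp]: "x # u \<approx> x # v \<longleftrightarrow> u \<approx> v"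
  using teq_append_cancel_left[of "[x]"] by simp
lemma teq_word_pow: "u \<approx> v \<Longrightarrow> word_pow u n \<approx> word_pow v n"
  by (induction n) (auto intro: teq_append)

lemma teq_count: "u \<approx> v \<Longrightarrow> count_list u a = count_list v a"
  by (metis count_list_proj(1) dep_refl teqD)

lemma teq_mset: "u \<approx> v \<Longrightarrow> mset u = mset v"
  by (rule multiset_eqI) (simp add: teq_count count_mset)

lemma teq_length: "u \<approx> v \<Longrightarrow> length u = length v"
  using teq_mset by (metis size_mset)
lemma teq_set: "u \<approx> v \<Longrightarrow> set u = set v"
  using teq_mset by (metis set_mset_mset)
lemma teq_Nil_iff [simp]: "u \<approx> [] \<longleftrightarrow> u = []" "[] \<approx> u \<longleftrightarrow> u = []"
  using teq_length by fastforce+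

lemma teq_move_front:
  assumes "\<forall>c\<in>set w1. \<not> dep y c"
  shows "w1 @ y # w2 \<approx> y # w1 @ w2"
proof (rule teqI)
  fix a b assume ab: "dep a b"
  show "proj a b (w1 @ y # w2) = proj a b (y # w1 @ w2)"
  proof (cases "y = a \<or> y = b")
    case True
    have "a \<notin> set w1" "b \<notin> set w1"
      using True assms ab dep_refl dep_sym by blast+
    hence "proj a b w1 = []" by (simp add: proj_eq_Nil_iff)
    thus ?thesis by simp
  qed simp
qed

text \<open>If a letter c dependent on y stood before the first y, the projection to y and c would
  begin with c.\<close>

lemma first_letter_split:
  assumes "\<And>b. dep y b \<Longrightarrow> \<exists>s. proj y b w = y # s"
  obtains w1 w2 where "w = w1 @ y # w2" "\<forall>c\<in>set w1. \<not> dep y c"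
proof -
  have "y \<in> set w"
    using assms[of y] by (metis dep_refl proj_eq_Nil_iff list.distinct(1))
  then obtain w1 w2 where w: "w = w1 @ y # w2" "y \<notin> set w1"
    by (meson split_list_first)
  have "\<not> dep y c" if c: "c \<in> set w1" for c
  proof
    assume d: "dep y c"
    obtain s where s: "proj y c w = y # s" using assms[OF d] by blast
    have "c \<in> set (proj y c w1)" "y \<notin> set (proj y c w1)" using c w by (auto simp: set_proj)
    moreover have "proj y c w1 \<noteq> []" using calculation(1) by auto
    ultimately have "hd (proj y c w) \<noteq> y" using w
      by (metis hd_append2 hd_in_set proj_simps(3))
    thus False using s by simp
  qed
  thus ?thesis using that w by blast
qed

text \<open>Divisibility of traces can be tested on projections: the first letter of x leads all its
  projections of w to dependent pairs, so it can be moved to the front of w and cancelled.\<close>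

lemma proj_prefix_imp:
  assumes "\<And>a b. dep a b \<Longrightarrow> \<exists>s. proj a b w = proj a b x @ s"
  shows "\<exists>z. w \<approx> x @ z"
  using assms
proof (induction x arbitrary: w)
  case Nil
  thus ?case by (auto intro: teq_refl)
next
  case (Cons y x)
  have "\<exists>s. proj y b w = y # s" if "dep y b" for b
    using Cons.prems[OF that] by auto
  then obtain w1 w2 where w: "w = w1 @ y # w2" "\<forall>c\<in>set w1. \<not> dep y c"
    by (rule first_letter_split) auto
  have w': "w \<approx> y # w1 @ w2" using teq_move_front w by simp
  have "\<exists>s. proj a b (w1 @ w2) = proj a b x @ s" if d: "dep a b" for a b
  proof -
    obtain s where "proj a b w = proj a b (y # x) @ s" using Cons.prems[OF d] by blast
    with teqD[OF w' d] have "proj a b (w1 @ w2) = proj a b x @ s" by (simp split: if_splits)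
    thus ?thesis ..
  qed
  from Cons.IH[OF this] obtain z where "w1 @ w2 \<approx> x @ z" by blast
  hence "y # w1 @ w2 \<approx> (y # x) @ z" by simp
  with w' show ?case using teq_trans by blast
qed

text \<open>The word r keeps the first n x copies of each letter x of w. The prefixes z fit together
  because the counts n do not depend on the pair.\<close>

lemma proj_family_realisable:
  assumes "\<And>a b. dep a b \<Longrightarrow> \<exists>s. proj a b w = z a b @ s"
    and "\<And>a b. dep a b \<Longrightarrow> count_list (z a b) a = n a \<and> count_list (z a b) b = n b"
  shows "\<exists>r. \<forall>a b. dep a b \<longrightarrow> proj a b r = z a b"
  using assms
proof (induction w arbitrary: z n)
  case Nil
  hence "\<forall>a b. dep a b \<longrightarrow> proj a b [] = z a b" by fastforce
  thus ?case by blast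
next
  case (Cons x w)
  show ?case
  proof (cases "n x = 0")
    case True
    \<comment> \<open>No copy of x is left to keep, yet x comes first in the projection, so a prefix
      free of x is empty.\<close>
    have z0: "z a b = []" if ab: "dep a b" and x: "x = a \<or> x = b" for a b
    proof -
      obtain s where "x # proj a b w = z a b @ s" using Cons.prems(1)[OF ab] x by auto
      moreover have "x \<notin> set (z a b)"
        using Cons.prems(2)[OF ab] x True by (auto simp: count_list_0_iff)
      ultimately show ?thesis by (cases "z a b") auto
    qed
    have "\<exists>s. proj a b w = z a b @ s" if "dep a b" for a b
      using z0[of a b] Cons.prems(1)[of a b] that by (cases "x = a \<or> x = b") auto
    from Cons.IH[OF this Cons.prems(2)] show ?thesis by blast
  next
    case False
    define z' where "z' a b = (if x = a \<or> x = b then tl (z a b) else z a b)" for a b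
    have zx: "z a b = x # z' a b" if "dep a b" "x = a \<or> x = b" for a b
    proof -
      have "count_list (z a b) x \<noteq> 0" using that Cons.prems(2)[OF that(1)] False by auto
      hence "z a b \<noteq> []" by auto
      thus ?thesis using Cons.prems(1)[OF that(1)] that(2) by (cases "z a b") (auto simp: z'_def)
    qed
    have zn: "z a b = z' a b" if "\<not> (x = a \<or> x = b)" for a b
      using that by (simp add: z'_def)
    have "\<exists>s. proj a b w = z' a b @ s" if "dep a b" for a b
      using Cons.prems(1)[of a b] zx[of a b] zn[of a b] that by (cases "x = a \<or> x = b") auto
    moreover have "count_list (z' a b) a = (n(x := n x - 1)) a \<and> count_list (z' a b) b = (n(x := n x - 1)) b"
      if "dep a b" for a b
      using Cons.prems(2)[of a b] zx[of a b] zn[of a b] that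
      by (cases "x = a"; cases "x = b") auto
    ultimately obtain r where r: "\<forall>a b. dep a b \<longrightarrow> proj a b r = z' a b"
      using Cons.IH[of z' "n(x := n x - 1)"] by blast
    have "\<forall>a b. dep a b \<longrightarrow> proj a b (x # r) = z a b"
      using r zx zn by auto
    thus ?thesis by blast
  qed
qed

text \<open>The roots of the projections glue: they are prefixes of the projections of w, and each
  contains a letter a of its pair exactly \<open>count_list w a div m\<close> times, whatever the
  other letter is.\<close>

lemma proj_powers_imp_power:
  assumes "\<And>a b. dep a b \<Longrightarrow> \<exists>z. proj a b w = word_pow z m" "m > 0"
  shows "\<exists>r. w \<approx> word_pow r m"
proof -
  obtain z where z: "\<And>a b. dep a b \<Longrightarrow> proj a b w = word_pow (z a b) m"
    using assms(1) by metis
  obtain k where k: "m = Suc k" using assms(2) by (cases m) auto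
  have "\<exists>s. proj a b w = z a b @ s" if "dep a b" for a b
    using z[OF that] k by auto
  moreover have "count_list (z a b) a = count_list w a div m \<and> count_list (z a b) b = count_list w b div m"
    if "dep a b" for a b
    using count_list_proj[of a b w] z[OF that] assms(2)
    by (metis count_list_word_pow nonzero_mult_div_cancel_left not_less_zero)
  ultimately obtain r where "\<forall>a b. dep a b \<longrightarrow> proj a b r = z a b"
    using proj_family_realisable[of w z "\<lambda>a. count_list w a div m"] by blast
  hence "w \<approx> word_pow r m" using z by (auto intro!: teqI)
  thus ?thesis by blast
qed

lemma teq_word_pow_cancel:
  assumes "word_pow u m \<approx> word_pow v m" "m > 0"
  shows "u \<approx> v"
proof (rule teqI)
  fix a b assume "dep a b"
  hence eq: "word_pow (proj a b u) m = word_pow (proj a b v) m" using teqD[OF assms(1)] by simp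
  hence "length (proj a b u) = length (proj a b v)"
    using assms(2) by (metis length_word_pow mult_left_cancel not_less_zero)
  thus "proj a b u = proj a b v" using eq assms(2)
    by (cases m) auto
qed

subsection \<open>Heap classes\<close>

lemma comm_step_teq: "comm_step E u v \<Longrightarrow> u \<approx> v"
  unfolding comm_step_def teq_def dep_def by auto

lemma comm_steps_Cons:
  assumes "(\<lambda>x y. comm_step E x y \<or> comm_step E y x)\<^sup>*\<^sup>* u v"
  shows "(\<lambda>x y. comm_step E x y \<or> comm_step E y x)\<^sup>*\<^sup>* (c # u) (c # v)"
  using assms
proof (induction rule: rtranclp_induct)
  case (step y z)
  have "comm_step E (c # s) (c # t)" if "comm_step E s t" for s t
    using that unfolding comm_step_def by (metis append_Cons)
  thus ?case using step by (metis (no_types, lifting) rtranclp.rtrancl_into_rtrancl)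
qed simp

lemma comm_steps_move_front:
  assumes "\<forall>c\<in>set w1. \<not> dep y c"
  shows "(\<lambda>x y. comm_step E x y \<or> comm_step E y x)\<^sup>*\<^sup>* (y # w1 @ w2) (w1 @ y # w2)"
  using assms
proof (induction w1)
  case (Cons c w1)
  have "y \<noteq> c" "\<not> E y c" "\<not> E c y" using Cons.prems E_sym by (auto simp: dep_def)
  hence "comm_step E (y # c # w1 @ w2) (c # y # w1 @ w2)"
    unfolding comm_step_def by (metis append_Cons append_Nil)
  moreover have "(\<lambda>x y. comm_step E x y \<or> comm_step E y x)\<^sup>*\<^sup>* (c # y # w1 @ w2) (c # w1 @ y # w2)"
    using Cons by (intro comm_steps_Cons) auto
  ultimately show ?case
    by (metis (no_types, lifting) append_Cons converse_rtranclp_into_rtranclp)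
qed simp

text \<open>The first letter of u leads the projections of v to its dependent pairs, so in v only
  independent letters precede it. Adjacent swaps bring it to the front, and induction handles the
  rest. Projections therefore lose nothing compared with commutation classes.\<close>

lemma teq_imp_comm_steps:
  "u \<approx> v \<Longrightarrow> (\<lambda>x y. comm_step E x y \<or> comm_step E y x)\<^sup>*\<^sup>* u v"
proof (induction u arbitrary: v)
  case (Cons y u)
  have "\<exists>s. proj y b v = y # s" if "dep y b" for b
    using teqD[OF Cons.prems that] by (metis (full_types) proj_simps(2))
  then obtain v1 v2 where v: "v = v1 @ y # v2" "\<forall>c\<in>set v1. \<not> dep y c"
    by (rule first_letter_split) auto
  hence "v \<approx> y # v1 @ v2" using teq_move_front by simp
  hence "u \<approx> v1 @ v2" using Cons.prems teq_trans teq_Cons_cancel by blast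
  hence "(\<lambda>x y. comm_step E x y \<or> comm_step E y x)\<^sup>*\<^sup>* (y # u) (y # v1 @ v2)"
    by (intro comm_steps_Cons Cons.IH)
  thus ?case using comm_steps_move_front[OF v(2), of v2] v(1)
    by (metis (no_types, lifting) rtranclp_trans)
qed simp

lemma heap_class_teq: "heap_class E w = {w'. w \<approx> w'}"
proof -
  have "w \<approx> w'" if "(\<lambda>x y. comm_step E x y \<or> comm_step E y x)\<^sup>*\<^sup>* w w'" for w'
    using that by (induction rule: rtranclp_induct) (auto intro: teq_trans teq_sym dest: comm_step_teq)
  thus ?thesis unfolding heap_class_def using teq_imp_comm_steps by blast
qed

lemma heap_class_eq_iff: "heap_class E u = heap_class E v \<longleftrightarrow> u \<approx> v"
  unfolding heap_class_teq using teq_refl teq_sym teq_trans by blast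

lemma mem_heap_class_iff: "v \<in> heap_class E u \<longleftrightarrow> u \<approx> v"
  by (simp add: heap_class_teq)

end

section \<open>Occurrences of letters in words and subwords\<close>

lemma count_list_nths_cong:
  assumes "\<And>j. j < length w \<Longrightarrow> w ! j = v \<Longrightarrow> j \<in> A \<longleftrightarrow> j \<in> B"
  shows "count_list (nths w A) v = count_list (nths w B) v"
  using assms
proof (induction w arbitrary: A B)
  case (Cons x w)
  have "count_list (nths w {j. Suc j \<in> A}) v = count_list (nths w {j. Suc j \<in> B}) v"
    using Cons.prems[of "Suc _"] by (intro Cons.IH) auto
  moreover have "x = v \<Longrightarrow> 0 \<in> A \<longleftrightarrow> 0 \<in> B" using Cons.prems[of 0] by auto
  ultimately show ?case by (auto simp: nths_Cons)
qed simp

lemma nths_eq_append_ConsD: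
  assumes "nths w A = w1 @ y # w2"
  obtains j where "j < length w" "j \<in> A" "w ! j = y" "\<And>i. i < j \<Longrightarrow> i \<in> A \<Longrightarrow> w ! i \<in> set w1"
proof -
  have "\<exists>j<length w. j \<in> A \<and> w ! j = y \<and> (\<forall>i<j. i \<in> A \<longrightarrow> w ! i \<in> set w1)"
    using assms
  proof (induction w arbitrary: A w1)
    case (Cons x w)
    show ?case
    proof (cases "0 \<in> A \<and> w1 = []")
      case True
      thus ?thesis using Cons.prems by (intro exI[of _ 0]) (auto simp: nths_Cons)
    next
      case False
      obtain w1' where w1': "nths w {j. Suc j \<in> A} = w1' @ y # w2" "0 \<in> A \<longrightarrow> w1 = x # w1'" "set w1' \<subseteq> set w1"
        using Cons.prems False by (cases w1) (auto simp: nths_Cons split: if_splits)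
      from Cons.IH[OF this(1)] obtain j where
        j: "j < length w" "Suc j \<in> A" "w ! j = y" "\<forall>i<j. Suc i \<in> A \<longrightarrow> w ! i \<in> set w1'" by auto
      have "(x # w) ! i \<in> set w1" if "i < Suc j" "i \<in> A" for i
        using that j w1' by (cases i) auto
      thus ?thesis using j by (intro exI[of _ "Suc j"]) auto
    qed
  qed simp
  thus ?thesis using that by blast
qed

text \<open>Equal letters never pass one another, so a piece of a heap is named, independently of
  the representative, by its letter and the number of earlier copies. In a given word the name
  yields a position.\<close>

lemma obtain_occurrence:
  assumes "r < count_list w v"
  obtains i where "i < length w" "w ! i = v" "count_list (take i w) v = r"
proof -
  have "\<exists>i<length w. w ! i = v \<and> count_list (take i w) v = r"
    using assms
  proof (induction w arbitrary: r)
    case (Cons x w)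
    show ?case
    proof (cases "x = v \<and> r = 0")
      case True
      thus ?thesis by (intro exI[of _ 0]) auto
    next
      case False
      define r' where "r' = (if x = v then r - 1 else r)"
      have "r' < count_list w v" using Cons.prems False by (auto simp: r'_def split: if_splits)
      from Cons.IH[OF this] obtain i where "i < length w" "w ! i = v" "count_list (take i w) v = r'"
        by blast
      thus ?thesis using False by (intro exI[of _ "Suc i"]) (auto simp: r'_def)
    qed
  qed simp
  thus ?thesis using that by blast
qed

context dependence
begin

subsection \<open>Minimal letters and pyramids\<close>

text \<open>Letters suffice to describe minimal pieces: pieces with the same letter are comparable,
  so minimal pieces carry distinct letters.\<close>

definition mins :: "'a list \<Rightarrow> 'a set" where
  "mins w = {x. \<exists>w'. w \<approx> x # w'}"

lemma mins_teq: "u \<approx> v \<Longrightarrow> mins u = mins v"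
  unfolding mins_def using teq_sym teq_trans by blast

lemma mins_iff_split: "x \<in> mins w \<longleftrightarrow> (\<exists>w1 w2. w = w1 @ x # w2 \<and> (\<forall>c\<in>set w1. \<not> dep x c))"
proof
  assume "x \<in> mins w"
  then obtain w' where w': "w \<approx> x # w'" by (auto simp: mins_def)
  have "\<exists>s. proj x b w = x # s" if "dep x b" for b
    using teqD[OF w' that] by simp
  thus "\<exists>w1 w2. w = w1 @ x # w2 \<and> (\<forall>c\<in>set w1. \<not> dep x c)"
    by (rule first_letter_split) auto
qed (use teq_move_front in \<open>auto simp: mins_def\<close>)

lemma mins_subset: "mins w \<subseteq> set w"
  by (auto simp: mins_iff_split)

lemma finite_mins [simp]: "finite (mins w)"
  using finite_subset[OF mins_subset] by simp

lemma Cons_in_mins [simp]: "x \<in> mins (x # w)"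
  by (auto simp: mins_def intro: teq_refl)

lemma mins_eq_empty_iff [simp]: "mins w = {} \<longleftrightarrow> w = []"
proof (cases w)
  case Nil
  thus ?thesis using mins_subset[of w] by auto
next
  case (Cons a v)
  thus ?thesis using Cons_in_mins[of a v] by (metis empty_iff list.distinct(1))
qed

lemma mins_indep:
  assumes "x \<in> mins w" "y \<in> mins w" "x \<noteq> y"
  shows "\<not> dep x y"
proof
  assume d: "dep x y"
  obtain u v where "w \<approx> x # u" "w \<approx> y # v" using assms(1,2) by (auto simp: mins_def)
  hence "x # u \<approx> y # v" using teq_sym teq_trans by blast
  thus False using teqD[OF _ d] assms(3) by fastforce
qed

lemma mins_append: "x \<in> mins (u @ v) \<longleftrightarrow> x \<in> mins u \<or> (x \<in> mins v \<and> (\<forall>c\<in>set u. \<not> dep x c))"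
proof
  assume "x \<in> mins (u @ v)"
  then obtain w1 w2 where w: "u @ v = w1 @ x # w2" "\<forall>c\<in>set w1. \<not> dep x c"
    by (auto simp: mins_iff_split)
  have "(\<exists>t. u = w1 @ x # t) \<or> (\<exists>t. w1 = u @ t \<and> v = t @ x # w2)"
    using w(1) by (auto simp: append_eq_append_conv2 Cons_eq_append_conv append_eq_Cons_conv)
  then consider t where "u = w1 @ x # t" | t where "w1 = u @ t" "v = t @ x # w2"
    by blast
  thus "x \<in> mins u \<or> (x \<in> mins v \<and> (\<forall>c\<in>set u. \<not> dep x c))"
    using w(2) by cases (auto simp: mins_iff_split)
next
  assume "x \<in> mins u \<or> (x \<in> mins v \<and> (\<forall>c\<in>set u. \<not> dep x c))"
  thus "x \<in> mins (u @ v)"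
  proof
    assume "x \<in> mins u"
    then obtain u' where "u \<approx> x # u'" by (auto simp: mins_def)
    hence "u @ v \<approx> x # (u' @ v)" using teq_append_cancel_right[of u v "x # u'"] by simp
    thus ?thesis by (auto simp: mins_def)
  next
    assume *: "x \<in> mins v \<and> (\<forall>c\<in>set u. \<not> dep x c)"
    then obtain v' where "v \<approx> x # v'" by (auto simp: mins_def)
    hence "u @ v \<approx> u @ x # v'" by simp
    also have "u @ x # v' \<approx> x # (u @ v')" using * by (intro teq_move_front) auto
    finally show ?thesis by (auto simp: mins_def)
  qed
qed

text \<open>A heap together with one of its pieces, given as the occurrence number of a letter v, is the
  same as a factorisation whose right factor is a pyramid with base v.\<close>
lemma pyramid_factor_unique:
  assumes "mins P = {v}" "mins P' = {v}" "U @ P \<approx> U' @ P'" "count_list U v = count_list U' v"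
  shows "U \<approx> U'"
  using assms(3,4)
proof (induction U arbitrary: U')
  case Nil
  show ?case
  proof (cases U')
    case (Cons y U'')
    hence "y \<in> mins (U' @ P')" by simp
    hence "y = v" using mins_teq[OF Nil(1)] assms(1) by auto
    thus ?thesis using Nil(2) Cons by simp
  qed simp
next
  case (Cons x U)
  have "x \<in> mins (U' @ P')" using mins_teq[OF Cons.prems(1)] by (metis Cons_in_mins append_Cons)
  hence "x \<in> mins U' \<or> (x \<in> mins P' \<and> (\<forall>c\<in>set U'. \<not> dep x c))" by (simp add: mins_append)
  thus ?case
  proof
    assume "x \<in> mins U'"
    then obtain U1 where U1: "U' \<approx> x # U1" by (auto simp: mins_def)
    hence "U' @ P' \<approx> x # (U1 @ P')" using teq_append_cancel_right[of U' P' "x # U1"] by simp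
    with Cons.prems(1) have "U @ P \<approx> U1 @ P'" using teq_trans by fastforce
    moreover have "count_list U v = count_list U1 v"
      using Cons.prems(2) teq_count[OF U1, of v] by (auto split: if_splits)
    ultimately have "U \<approx> U1" by (rule Cons.IH)
    thus ?thesis using U1 teq_sym teq_trans teq_Cons_cancel by blast
  next
    assume *: "x \<in> mins P' \<and> (\<forall>c\<in>set U'. \<not> dep x c)"
    hence "x = v" "v \<notin> set U'" using assms(2) dep_refl by auto
    thus ?thesis using Cons.prems(2) by simp
  qed
qed

lemma prec_iff: "prec E w i j \<longleftrightarrow> i < j \<and> j < length w \<and> dep (w ! i) (w ! j)"
  by (auto simp: prec_def dep_def)

text \<open>A relation and its transitive closure have the same minimal elements, and reading off
  the letter is injective on minimal positions.\<close>

lemma card_minimal_pieces: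
  "card {j. j < length w \<and> (\<forall>i. \<not> (prec E w)\<^sup>+\<^sup>+ i j)} = card (mins w)"
proof -
  have *: "(\<forall>i. \<not> (prec E w)\<^sup>+\<^sup>+ i j) \<longleftrightarrow> (\<forall>i. \<not> prec E w i j)" for j
    by (auto elim: tranclp.cases)
  define M where "M = {j. j < length w \<and> (\<forall>i<j. \<not> dep (w ! i) (w ! j))}"
  have "{j. j < length w \<and> (\<forall>i. \<not> (prec E w)\<^sup>+\<^sup>+ i j)} = M"
    unfolding * prec_iff M_def by auto
  moreover have "inj_on ((!) w) M"
  proof (rule inj_onI)
    fix i j assume "i \<in> M" "j \<in> M" "w ! i = w ! j"
    thus "i = j" unfolding M_def
      by (metis (mono_tags, lifting) dep_refl linorder_neqE_nat mem_Collect_eq)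
  qed
  moreover have "(!) w ` M = mins w"
  proof (intro equalityI subsetI)
    fix x assume "x \<in> (!) w ` M"
    then obtain j where j: "j \<in> M" "x = w ! j" by auto
    hence "w = take j w @ x # drop (Suc j) w" by (simp add: M_def id_take_nth_drop)
    moreover have "\<forall>c\<in>set (take j w). \<not> dep x c"
      using j dep_commute by (auto simp: M_def in_set_conv_nth)
    ultimately show "x \<in> mins w" unfolding mins_iff_split by blast
  next
    fix x assume "x \<in> mins w"
    then obtain w1 w2 where w: "w = w1 @ x # w2" "\<forall>c\<in>set w1. \<not> dep x c"
      by (auto simp: mins_iff_split)
    hence "length w1 \<in> M" by (auto simp: M_def nth_append dep_commute[of _ x])
    thus "x \<in> (!) w ` M" using w by (auto intro!: image_eqI[of _ _ "length w1"])
  qed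
  ultimately show ?thesis by (metis card_image)
qed

lemma pyramid_iff: "pyramid E (heap_class E w) \<longleftrightarrow> (\<exists>v. mins w = {v})"
proof -
  have "pyramid E (heap_class E w) \<longleftrightarrow> (\<exists>w'\<in>heap_class E w. card (mins w') = 1)"
    by (simp add: pyramid_def card_minimal_pieces)
  also have "\<dots> \<longleftrightarrow> card (mins w) = 1"
    using mins_teq mem_heap_class_iff teq_refl by metis
  finally show ?thesis by (simp add: card_1_singleton_iff)
qed

text \<open>Connectivity of the graph of \<open>dep\<close> on A; the empty set counts as
  connected.\<close>

definition conn :: "'a set \<Rightarrow> bool" where
  "conn A \<longleftrightarrow> (\<forall>B\<subseteq>A. B \<noteq> {} \<longrightarrow> (\<forall>a\<in>B. \<forall>b\<in>A - B. \<not> dep a b) \<longrightarrow> B = A)"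

text \<open>If B contains the base v and has no dependency with the other letters, the first letter
  of w outside B has only independent letters before it and would be a second minimal letter. A part
  without v is handled through its complement.\<close>

lemma pyramid_conn:
  assumes "mins w = {v}"
  shows "conn (set w)"
proof -
  have *: "B = set w" if "B \<subseteq> set w" "v \<in> B" "\<forall>a\<in>B. \<forall>b\<in>set w - B. \<not> dep a b" for B
  proof (rule ccontr)
    assume "B \<noteq> set w"
    hence "\<exists>y\<in>set w. y \<notin> B" using that(1) by blast
    then obtain w1 y w2 where w: "w = w1 @ y # w2" "y \<notin> B" "\<forall>c\<in>set w1. \<not> c \<notin> B"
      by (rule split_list_first_propE)
    have "\<not> dep y c" if "c \<in> set w1" for c
      using w \<open>\<forall>a\<in>B. \<forall>b\<in>set w - B. \<not> dep a b\<close> that dep_commute[of y c] by auto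
    hence "y \<in> mins w" unfolding mins_iff_split using w(1) by blast
    thus False using assms that(2) w(2) by simp
  qed
  show ?thesis unfolding conn_def
  proof (intro allI impI)
    fix B assume B: "B \<subseteq> set w" "B \<noteq> {}" "\<forall>a\<in>B. \<forall>b\<in>set w - B. \<not> dep a b"
    show "B = set w"
    proof (cases "v \<in> B")
      case False
      have "v \<in> set w" using assms mins_subset by blast
      hence "set w - B = set w" using B False dep_sym by (intro *) blast+
      thus ?thesis using B by blast
    qed (use B * in blast)
  qed
qed

subsection \<open>Rotation\<close>

text \<open>The selected positions form a down-set, so each selected letter is independent of every
  unselected letter before it and can move past it.\<close>

lemma nths_split_teq:
  assumes "\<And>i j. i < j \<Longrightarrow> j < length w \<Longrightarrow> dep (w ! i) (w ! j) \<Longrightarrow> j \<in> A \<Longrightarrow> i \<in> A"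
  shows "w \<approx> nths w A @ nths w (- A)"
  using assms
proof (induction w arbitrary: A)
  case (Cons x w)
  have A: "- {j. Suc j \<in> A} = {j. Suc j \<in> - A}" by auto
  have IH: "w \<approx> nths w {j. Suc j \<in> A} @ nths w {j. Suc j \<in> - A}"
    unfolding A[symmetric] using Cons.prems[of "Suc _" "Suc _"] by (intro Cons.IH) auto
  show ?case
  proof (cases "0 \<in> A")
    case True
    thus ?thesis using IH by (simp add: nths_Cons)
  next
    case False
    have "\<not> dep x c" if c: "c \<in> set (nths w {j. Suc j \<in> A})" for c
    proof
      assume "dep x c"
      moreover obtain j where "j < length w" "Suc j \<in> A" "w ! j = c"
        using c by (auto simp: set_nths)
      ultimately show False using Cons.prems[of 0 "Suc j"] False by simp
    qed
    hence "nths w {j. Suc j \<in> A} @ x # nths w {j. Suc j \<in> - A}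
        \<approx> x # nths w {j. Suc j \<in> A} @ nths w {j. Suc j \<in> - A}"
      by (intro teq_move_front) blast
    moreover have "x # w \<approx> x # nths w {j. Suc j \<in> A} @ nths w {j. Suc j \<in> - A}"
      using IH by simp
    ultimately have "x # w \<approx> nths w {j. Suc j \<in> A} @ x # nths w {j. Suc j \<in> - A}"
      using teq_sym teq_trans by blast
    thus ?thesis using False by (simp add: nths_Cons)
  qed
qed simp

abbreviation above :: "'a list \<Rightarrow> nat \<Rightarrow> nat set" where
  "above w i \<equiv> {j. (prec E w)\<^sup>*\<^sup>* i j}"

lemma above_ge: "j \<in> above w i \<Longrightarrow> i \<le> j"
  unfolding mem_Collect_eq by (induction rule: rtranclp_induct) (auto simp: prec_def)

lemma split_above: "w \<approx> nths w (- above w i) @ nths w (above w i)"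
proof -
  have "w \<approx> nths w (- above w i) @ nths w (- (- above w i))"
    by (rule nths_split_teq) (auto simp: prec_iff intro: rtranclp.rtrancl_into_rtrancl)
  thus ?thesis by simp
qed

lemma mins_above:
  assumes "i < length w"
  shows "mins (nths w (above w i)) = {w ! i}"
proof -
  have "y = w ! i" if y: "y \<in> mins (nths w (above w i))" for y
  proof -
    obtain w1 w2 where w: "nths w (above w i) = w1 @ y # w2" "\<forall>c\<in>set w1. \<not> dep y c"
      using y by (auto simp: mins_iff_split)
    obtain j where j: "j < length w" "j \<in> above w i" "w ! j = y"
      "\<And>k. k < j \<Longrightarrow> k \<in> above w i \<Longrightarrow> w ! k \<in> set w1"
      using nths_eq_append_ConsD[OF w(1)] by blast
    show ?thesis
    proof (cases "j = i")
      case False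
      then obtain k where "k \<in> above w i" "prec E w k j"
        using j(2) by (auto elim: rtranclp.cases)
      thus ?thesis using j w(2) dep_sym by (auto simp: prec_iff)
    qed (use j in simp)
  qed
  moreover have "w ! i \<in> set (nths w (above w i))" using assms by (auto simp: set_nths)
  hence "mins (nths w (above w i)) \<noteq> {}" by auto
  ultimately show ?thesis by blast
qed

text \<open>Copies of one letter are always comparable, so the copies of \<open>w ! i\<close>
  outside the pyramid are those before position i. The left factor thus remembers which copy was
  chosen.\<close>

lemma count_not_above:
  "count_list (nths w (- above w i)) (w ! i) = count_list (take i w) (w ! i)"
proof -
  have "count_list (nths w (- above w i)) (w ! i) = count_list (nths w {..<i}) (w ! i)"
  proof (rule count_list_nths_cong)
    fix j assume j: "j < length w" "w ! j = w ! i"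
    hence "j \<in> above w i \<longleftrightarrow> i \<le> j"
      using above_ge[of j w i] by (auto simp: le_less prec_iff intro: r_into_rtranclp)
    thus "j \<in> - above w i \<longleftrightarrow> j \<in> {..<i}" by auto
  qed
  thus ?thesis by simp
qed

lemma rot_eq: "rot E w i = nths w (above w i) @ nths w (- above w i)"
  by (simp add: rot_def Collect_neg_eq)

lemma nths_above_eq_Cons:
  assumes "i < length w"
  obtains p where "nths w (above w i) = w ! i # p"
proof (cases "nths w (above w i)")
  case Nil
  thus ?thesis using mins_above[OF assms] by (metis insert_not_empty mins_eq_empty_iff)
next
  case (Cons y p)
  hence "y \<in> mins (nths w (above w i))" by simp
  hence "y = w ! i" using mins_above[OF assms] by blast
  thus ?thesis using that Cons by blast
qed

text \<open>Conjugacy of heaps, with conjugator X. The support condition keeps out letters foreign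
  to u that merely commute with everything, and so makes X a left divisor of a power of u
  (\<open>conj_by_prefix\<close>).\<close>

definition conj_by :: "'a list \<Rightarrow> 'a list \<Rightarrow> 'a list \<Rightarrow> bool" where
  "conj_by X u w \<longleftrightarrow> u @ X \<approx> X @ w \<and> set X \<subseteq> set u"

lemma conj_by_mset: "conj_by X u w \<Longrightarrow> mset u = mset w"
  unfolding conj_by_def using teq_mset by fastforce

lemma conj_by_set: "conj_by X u w \<Longrightarrow> set u = set w"
  using conj_by_mset by (metis set_mset_mset)

lemma conj_by_Nil [simp]: "conj_by [] u w \<longleftrightarrow> u \<approx> w"
  by (auto simp: conj_by_def)

lemma conj_by_trans:
  assumes "conj_by X u w" "conj_by Y w y"
  shows "conj_by (X @ Y) u y"
proof -
  have "u @ X @ Y \<approx> (X @ w) @ Y"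
    using assms teq_append_cancel_right[of "u @ X" Y "X @ w"] by (simp add: conj_by_def)
  also have "(X @ w) @ Y \<approx> X @ Y @ y" using assms by (simp add: conj_by_def)
  finally show ?thesis using assms conj_by_set[OF assms(1)] by (auto simp: conj_by_def)
qed

lemma conj_by_teq_right: "conj_by X u w \<Longrightarrow> w \<approx> w' \<Longrightarrow> conj_by X u w'"
  using conj_by_trans[of X u w "[]" w'] by simp

lemma conj_by_teq_left: "conj_by X u w \<Longrightarrow> u' \<approx> u \<Longrightarrow> conj_by X u' w"
  using conj_by_trans[of "[]" u' u X w] by simp

lemma conj_by_rot: "conj_by (nths w (- above w i)) w (rot E w i)"
proof -
  have "w @ nths w (- above w i) \<approx> (nths w (- above w i) @ nths w (above w i)) @ nths w (- above w i)"
    using split_above teq_append_cancel_right by blast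
  thus ?thesis by (simp add: conj_by_def rot_eq set_nths_subset)
qed

lemma rot_nth_0:
  assumes "i < length w"
  shows "rot E w i \<noteq> []" "rot E w i ! 0 = w ! i"
proof -
  obtain p where "nths w (above w i) = w ! i # p" using nths_above_eq_Cons[OF assms] .
  thus "rot E w i \<noteq> []" "rot E w i ! 0 = w ! i" by (simp_all add: rot_eq)
qed

text \<open>A rotation at position 0 moves only pieces not above that piece, hence no copy of its
  letter. The accumulated conjugator is free of this letter, and the occurrence number of the chosen
  piece is fixed by the very first rotation.\<close>

lemma conj_by_rot_iterate:
  assumes "u \<noteq> []"
  shows "\<exists>X. conj_by X u (((\<lambda>u. rot E u 0) ^^ n) u) \<and> count_list X (u ! 0) = 0
    \<and> ((\<lambda>u. rot E u 0) ^^ n) u \<noteq> [] \<and> ((\<lambda>u. rot E u 0) ^^ n) u ! 0 = u ! 0"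
proof (induction n)
  case 0
  have "conj_by [] u u" by simp
  thus ?case using assms by (auto intro!: exI[of _ "[]"] teq_refl)
next
  case (Suc n)
  define u' where "u' = ((\<lambda>u. rot E u 0) ^^ n) u"
  obtain X where X: "conj_by X u u'" "count_list X (u ! 0) = 0" "u' \<noteq> []" "u' ! 0 = u ! 0"
    using Suc unfolding u'_def by blast
  have "conj_by (X @ nths u' (- above u' 0)) u (rot E u' 0)"
    using X conj_by_rot conj_by_trans by blast
  moreover have "count_list (X @ nths u' (- above u' 0)) (u ! 0) = 0"
    using X count_not_above[of u' 0] by simp
  ultimately show ?case using X rot_nth_0[of 0 u'] by (auto simp: u'_def)
qed

text \<open>Translates the stabilisation test inside \<open>rotation_equiv\<close> into the language
  of minimal letters.\<close>

lemma all_above_iff_mins: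
  assumes "w \<noteq> []"
  shows "(\<forall>j<length w. (prec E w)\<^sup>*\<^sup>* 0 j) \<longleftrightarrow> mins w = {w ! 0}"
proof
  assume *: "\<forall>j<length w. (prec E w)\<^sup>*\<^sup>* 0 j"
  hence "nths w (above w 0) = w" by (intro nths_all) simp
  thus "mins w = {w ! 0}" using mins_above[of 0 w] assms by simp
next
  assume *: "mins w = {w ! 0}"
  show "\<forall>j<length w. (prec E w)\<^sup>*\<^sup>* 0 j"
  proof (intro allI impI)
    fix j assume "j < length w"
    thus "(prec E w)\<^sup>*\<^sup>* 0 j"
    proof (induction j rule: less_induct)
      case (less j)
      show ?case
      proof (cases "\<exists>i<j. dep (w ! i) (w ! j)")
        case True
        then obtain i where "i < j" "prec E w i j" using less.prems by (auto simp: prec_iff)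
        thus ?thesis using less by (meson less_trans rtranclp.rtrancl_into_rtrancl)
      next
        case False
        hence "\<forall>c\<in>set (take j w). \<not> dep (w ! j) c"
          using dep_commute less.prems by (auto simp: in_set_conv_nth)
        hence "w ! j \<in> mins w" using less.prems id_take_nth_drop[of j w]
          unfolding mins_iff_split by metis
        hence "w ! j = w ! 0" using * by simp
        hence "j = 0" using False by (cases j) auto
        thus ?thesis by simp
      qed
    qed
  qed
qed

text \<open>Rotation puts the pyramid P of the first piece in front and the rest R behind. All of P
  stays above position 0, and some letter of R depends on a letter of P and joins it.\<close>

lemma length_above_rot_less:
  assumes "u \<noteq> []" "conn (set u)" "nths u (- above u 0) \<noteq> []"
  shows "length (nths u (above u 0)) < length (nths (rot E u 0) (above (rot E u 0) 0))"
proof -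
  define P R where "P = nths u (above u 0)" and "R = nths u (- above u 0)"
  have u': "rot E u 0 = P @ R" by (simp add: rot_eq P_def R_def)
  have setu: "set u = set P \<union> set R"
    using teq_set[OF split_above[of u 0]] by (auto simp: P_def R_def)
  have u0: "0 < length u" using assms(1) by simp
  obtain p where P: "P = u ! 0 # p" unfolding P_def using nths_above_eq_Cons[OF u0] .
  have "mins P = {P ! 0}" using assms(1) mins_above[of 0 u] P by (simp add: P_def)
  hence "\<forall>j<length P. (prec E P)\<^sup>*\<^sup>* 0 j" using all_above_iff_mins[of P] P by simp
  moreover have "prec E P \<le> prec E (P @ R)" by (auto simp: prec_def nth_append)
  hence mono: "(prec E P)\<^sup>*\<^sup>* \<le> (prec E (P @ R))\<^sup>*\<^sup>*" by (rule rtranclp_mono)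
  ultimately have below: "{..<length P} \<subseteq> above (P @ R) 0"
    using predicate2D[OF mono] by auto
  \<comment> \<open>If P already contains every letter, a letter of R depends on its own copy in P;
    otherwise connectivity of the support supplies a dependency across the boundary.\<close>
  have "\<exists>a\<in>set P. \<exists>b\<in>set R. dep a b"
  proof (cases "set P = set u")
    case True
    obtain b where "b \<in> set R" using assms(3) unfolding R_def by (meson last_in_set)
    thus ?thesis using True setu dep_refl by blast
  next
    case False
    hence "\<exists>a\<in>set P. \<exists>b\<in>set u - set P. dep a b"
      using assms(2) setu P unfolding conn_def by (metis Un_upper1 list.distinct(1) set_empty)
    thus ?thesis using setu by blast
  qed
  then obtain i k where ik: "i < length P" "k < length R" "dep (P ! i) (R ! k)"
    by (metis in_set_conv_nth)
  hence "prec E (P @ R) i (length P + k)" by (simp add: prec_iff nth_append)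
  hence "length P + k \<in> above (P @ R) 0" using below ik(1)
    by (auto intro: rtranclp.rtrancl_into_rtrancl)
  hence "insert (length P + k) {..<length P} \<subseteq> {i. i < length (P @ R) \<and> i \<in> above (P @ R) 0}"
    using below ik by auto
  hence "card (insert (length P + k) {..<length P}) \<le> card {i. i < length (P @ R) \<and> i \<in> above (P @ R) 0}"
    by (intro card_mono) auto
  thus ?thesis by (simp add: u' length_nths flip: P_def)
qed

text \<open>This is the stabilisation of A_p: as long as some piece is not above the first one, a
  rotation enlarges the pyramid at position 0.\<close>

lemma rot_iterate_pyramid:
  assumes "u \<noteq> []" "conn (set u)"
  shows "\<exists>n. mins (((\<lambda>u. rot E u 0) ^^ n) u) = {u ! 0}"
  using assms
proof (induction "length u - length (nths u (above u 0))" arbitrary: u rule: less_induct)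
  case less
  define u' where "u' = rot E u 0"
  show ?case
  proof (cases "nths u (- above u 0) = []")
    case True
    hence "mins (((\<lambda>u. rot E u 0) ^^ 1) u) = {u ! 0}"
      using mins_above[of 0 u] less.prems by (simp add: rot_eq)
    thus ?thesis by blast
  next
    case False
    have len: "length u' = length u" "set u' = set u"
      unfolding u'_def using conj_by_mset[OF conj_by_rot, of u 0]
        conj_by_set[OF conj_by_rot, of u 0] by (metis size_mset, blast)
    have le: "length (nths u' (above u' 0)) \<le> length u'"
      unfolding length_nths by (rule order_trans[OF card_mono[of "{..<length u'}"]]) auto
    have "length u' - length (nths u' (above u' 0)) < length u - length (nths u (above u 0))"
      using length_above_rot_less[OF less.prems False] le len(1) unfolding u'_def by linarith
    moreover have "u' \<noteq> []" "u' ! 0 = u ! 0" using rot_nth_0[of 0 u] less.prems by (auto simp: u'_def)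
    ultimately obtain n where "mins (((\<lambda>u. rot E u 0) ^^ n) u') = {u ! 0}"
      using less.hyps[of u'] less.prems len by auto
    hence "mins (((\<lambda>u. rot E u 0) ^^ Suc n) u) = {u ! 0}"
      by (simp only: funpow_Suc_right o_apply u'_def)
    thus ?thesis by blast
  qed
qed

lemma rotation_equivD:
  assumes "rotation_equiv E (heap_class E h) Q"
  obtains X q v where "Q = heap_class E q" "mins q = {v}" "conj_by X h q"
proof -
  obtain w i n where w: "w \<in> heap_class E h" "i < length w"
    and Q: "Q = heap_class E (((\<lambda>u. rot E u 0) ^^ n) (rot E w i))"
    and above: "\<forall>j<length (((\<lambda>u. rot E u 0) ^^ n) (rot E w i)).
      (prec E (((\<lambda>u. rot E u 0) ^^ n) (rot E w i)))\<^sup>*\<^sup>* 0 j"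
    using assms unfolding rotation_equiv_def Let_def
    by (elim bexE exE conjE) (rule that)
  define q where "q = ((\<lambda>u. rot E u 0) ^^ n) (rot E w i)"
  obtain X where X: "conj_by X (rot E w i) q" "q \<noteq> []"
    using conj_by_rot_iterate[of "rot E w i" n] rot_nth_0[OF w(2)] unfolding q_def by auto
  have "conj_by (nths w (- above w i) @ X) w q"
    using conj_by_trans conj_by_rot X(1) by blast
  hence "conj_by (nths w (- above w i) @ X) h q"
    by (rule conj_by_teq_left) (use w in \<open>simp add: mem_heap_class_iff\<close>)
  moreover have "mins q = {q ! 0}"
    using above all_above_iff_mins[OF X(2)] unfolding q_def by blast
  moreover have "Q = heap_class E q" unfolding q_def by (rule Q)
  ultimately show ?thesis by (intro that)
qed

text \<open>Existence half of the correspondence between pieces and pyramids of a class. Only the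
  first rotation moves copies of the chosen letter into X, so their number is the occurrence number
  of the piece.\<close>

lemma rotate_to_piece:
  assumes "i < length w" "conn (set w)"
  obtains q X where "mins q = {w ! i}" "conj_by X w q"
    "count_list X (w ! i) = count_list (take i w) (w ! i)"
    "rotation_equiv E (heap_class E w) (heap_class E q)"
proof -
  have r: "rot E w i \<noteq> []" "rot E w i ! 0 = w ! i" using rot_nth_0[OF assms(1)] by auto
  have "set (rot E w i) = set w" using conj_by_set[OF conj_by_rot] by metis
  then obtain n where n: "mins (((\<lambda>u. rot E u 0) ^^ n) (rot E w i)) = {w ! i}"
    using rot_iterate_pyramid[OF r(1)] assms(2) r(2) by auto
  define q where "q = ((\<lambda>u. rot E u 0) ^^ n) (rot E w i)"
  obtain X where X: "conj_by X (rot E w i) q" "count_list X (w ! i) = 0" "q \<noteq> []" "q ! 0 = w ! i"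
    using conj_by_rot_iterate[OF r(1), of n] r(2) unfolding q_def by auto
  have "\<forall>j<length q. (prec E q)\<^sup>*\<^sup>* 0 j" using all_above_iff_mins[of q] X n by (simp add: q_def)
  hence "rotation_equiv E (heap_class E w) (heap_class E q)"
    unfolding rotation_equiv_def Let_def using assms(1)
    by (intro bexI[of _ w] exI[of _ i] conjI exI[of _ n]) (simp_all add: q_def mem_heap_class_iff)
  moreover have "conj_by (nths w (- above w i) @ X) w q"
    using conj_by_trans conj_by_rot X(1) by blast
  moreover have "count_list (nths w (- above w i) @ X) (w ! i) = count_list (take i w) (w ! i)"
    using X(2) count_not_above[of w i] by simp
  moreover have "mins q = {w ! i}" using n by (simp add: q_def)
  ultimately show ?thesis by (intro that)
qed

end

context dependence
begin

subsection \<open>Conjugacy classes of pyramids\<close>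

lemma conj_by_word_pow:
  assumes "conj_by X u w"
  shows "word_pow u n @ X \<approx> X @ word_pow w n"
proof (induction n)
  case (Suc n)
  have "word_pow u (Suc n) @ X \<approx> u @ X @ word_pow w n" using Suc by simp
  also have "u @ X @ word_pow w n \<approx> (X @ w) @ word_pow w n"
    using assms teq_append_cancel_right[of "u @ X" "word_pow w n" "X @ w"] by (simp add: conj_by_def)
  finally show ?case by simp
qed simp

text \<open>In h^M X = X q^M every projection of X is at most as long as that of h^M: if it is
  nonempty, it meets a letter of h by the support condition, so the projection of h^M has length at
  least M.\<close>

lemma conj_by_prefix:
  assumes "conj_by X h q" "length X \<le> M"
  obtains Z where "X @ Z \<approx> word_pow h M" "set Z \<subseteq> set h"
proof -
  have "\<exists>s. proj a b (word_pow h M) = proj a b X @ s" if d: "dep a b" for a b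
  proof -
    have eq: "word_pow (proj a b h) M @ proj a b X = proj a b X @ word_pow (proj a b q) M"
      using teqD[OF conj_by_word_pow[OF assms(1)] d, of M] by simp
    have "length (proj a b X) \<le> M * length (proj a b h)"
    proof (cases "proj a b X = []")
      case False
      hence "a \<in> set h \<or> b \<in> set h" using assms(1) by (auto simp: conj_by_def proj_eq_Nil_iff)
      hence "length (proj a b h) \<ge> 1" by (simp add: Suc_le_eq proj_eq_Nil_iff)
      have "length (proj a b X) \<le> M * 1" using assms(2) length_proj_le[of a b X] by simp
      also have "\<dots> \<le> M * length (proj a b h)"
        using \<open>length (proj a b h) \<ge> 1\<close> by (rule mult_le_mono2)
      finally show ?thesis .
    qed simp
    hence "take (length (proj a b X)) (word_pow (proj a b h) M) = proj a b X"
      using arg_cong[OF eq, of "take (length (proj a b X))"] by simp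
    thus ?thesis by (metis append_take_drop_id proj_word_pow)
  qed
  then obtain Z where Z: "word_pow h M \<approx> X @ Z" using proj_prefix_imp by blast
  have "set Z \<subseteq> set h" using teq_set[OF Z] by auto
  thus ?thesis using that Z teq_sym by blast
qed

text \<open>X divides the power of h with exponent |X|, and the complementary factor Z conjugates
  back. The counts in X and Z are therefore opposite modulo the counts in h.\<close>

lemma conj_by_sym:
  assumes "conj_by X h q"
  obtains Z where "conj_by Z q h"
    "\<And>v. count_list X v + count_list Z v = length X * count_list h v"
proof -
  obtain Z where Z: "X @ Z \<approx> word_pow h (length X)" "set Z \<subseteq> set h"
    using conj_by_prefix[OF assms order_refl] .
  have "X @ (q @ Z) \<approx> (h @ X) @ Z"
    using assms teq_append_cancel_right[of "X @ q" Z "h @ X"] by (auto simp: conj_by_def intro: teq_sym)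
  also have "(h @ X) @ Z \<approx> h @ word_pow h (length X)" using Z by simp
  also have "h @ word_pow h (length X) = word_pow h (length X) @ h" by (simp add: word_pow_commute)
  also have "word_pow h (length X) @ h \<approx> (X @ Z) @ h"
    using Z teq_append_cancel_right teq_sym by blast
  finally have "q @ Z \<approx> Z @ h" by simp
  hence "conj_by Z q h" using Z(2) conj_by_set[OF assms] by (simp add: conj_by_def)
  moreover have "count_list X v + count_list Z v = length X * count_list h v" for v
    using teq_count[OF Z(1), of v] by simp
  ultimately show ?thesis by (rule that)
qed

lemma conj_by_word_pow_append:
  assumes "conj_by X h q"
  shows "conj_by (word_pow h n @ X) h q"
proof -
  have "conj_by (word_pow h n) h h"
    by (cases n) (auto simp: conj_by_def word_pow_commute intro: teq_refl)
  thus ?thesis using assms conj_by_trans by blast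
qed

text \<open>Completing X and Y to the same power of h gives X (q Z) = h^(M+1) = Y (q' Z'), where
  both right factors are pyramids with base v. With equally many copies of v on the left the
  factorisation is unique, so X = Y and then q = q'.\<close>

lemma conj_by_base_unique_aux:
  assumes "conj_by X h q" "conj_by Y h q'" "mins q = {v}" "mins q' = {v}"
    and "count_list X v = count_list Y v"
  shows "q \<approx> q'"
proof -
  define M where "M = max (length X) (length Y)"
  obtain Z where Z: "X @ Z \<approx> word_pow h M" "set Z \<subseteq> set h"
    using conj_by_prefix[OF assms(1), of M] by (auto simp: M_def)
  obtain Z' where Z': "Y @ Z' \<approx> word_pow h M" "set Z' \<subseteq> set h"
    using conj_by_prefix[OF assms(2), of M] by (auto simp: M_def)
  have *: "S @ (p @ W) \<approx> h @ word_pow h M"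
    if "conj_by S h p" "S @ W \<approx> word_pow h M" for S p W
  proof -
    have "S @ (p @ W) \<approx> (h @ S) @ W"
      using that(1) teq_append_cancel_right[of "S @ p" W "h @ S"] by (auto simp: conj_by_def intro: teq_sym)
    also have "(h @ S) @ W \<approx> h @ word_pow h M" using that(2) by simp
    finally show ?thesis .
  qed
  have m: "mins (p @ W) = {v}" if "mins p = {v}" "set W \<subseteq> set p" for p W
  proof -
    have "x \<in> mins (p @ W) \<longleftrightarrow> x \<in> {v}" for x
      unfolding mins_append using that mins_subset[of W] dep_refl by blast
    thus ?thesis by blast
  qed
  have "X @ (q @ Z) \<approx> Y @ (q' @ Z')"
    using *[OF assms(1) Z(1)] *[OF assms(2) Z'(1)] teq_sym teq_trans by blast
  moreover have "mins (q @ Z) = {v}" "mins (q' @ Z') = {v}"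
    using m[OF assms(3)] m[OF assms(4)] Z(2) Z'(2) conj_by_set[OF assms(1)] conj_by_set[OF assms(2)]
    by auto
  ultimately have XY: "X \<approx> Y" using pyramid_factor_unique assms(5) by blast
  have "X @ q \<approx> h @ X" using assms(1) by (auto simp: conj_by_def intro: teq_sym)
  also have "h @ X \<approx> h @ Y" using XY by simp
  also have "h @ Y \<approx> Y @ q'" using assms(2) by (simp add: conj_by_def)
  also have "Y @ q' \<approx> X @ q'" using XY by (simp add: teq_sym)
  finally show ?thesis by simp
qed

text \<open>Prepending h^n to a conjugator leaves the result unchanged and adds n times the count of
  v in h, so only the residue of the count matters.\<close>

lemma conj_by_base_unique:
  assumes "conj_by X h q" "conj_by Y h q'" "mins q = {v}" "mins q' = {v}"
    and "count_list X v mod count_list h v = count_list Y v mod count_list h v"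
  shows "q \<approx> q'"
proof -
  have *: "q \<approx> q'" if "conj_by X h q" "conj_by Y h q'" "mins q = {v}" "mins q' = {v}"
    and cong: "count_list X v mod count_list h v = count_list Y v mod count_list h v"
    and le: "count_list X v \<le> count_list Y v" for X Y q q'
  proof -
    obtain n where "count_list Y v = count_list X v + count_list h v * n"
      using mod_eq_nat1E[OF cong[symmetric] le] .
    hence "count_list (word_pow h n @ X) v = count_list Y v" by simp
    thus ?thesis
      by (rule conj_by_base_unique_aux[OF conj_by_word_pow_append[OF that(1)] that(2,3,4)])
  qed
  show ?thesis
    using *[OF assms] *[OF assms(2,1,4,3) assms(5)[symmetric]] teq_sym
    by (cases "count_list X v \<le> count_list Y v") auto
qed

lemma pyramid_base_in_set: "mins w = {v} \<Longrightarrow> v \<in> set w"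
  using mins_subset by blast

lemma obtain_base_occurrence:
  assumes "conj_by X h q" "mins q = {v}"
  obtains i where "i < length h" "h ! i = v" "count_list (take i h) v = count_list X v mod count_list h v"
proof -
  have "v \<in> set h" using pyramid_base_in_set[OF assms(2)] conj_by_set[OF assms(1)] by simp
  hence "count_list h v > 0" by (metis count_list_0_iff gr0I)
  hence "count_list X v mod count_list h v < count_list h v" by simp
  thus ?thesis using obtain_occurrence that by metis
qed

text \<open>The conjugator X names a piece of h, the copy of v with number
  \<open>count_list X v mod count_list h v\<close>. Rotating to that piece must return q by
  uniqueness, so conjugacy to a pyramid is always achieved by a rotation.\<close>

lemma conj_by_imp_rotation_equiv:
  assumes "conj_by X h q" "mins q = {v}" "conn (set h)"
  shows "rotation_equiv E (heap_class E h) (heap_class E q)"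
proof -
  obtain i where i: "i < length h" "h ! i = v"
    "count_list (take i h) v = count_list X v mod count_list h v"
    using obtain_base_occurrence[OF assms(1,2)] .
  obtain q' Y where q': "mins q' = {v}" "conj_by Y h q'"
    "count_list Y v = count_list (take i h) v"
    "rotation_equiv E (heap_class E h) (heap_class E q')"
    using rotate_to_piece[OF i(1) assms(3)] i(2) by auto
  have "q \<approx> q'" by (rule conj_by_base_unique[OF assms(1) q'(2) assms(2) q'(1)]) (simp add: q' i)
  hence "heap_class E q = heap_class E q'" by (simp add: heap_class_eq_iff)
  thus ?thesis using q' by simp
qed

subsection \<open>Periodicity\<close>

definition per :: "'a list \<Rightarrow> bool" where
  "per w \<longleftrightarrow> (\<exists>k m. m > 1 \<and> w \<approx> word_pow k m)"

lemma periodic_iff: "periodic E (heap_class E w) \<longleftrightarrow> per w"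
  by (simp add: periodic_def per_def heap_class_eq_iff)

text \<open>Each projection of q is conjugate to an m-th power, hence itself one, and the roots
  glue.\<close>

lemma conj_by_per:
  assumes "conj_by X h q" "per h"
  shows "per q"
proof -
  obtain k m where km: "m > 1" "h \<approx> word_pow k m" using assms(2) by (auto simp: per_def)
  have "\<exists>z. proj a b q = word_pow z m" if d: "dep a b" for a b
  proof (rule word_pow_conjugate)
    show "word_pow (proj a b k) m @ proj a b X = proj a b X @ proj a b q"
      using teqD[OF km(2) d] assms(1) d by (auto simp: conj_by_def dest: teqD)
  qed
  then obtain r where "q \<approx> word_pow r m" using proj_powers_imp_power[of q m] km(1) by auto
  thus ?thesis using km(1) by (auto simp: per_def)
qed

text \<open>Commuting words are powers of a common word, so at dependent letters the counts of T and
  h are in the same proportion, and connectivity carries the proportion Tv : hv from v to all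
  letters. In lowest terms s : t, the number t exceeds 1 because hv does not divide Tv, and every
  projection of h is a t-th power.\<close>

lemma commute_imp_per:
  assumes "h @ T \<approx> T @ h" "conn (set h)" "v \<in> set h" "\<not> count_list h v dvd count_list T v"
  shows "per h"
proof -
  define hv Tv where "hv = count_list h v" and "Tv = count_list T v"
  have hv: "hv > 0" using assms(3) unfolding hv_def by (metis count_list_0_iff gr0I)
  have root: "\<exists>z m n. proj a b T = word_pow z m \<and> proj a b h = word_pow z n" if "dep a b" for a b
    using teqD[OF assms(1) that] comm_append_are_replicate[of "proj a b T" "proj a b h"] by auto metis
  have ratio: "m * hv = n * Tv"
    if "count_list T a = m * za" "count_list h a = n * za" "a \<in> set h"
      "count_list T a * hv = count_list h a * Tv" for a m n za
  proof -
    have "za > 0" using that(2,3) by (cases "za = 0") (auto simp: count_list_0_iff)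
    moreover have "za * (m * hv) = za * (n * Tv)" using that by (simp add: mult_ac)
    ultimately show ?thesis by simp
  qed
  \<comment> \<open>The letters at which T and h have the same ratio as at v, cross-multiplied to
    stay in the natural numbers.\<close>
  define B where "B = {a \<in> set h. count_list T a * hv = count_list h a * Tv}"
  have "B = set h"
  proof -
    have "\<not> dep a b" if ab: "a \<in> B" "b \<in> set h - B" for a b
    proof
      assume "dep a b"
      then obtain z m n where z: "proj a b T = word_pow z m" "proj a b h = word_pow z n"
        using root by blast
      have "count_list T a = m * count_list z a" "count_list h a = n * count_list z a"
        "count_list T b = m * count_list z b" "count_list h b = n * count_list z b"
        using z by (metis count_list_proj count_list_word_pow)+
      moreover from this have "m * hv = n * Tv" using ab ratio unfolding B_def by blast
      hence "count_list z b * (m * hv) = count_list z b * (n * Tv)" by simp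
      ultimately have "b \<in> B" using ab by (simp add: B_def mult_ac)
      thus False using ab by simp
    qed
    moreover have "v \<in> B" using assms(3) by (simp add: B_def hv_def Tv_def)
    moreover have "B \<subseteq> set h" by (auto simp: B_def)
    ultimately show ?thesis using assms(2) unfolding conn_def by blast
  qed
  define t where "t = hv div gcd Tv hv"
  define s where "s = Tv div gcd Tv hv"
  have ts: "hv = t * gcd Tv hv" "Tv = s * gcd Tv hv" "coprime s t" "gcd Tv hv > 0"
    using hv by (auto simp: t_def s_def div_gcd_coprime)
  have "t \<noteq> 1"
  proof
    assume "t = 1"
    hence "hv dvd Tv" using ts(1) by (metis gcd_dvd1 mult_1)
    thus False using assms(4) by (simp add: hv_def Tv_def)
  qed
  moreover have "t \<noteq> 0" using ts(1) hv by (metis mult_0 less_irrefl)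
  ultimately have t: "t > 1" by simp
  have "\<exists>z. proj a b h = word_pow z t" if d: "dep a b" for a b
  proof (cases "proj a b h = []")
    case True
    hence "proj a b h = word_pow [] t" by simp
    thus ?thesis ..
  next
    case False
    obtain z m n where z: "proj a b T = word_pow z m" "proj a b h = word_pow z n"
      using root[OF d] by blast
    have c: "count_list T a = m * count_list z a" "count_list h a = n * count_list z a"
      "count_list T b = m * count_list z b" "count_list h b = n * count_list z b"
      using z by (metis count_list_proj count_list_word_pow)+
    have "a \<in> B \<or> b \<in> B" using False \<open>B = set h\<close> by (auto simp: proj_eq_Nil_iff)
    hence "m * hv = n * Tv" using ratio c unfolding B_def by blast
    \<comment> \<open>After cancelling the gcd, m t = n s with s and t coprime; so t divides n and
      z^n is a t-th power.\<close>
    hence "(m * t) * gcd Tv hv = (n * s) * gcd Tv hv" using ts(1,2) by (metis mult.assoc)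
    hence "m * t = n * s" using ts(4) by (metis mult_right_cancel less_irrefl)
    hence "t dvd n" using ts(3) by (metis coprime_commute coprime_dvd_mult_left_iff dvd_triv_right)
    then obtain j where "n = j * t" by (metis dvd_div_mult_self)
    hence "proj a b h = word_pow (word_pow z j) t" using z by (simp add: word_pow_mult)
    thus ?thesis ..
  qed
  then obtain r where "h \<approx> word_pow r t" using proj_powers_imp_power[of h t] t by auto
  thus ?thesis using t by (auto simp: per_def)
qed

text \<open>In a nonempty projection k = z^m and l = z^n with a m = b n. The quotients of a and b by
  their gcd are coprime, so the quotient of b divides m, and the roots glue to one trace.\<close>

lemma common_power_imp_root_power:
  assumes "word_pow k a \<approx> word_pow l b" "a > 0" "b > 0"
  shows "\<exists>r. k \<approx> word_pow r (b div gcd a b)"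
proof (rule proj_powers_imp_power)
  fix x y assume d: "dep x y"
  have eq: "word_pow (proj x y k) a = word_pow (proj x y l) b" using teqD[OF assms(1) d] by simp
  then obtain z m n where z: "proj x y k = word_pow z m" "proj x y l = word_pow z n"
    using word_pow_eq_common_root[OF _ assms(2,3)] by metis
  show "\<exists>z. proj x y k = word_pow z (b div gcd a b)"
  proof (cases "proj x y k = []")
    case True
    hence "proj x y k = word_pow [] (b div gcd a b)" by simp
    thus ?thesis ..
  next
    case False
    hence "length z > 0" using z by (metis concat_replicate_trivial length_greater_0_conv)
    moreover have "(a * m) * length z = (b * n) * length z"
      using arg_cong[OF eq, of length] z by auto
    ultimately have "a * m = b * n" by simp
    moreover have "a = a div gcd a b * gcd a b" "b = b div gcd a b * gcd a b" by simp_all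
    ultimately have "(a div gcd a b * m) * gcd a b = (b div gcd a b * n) * gcd a b"
      by (metis mult.commute mult.assoc)
    hence "a div gcd a b * m = b div gcd a b * n" using assms by simp
    hence "b div gcd a b dvd a div gcd a b * m" by simp
    moreover have "coprime (b div gcd a b) (a div gcd a b)"
      using assms by (simp add: coprime_commute div_gcd_coprime)
    ultimately have "b div gcd a b dvd m" by (simp add: coprime_dvd_mult_right_iff)
    then obtain j where "m = j * (b div gcd a b)" by (metis dvd_div_mult_self)
    hence "proj x y k = word_pow (word_pow z j) (b div gcd a b)" using z by (simp add: word_pow_mult)
    thus ?thesis ..
  qed
next
  show "0 < b div gcd a b" using assms by (simp add: div_greater_zero_iff)
qed

text \<open>Uniqueness of the aperiodic root: aperiodicity forces both root exponents to be 1, so a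
  = b and the powers cancel.\<close>

lemma common_power_imp_teq:
  assumes "word_pow k a \<approx> word_pow l b" "a > 0" "b > 0" "\<not> per k" "\<not> per l"
  shows "k \<approx> l"
proof -
  have "0 < b div gcd a b" "0 < a div gcd a b" using assms by (simp_all add: div_greater_zero_iff)
  moreover have "\<not> 1 < b div gcd a b"
    using common_power_imp_root_power[OF assms(1-3)] assms(4) by (auto simp: per_def)
  moreover have "\<not> 1 < a div gcd a b"
    using common_power_imp_root_power[OF teq_sym[OF assms(1)] assms(3,2)] assms(5)
    by (auto simp: per_def gcd.commute)
  ultimately have "b div gcd a b = 1" "a div gcd a b = 1" by simp_all
  hence "a = b" by (metis dvd_div_mult_self gcd_dvd1 gcd_dvd2)
  thus ?thesis using assms teq_word_pow_cancel by blast
qed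

section \<open>Rotation classes of pyramids\<close>

text \<open>Stated with \<open>conj_by\<close>, which composes and inverts; for a pyramid h it is
  the class under \<open>rotation_equiv\<close> (\<open>rotation_class_iff\<close>).\<close>

definition rotation_class :: "'a list \<Rightarrow> 'a list set set" where
  "rotation_class h = {heap_class E q |q. (\<exists>v. mins q = {v}) \<and> (\<exists>X. conj_by X h q)}"

lemma rotation_class_iff:
  assumes "mins h = {u}"
  shows "Q \<in> rotation_class h \<longleftrightarrow> rotation_equiv E (heap_class E h) Q"
proof
  assume "Q \<in> rotation_class h"
  thus "rotation_equiv E (heap_class E h) Q"
    using conj_by_imp_rotation_equiv pyramid_conn[OF assms] by (auto simp: rotation_class_def)
next
  assume "rotation_equiv E (heap_class E h) Q"
  thus "Q \<in> rotation_class h"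
    by (rule rotation_equivD) (auto simp: rotation_class_def)
qed

text \<open>Rotating to each piece reaches every member, by \<open>conj_by_base_unique\<close>. If
  pieces i < j gave the same pyramid, both would carry one letter v, and going along
  \<open>X j\<close> and back along \<open>X i\<close> would give a heap commuting with h. Its count
  of v is, modulo that of h, a difference of two distinct occurrence numbers, so
  \<open>commute_imp_per\<close> would make h periodic.\<close>

lemma card_rotation_class:
  assumes "mins h = {u}" "\<not> per h"
  shows "card (rotation_class h) = length h"
proof -
  have conn: "conn (set h)" using assms(1) by (rule pyramid_conn)
  have "\<exists>q X. mins q = {h ! i} \<and> conj_by X h q \<and>
     count_list X (h ! i) = count_list (take i h) (h ! i)" if "i < length h" for i
    using rotate_to_piece[OF that conn] by metis
  then obtain q X where q: "\<And>i. i < length h \<Longrightarrow> mins (q i) = {h ! i}"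
    and X: "\<And>i. i < length h \<Longrightarrow> conj_by (X i) h (q i)"
    and cX: "\<And>i. i < length h \<Longrightarrow> count_list (X i) (h ! i) = count_list (take i h) (h ! i)"
    by metis
  have inj': False if ij: "i < j" "j < length h" and eq: "q i \<approx> q j" for i j
  proof -
    have i: "i < length h" using ij by simp
    define v where "v = h ! i"
    have hj: "h ! j = v" using q[OF i] q[OF ij(2)] mins_teq[OF eq] by (simp add: v_def)
    have "take j h = take i h @ v # take (j - Suc i) (drop (Suc i) h)"
      using ij i id_take_nth_drop[of i "take j h"] by (simp add: v_def min_def take_drop)
    hence less: "count_list (take i h) v < count_list (take j h) v" by simp
    have "h = take j h @ v # drop (Suc j) h"
      using ij(2) hj id_take_nth_drop by metis
    hence less': "count_list (take j h) v < count_list h v"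
      by (metis count_list_append count_list.simps(2) less_add_Suc1 add_Suc_right Suc_eq_plus1)
    obtain Z where Z: "conj_by Z (q i) h"
      "\<And>v. count_list (X i) v + count_list Z v = length (X i) * count_list h v"
      using conj_by_sym[OF X[OF i]] by blast
    \<comment> \<open>\<open>X j\<close> leads from h to \<open>q j\<close>, which is
      \<open>q i\<close> as a heap, and Z leads back from \<open>q i\<close> to h.\<close>
    have "conj_by (X j @ Z) h h"
      using conj_by_trans[OF X[OF ij(2)] conj_by_teq_left[OF Z(1) teq_sym[OF eq]]] .
    hence "h @ (X j @ Z) \<approx> (X j @ Z) @ h" by (simp only: conj_by_def)
    moreover have "\<not> count_list h v dvd count_list (X j @ Z) v"
    proof
      assume "count_list h v dvd count_list (X j @ Z) v"
      moreover have "count_list (X j @ Z) v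
          = (count_list (take j h) v - count_list (take i h) v) + length (X i) * count_list h v"
        using cX[OF i] cX[OF ij(2)] Z(2)[of v] less hj by (simp add: v_def)
      ultimately have "count_list h v dvd count_list (take j h) v - count_list (take i h) v"
        by (simp add: dvd_add_left_iff)
      thus False using less less' by (simp add: nat_dvd_not_less)
    qed
    moreover have "v \<in> set h" using i by (simp add: v_def)
    ultimately have "per h" using commute_imp_per[OF _ conn] by blast
    thus False using assms(2) by simp
  qed
  have "bij_betw (\<lambda>i. heap_class E (q i)) {..<length h} (rotation_class h)"
  proof (rule bij_betwI')
    fix i j assume "i \<in> {..<length h}" "j \<in> {..<length h}"
    thus "heap_class E (q i) = heap_class E (q j) \<longleftrightarrow> i = j"
      using inj'[of i j] inj'[of j i] teq_sym[of "q i" "q j"] unfolding heap_class_eq_iff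
      by (cases i j rule: linorder_cases) auto
  next
    fix i assume "i \<in> {..<length h}"
    thus "heap_class E (q i) \<in> rotation_class h"
      unfolding rotation_class_def using q[of i] X[of i] by blast
  next
    fix Q assume "Q \<in> rotation_class h"
    then obtain q' v Y where q': "Q = heap_class E q'" "mins q' = {v}" "conj_by Y h q'"
      unfolding rotation_class_def by blast
    obtain i where i: "i < length h" "h ! i = v"
      "count_list (take i h) v = count_list Y v mod count_list h v"
      using obtain_base_occurrence[OF q'(3,2)] .
    have "q' \<approx> q i"
      using cX[OF i(1)] i q[OF i(1)] by (intro conj_by_base_unique[OF q'(3) X[OF i(1)] q'(2)]) auto
    hence "Q = heap_class E (q i)" using q'(1) heap_class_eq_iff by simp
    thus "\<exists>i\<in>{..<length h}. Q = heap_class E (q i)" using i by auto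
  qed
  from bij_betw_same_card[OF this] show ?thesis by simp
qed

end

section \<open>Lexicographic order and standard words\<close>

lemma lex_le_refl: "lex_le u u"
  by (simp add: lex_le_def)

lemma lex_le_total: "lex_le u v \<or> lex_le v u"
proof -
  have "(u, v) \<in> lexord {(x, y). x < y} \<or> u = v \<or> (v, u) \<in> lexord {(x, y). x < y}"
    by (rule lexord_linear) auto
  thus ?thesis by (auto simp: lex_le_def)
qed

lemma lex_le_trans:
  assumes "lex_le u v" "lex_le v w"
  shows "lex_le u w"
proof -
  have "trans {(x, y :: 'a). x < y}" by (auto intro: transI)
  thus ?thesis using assms lexord_trans unfolding lex_le_def by blast
qed

lemma lex_le_antisym:
  assumes "lex_le u v" "lex_le v u"
  shows "u = v"
proof -
  have "trans {(x, y :: 'a). x < y}" by (auto intro: transI)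
  moreover have "(u, u) \<notin> lexord {(x, y). x < y}" by (rule lexord_irreflexive) simp
  ultimately show ?thesis using assms lexord_trans unfolding lex_le_def by blast
qed

lemma finite_lex_min:
  assumes "finite A" "A \<noteq> {}"
  shows "\<exists>a\<in>A. \<forall>b\<in>A. lex_le (f a) (f b)"
  using assms
proof (induction A rule: finite_ne_induct)
  case (insert x A)
  then obtain a where "a \<in> A" "\<forall>b\<in>A. lex_le (f a) (f b)" by blast
  thus ?case using lex_le_total[of "f x" "f a"] lex_le_trans[of "f x" "f a"] lex_le_refl
    by (metis insert_iff)
qed (simp add: lex_le_refl)

lemma finite_lex_max:
  assumes "finite A" "A \<noteq> {}"
  shows "\<exists>a\<in>A. \<forall>b\<in>A. lex_le b a"
  using assms
proof (induction A rule: finite_ne_induct)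
  case (insert x A)
  then obtain a where "a \<in> A" "\<forall>b\<in>A. lex_le b a" by blast
  thus ?case using lex_le_total[of x a] lex_le_trans[of _ a x] lex_le_refl
    by (metis insert_iff)
qed (simp add: lex_le_refl)

lemma std_word_mem:
  assumes "finite H" "H \<noteq> {}"
  shows "std_word H \<in> H"
proof -
  obtain a where a: "a \<in> H" "\<forall>b\<in>H. lex_le b a" using finite_lex_max[OF assms] by blast
  have "std_word H = a"
    unfolding std_word_def using a lex_le_antisym by (intro the_equality) auto
  thus ?thesis using a by simp
qed

section \<open>Independent sets\<close>

lemma sum_Pow_minus_one:
  assumes "finite A"
  shows "(\<Sum>S\<in>Pow A. (-1) ^ card S) = (if A = {} then 1 else 0 :: 'b :: comm_ring_1)"
  using prod_diff_conv_sum[OF assms, of "\<lambda>_. 1 :: 'b" "\<lambda>_. 1"] assms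
  by (simp add: power_0_left card_eq_0_iff)

definition ind_sets :: "('a \<Rightarrow> 'a \<Rightarrow> bool) \<Rightarrow> 'a set \<Rightarrow> 'a set set" where
  "ind_sets E V = {S. S \<subseteq> V \<and> (\<forall>u\<in>S. \<forall>v\<in>S. \<not> E u v)}"

definition ind_count :: "('a \<Rightarrow> 'a \<Rightarrow> bool) \<Rightarrow> 'a set \<Rightarrow> nat \<Rightarrow> nat" where
  "ind_count E V n = card {S \<in> ind_sets E V. card S = n}"

lemma finite_ind_sets: "finite V \<Longrightarrow> finite (ind_sets E V)"
  unfolding ind_sets_def by (rule finite_subset[of _ "Pow V"]) auto

lemma finite_ind_set: "finite V \<Longrightarrow> S \<in> ind_sets E V \<Longrightarrow> finite S"
  unfolding ind_sets_def by (auto intro: finite_subset)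

context dependence
begin

subsection \<open>Counting heaps and pyramids\<close>

definition heaps :: "'a set \<Rightarrow> nat \<Rightarrow> 'a list set set" where
  "heaps V n = {heap_class E w |w. set w \<subseteq> V \<and> length w = n}"

definition pyrs :: "'a set \<Rightarrow> nat \<Rightarrow> 'a list set set" where
  "pyrs V n = {heap_class E w |w. set w \<subseteq> V \<and> length w = n \<and> (\<exists>v. mins w = {v})}"

definition aperiodic_pyrs :: "'a set \<Rightarrow> nat \<Rightarrow> 'a list set set" where
  "aperiodic_pyrs V n =
    {heap_class E w |w. set w \<subseteq> V \<and> length w = n \<and> (\<exists>v. mins w = {v}) \<and> \<not> per w}"

definition rep :: "'a list set \<Rightarrow> 'a list" where
  "rep H = (SOME w. w \<in> H)"

lemma rep_teq: "w \<approx> rep (heap_class E w)"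
proof -
  have "w \<in> heap_class E w" by (simp add: mem_heap_class_iff)
  hence "rep (heap_class E w) \<in> heap_class E w" unfolding rep_def by (rule someI)
  thus ?thesis by (simp add: mem_heap_class_iff)
qed

lemma per_teq: "u \<approx> v \<Longrightarrow> per u \<longleftrightarrow> per v"
  unfolding per_def using teq_sym teq_trans by blast

lemma rep_heaps:
  assumes "H \<in> heaps V n"
  shows "H = heap_class E (rep H)" "set (rep H) \<subseteq> V" "length (rep H) = n"
proof -
  obtain w where w: "H = heap_class E w" "set w \<subseteq> V" "length w = n"
    using assms by (auto simp: heaps_def)
  have "w \<approx> rep H" using rep_teq w by simp
  thus "H = heap_class E (rep H)" "set (rep H) \<subseteq> V" "length (rep H) = n"
    using w teq_set[of w "rep H"] teq_length[of w "rep H"] by (simp_all add: heap_class_eq_iff)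
qed

lemma rep_pyrs:
  assumes "H \<in> pyrs V n"
  shows "H = heap_class E (rep H)" "set (rep H) \<subseteq> V" "length (rep H) = n" "\<exists>v. mins (rep H) = {v}"
proof -
  obtain w where w: "H = heap_class E w" "set w \<subseteq> V" "length w = n" "\<exists>v. mins w = {v}"
    using assms by (auto simp: pyrs_def)
  have "w \<approx> rep H" using rep_teq w by simp
  thus "H = heap_class E (rep H)" "set (rep H) \<subseteq> V" "length (rep H) = n" "\<exists>v. mins (rep H) = {v}"
    using w teq_set[of w "rep H"] teq_length[of w "rep H"] mins_teq[of w "rep H"]
    by (simp_all add: heap_class_eq_iff)
qed

lemma rep_aperiodic_pyrs:
  assumes "H \<in> aperiodic_pyrs V n"
  shows "H = heap_class E (rep H)" "set (rep H) \<subseteq> V" "length (rep H) = n" "\<exists>v. mins (rep H) = {v}"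
    "\<not> per (rep H)"
proof -
  obtain w where w: "H = heap_class E w" "set w \<subseteq> V" "length w = n" "\<exists>v. mins w = {v}" "\<not> per w"
    using assms by (auto simp: aperiodic_pyrs_def)
  have "w \<approx> rep H" using rep_teq w by simp
  thus "\<not> per (rep H)" using w per_teq by blast
  have "H \<in> pyrs V n" using w by (auto simp: pyrs_def)
  from rep_pyrs[OF this]
  show "H = heap_class E (rep H)" "set (rep H) \<subseteq> V" "length (rep H) = n" "\<exists>v. mins (rep H) = {v}"
    by auto
qed

lemma heapsI: "set w \<subseteq> V \<Longrightarrow> length w = n \<Longrightarrow> heap_class E w \<in> heaps V n"
  unfolding heaps_def by blast

lemma pyrsI: "set w \<subseteq> V \<Longrightarrow> length w = n \<Longrightarrow> mins w = {v} \<Longrightarrow> heap_class E w \<in> pyrs V n"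
  unfolding pyrs_def by blast

lemma aperiodic_pyrsI:
  "set w \<subseteq> V \<Longrightarrow> length w = n \<Longrightarrow> mins w = {v} \<Longrightarrow> \<not> per w \<Longrightarrow> heap_class E w \<in> aperiodic_pyrs V n"
  unfolding aperiodic_pyrs_def by blast

lemma mins_Nil [simp]: "mins [] = {}"
  using mins_subset[of "[]"] by simp

lemma finite_heaps: "finite V \<Longrightarrow> finite (heaps V n)"
proof -
  assume "finite V"
  hence "finite (heap_class E ` {w. set w \<subseteq> V \<and> length w = n})"
    by (intro finite_imageI finite_lists_length_eq)
  thus ?thesis by (rule finite_subset[rotated]) (auto simp: heaps_def)
qed

lemma pyrs_subset: "pyrs V n \<subseteq> heaps V n" "aperiodic_pyrs V n \<subseteq> pyrs V n"
  by (auto simp: pyrs_def heaps_def aperiodic_pyrs_def)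

lemma finite_pyrs: "finite V \<Longrightarrow> finite (pyrs V n)"
  by (rule finite_subset[OF pyrs_subset(1) finite_heaps])

lemma finite_aperiodic_pyrs: "finite V \<Longrightarrow> finite (aperiodic_pyrs V n)"
  by (rule finite_subset[OF pyrs_subset(2) finite_pyrs])

lemma mins_append_subset:
  assumes "set v \<subseteq> set u"
  shows "mins (u @ v) = mins u"
proof -
  have "x \<in> mins (u @ v) \<longleftrightarrow> x \<in> mins u" for x
    unfolding mins_append using assms mins_subset[of v] dep_refl by blast
  thus ?thesis by blast
qed

lemma mins_word_pow:
  assumes "m > 0"
  shows "mins (word_pow w m) = mins w"
proof -
  obtain k where "m = Suc k" using assms by (cases m) auto
  moreover have "set (word_pow w k) \<subseteq> set w" by auto
  ultimately show ?thesis using mins_append_subset by simp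
qed

lemma primitive_root_exists:
  assumes "w \<noteq> []"
  shows "\<exists>k m. m > 0 \<and> w \<approx> word_pow k m \<and> \<not> per k"
  using assms
proof (induction w rule: length_induct)
  case (1 w)
  show ?case
  proof (cases "per w")
    case False
    have "w \<approx> word_pow w 1" by simp
    thus ?thesis using False zero_less_one by blast
  next
    case True
    then obtain k m where km: "m > 1" "w \<approx> word_pow k m" by (auto simp: per_def)
    have len: "length w = m * length k" using teq_length[OF km(2)] by simp
    hence "k \<noteq> []" "length k < length w" using 1(2) km(1) by auto
    then obtain k' m' where k': "m' > 0" "k \<approx> word_pow k' m'" "\<not> per k'" using 1(1) by blast
    have "word_pow k m \<approx> word_pow k' (m' * m)"
      using teq_word_pow[OF k'(2), of m] by (simp add: word_pow_mult)
    hence "w \<approx> word_pow k' (m' * m)" using km(2) teq_trans by blast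
    moreover have "m' * m > 0" using k'(1) km(1) by simp
    ultimately show ?thesis using k'(3) by blast
  qed
qed

text \<open>A positive power has the same minimal letters as its base, so the aperiodic root of a
  pyramid is again a pyramid; \<open>common_power_imp_teq\<close> makes the root and its size k
  unique.\<close>

lemma card_pyrs:
  assumes "finite V" "n > 0"
  shows "card (pyrs V n) = (\<Sum>k | k dvd n. card (aperiodic_pyrs V k))"
proof -
  define f where "f = (\<lambda>(k, K). heap_class E (word_pow (rep K) (n div k)))"
  have fin: "finite {k. k dvd n}" using assms(2) by simp
  have div_pos: "n div k > 0" if "k dvd n" for k
    using that assms(2) by (auto elim!: dvdE)
  have "bij_betw f (SIGMA k:{k. k dvd n}. aperiodic_pyrs V k) (pyrs V n)"
  proof (rule bij_betw_imageI)
    show "inj_on f (SIGMA k:{k. k dvd n}. aperiodic_pyrs V k)"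
    proof (rule inj_onI, clarsimp)
      fix k l K L
      assume k: "k dvd n" "K \<in> aperiodic_pyrs V k" and l: "l dvd n" "L \<in> aperiodic_pyrs V l"
        and eq: "f (k, K) = f (l, L)"
      note K = rep_aperiodic_pyrs[OF k(2)] and L = rep_aperiodic_pyrs[OF l(2)]
      have "word_pow (rep K) (n div k) \<approx> word_pow (rep L) (n div l)"
        using eq by (simp add: f_def heap_class_eq_iff)
      hence "rep K \<approx> rep L"
        using common_power_imp_teq div_pos k(1) l(1) K(5) L(5) by blast
      thus "k = l \<and> K = L" using K L teq_length heap_class_eq_iff by metis
    qed
    show "f ` (SIGMA k:{k. k dvd n}. aperiodic_pyrs V k) = pyrs V n"
    proof (intro equalityI subsetI)
      fix H assume "H \<in> f ` (SIGMA k:{k. k dvd n}. aperiodic_pyrs V k)"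
      then obtain k K where k: "k dvd n" "K \<in> aperiodic_pyrs V k" "H = f (k, K)" by auto
      note K = rep_aperiodic_pyrs[OF k(2)]
      have "set (word_pow (rep K) (n div k)) \<subseteq> V" using K(2) set_word_pow[OF div_pos[OF k(1)]] by metis
      moreover have "length (word_pow (rep K) (n div k)) = n" using K(3) k(1) by simp
      moreover obtain v where "mins (word_pow (rep K) (n div k)) = {v}"
        using K(4) mins_word_pow[OF div_pos[OF k(1)]] by metis
      ultimately show "H \<in> pyrs V n" unfolding k(3) f_def prod.case by (rule pyrsI)
    next
      fix H assume "H \<in> pyrs V n"
      then obtain w where w: "H = heap_class E w" "set w \<subseteq> V" "length w = n" "\<exists>v. mins w = {v}"
        unfolding pyrs_def by blast
      hence "w \<noteq> []" using assms(2) by auto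
      then obtain k m where km: "m > 0" "w \<approx> word_pow k m" "\<not> per k"
        using primitive_root_exists by blast
      have n: "n = m * length k" using teq_length[OF km(2)] w(3) by simp
      have "set k \<subseteq> V" using teq_set[OF km(2)] set_word_pow[OF km(1), of k] w(2) by simp
      moreover obtain v where "mins k = {v}" using w(4) mins_teq[OF km(2)] mins_word_pow[OF km(1)] by metis
      ultimately have "heap_class E k \<in> aperiodic_pyrs V (length k)"
        using km(3) aperiodic_pyrsI by blast
      moreover have "n div length k = m" using n assms(2) by auto
      moreover have "w \<approx> word_pow (rep (heap_class E k)) m"
        using km(2) teq_word_pow[OF rep_teq[of k], of m] teq_trans by blast
      ultimately have "f (length k, heap_class E k) = H" by (simp add: f_def w(1) heap_class_eq_iff teq_sym)
      moreover have "length k dvd n" using n by simp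
      ultimately show "H \<in> f ` (SIGMA k:{k. k dvd n}. aperiodic_pyrs V k)"
        using \<open>heap_class E k \<in> aperiodic_pyrs V (length k)\<close>
        by (intro image_eqI[of _ _ "(length k, heap_class E k)"]) auto
    qed
  qed
  hence "card (pyrs V n) = card (SIGMA k:{k. k dvd n}. aperiodic_pyrs V k)"
    by (simp add: bij_betw_same_card)
  also have "\<dots> = (\<Sum>k | k dvd n. card (aperiodic_pyrs V k))"
    using fin finite_aperiodic_pyrs[OF assms(1)] by (simp add: card_SigmaI)
  finally show ?thesis .
qed

text \<open>Both sides count heaps with a chosen piece, given as a position in a fixed
  representative. The two factors recover the pair: their product is the heap, and the base of the
  pyramid together with its count in the left factor locates the piece.\<close>

lemma pointed_heaps:
  assumes "finite V"
  shows "n * card (heaps V n) = (\<Sum>k=1..n. card (heaps V (n - k)) * card (pyrs V k))"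
proof -
  define f where
    "f = (\<lambda>(H, i). (heap_class E (nths (rep H) (- above (rep H) i)), heap_class E (nths (rep H) (above (rep H) i))))"
  define T where "T = (\<Union>k\<in>{1..n}. heaps V (n - k) \<times> pyrs V k)"
  have "bij_betw f (heaps V n \<times> {..<n}) T"
  proof (rule bij_betw_imageI)
    show "inj_on f (heaps V n \<times> {..<n})"
    proof (rule inj_onI, clarsimp)
      fix H i H' i'
      assume H: "H \<in> heaps V n" "i < n" and H': "H' \<in> heaps V n" "i' < n" and eq: "f (H, i) = f (H', i')"
      define w w' where "w = rep H" and "w' = rep H'"
      note rH = rep_heaps[OF H(1), folded w_def] and rH' = rep_heaps[OF H'(1), folded w'_def]
      have U: "nths w (- above w i) \<approx> nths w' (- above w' i')"
        and P: "nths w (above w i) \<approx> nths w' (above w' i')"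
        using eq by (simp_all add: f_def w_def w'_def heap_class_eq_iff)
      have "w \<approx> nths w' (- above w' i') @ nths w' (above w' i')"
        using split_above[of w i] teq_append[OF U P] teq_trans by blast
      hence "w \<approx> w'" using split_above teq_sym teq_trans by blast
      hence HH: "H = H'" using rH rH' heap_class_eq_iff by simp
      hence ww: "w = w'" by (simp add: w_def w'_def)
      have v: "w ! i = w ! i'"
        using mins_teq[OF P] mins_above[of i w] mins_above[of i' w] H(2) H'(2) rH(3) ww by simp
      have "count_list (take i w) (w ! i) = count_list (take i' w) (w ! i)"
        using teq_count[OF U, of "w ! i"] count_not_above[of w i] count_not_above[of w i'] v ww by simp
      moreover have less: "count_list (take a w) (w ! a) < count_list (take b w) (w ! a)"
        if "a < b" "b < length w" for a b
        using that id_take_nth_drop[of a "take b w"] by (simp add: min_def)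
          (metis count_list.simps(2) count_list_append less_add_Suc1 add_Suc_right Suc_eq_plus1)
      ultimately have "i = i'"
        using less[of i i'] less[of i' i] v H(2) H'(2) rH(3) by (metis less_irrefl linorder_neqE_nat)
      thus "H = H' \<and> i = i'" using HH by simp
    qed
    show "f ` (heaps V n \<times> {..<n}) = T"
    proof (intro equalityI subsetI)
      fix x assume "x \<in> f ` (heaps V n \<times> {..<n})"
      then obtain H i where H: "H \<in> heaps V n" "i < n" "x = f (H, i)" by auto
      define w U P where "w = rep H" and "U = nths (rep H) (- above (rep H) i)"
        and "P = nths (rep H) (above (rep H) i)"
      note rH = rep_heaps[OF H(1), folded w_def]
      have w: "w \<approx> U @ P" unfolding w_def U_def P_def by (rule split_above)
      have mP: "mins P = {w ! i}" unfolding P_def w_def using H(2) rep_heaps(3)[OF H(1)] by (intro mins_above) simp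
      have sets: "set U \<subseteq> V" "set P \<subseteq> V" using teq_set[OF w] rH(2) by auto
      have len: "length U + length P = n" using teq_length[OF w] rH(3) by simp
      have "P \<noteq> []" using mP by auto
      hence k: "length P \<in> {1..n}" using len by (cases P) auto
      have "heap_class E U \<in> heaps V (n - length P)" using sets len by (intro heapsI) auto
      moreover have "heap_class E P \<in> pyrs V (length P)" using sets mP by (intro pyrsI) auto
      moreover have "x = (heap_class E U, heap_class E P)" using H(3) by (simp add: f_def U_def P_def)
      ultimately show "x \<in> T" using k unfolding T_def by blast
    next
      fix x assume "x \<in> T"
      then obtain k A B where x: "x = (A, B)" "k \<in> {1..n}" "A \<in> heaps V (n - k)" "B \<in> pyrs V k"
        by (auto simp: T_def)
      note rA = rep_heaps[OF x(3)] and rB = rep_pyrs[OF x(4)]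
      define H where "H = heap_class E (rep A @ rep B)"
      define w where "w = rep H"
      obtain v where v: "mins (rep B) = {v}" using rB(4) by blast
      have H: "H \<in> heaps V n" unfolding H_def using rA(2,3) rB(2,3) x(2) by (intro heapsI) auto
      have w: "rep A @ rep B \<approx> w" unfolding w_def H_def by (rule rep_teq)
      \<comment> \<open>The piece to point at is the base of the pyramid: the copy of v whose number
        is the count of v in the left factor.\<close>
      have "v \<in> set (rep B)" using v pyramid_base_in_set by simp
      hence "count_list (rep B) v > 0" by (metis count_list_0_iff gr0I)
      hence "count_list (rep A) v < count_list w v" using teq_count[OF w, of v] by simp
      then obtain i where i: "i < length w" "w ! i = v" "count_list (take i w) v = count_list (rep A) v"
        by (rule obtain_occurrence)
      have m: "mins (nths w (above w i)) = {v}" using mins_above[OF i(1)] i(2) by simp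
      have UP: "nths w (- above w i) @ nths w (above w i) \<approx> rep A @ rep B"
        using w split_above teq_sym teq_trans by blast
      have "nths w (- above w i) \<approx> rep A"
        by (rule pyramid_factor_unique[OF m v UP]) (use count_not_above[of w i] i in simp)
      moreover from this have "nths w (above w i) \<approx> rep B"
        using UP teq_append_cancel_left teq_append_cancel_right teq_sym teq_trans by blast
      ultimately have "f (H, i) = x" using rA(1) rB(1) x(1)
        unfolding f_def prod.case w_def[symmetric] by (metis heap_class_eq_iff)
      moreover have "i < n" using i(1) rep_heaps(3)[OF H] by (simp add: w_def)
      ultimately show "x \<in> f ` (heaps V n \<times> {..<n})"
        using H by (intro image_eqI[of _ _ "(H, i)"]) auto
    qed
  qed
  hence "card (heaps V n \<times> {..<n}) = card T" by (rule bij_betw_same_card)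
  also have "card T = (\<Sum>k=1..n. card (heaps V (n - k) \<times> pyrs V k))"
    unfolding T_def
  proof (rule card_UN_disjoint)
    have "k = l" if "B \<in> pyrs V k" "B \<in> pyrs V l" for k l B
      using rep_pyrs(3)[OF that(1)] rep_pyrs(3)[OF that(2)] by simp
    thus "\<forall>k\<in>{1..n}. \<forall>l\<in>{1..n}. k \<noteq> l \<longrightarrow> heaps V (n - k) \<times> pyrs V k \<inter> (heaps V (n - l) \<times> pyrs V l) = {}"
      by blast
  qed (use finite_heaps[OF assms] finite_pyrs[OF assms] in auto)
  finally show ?thesis by (simp add: card_cartesian_product mult.commute)
qed

lemma mins_list_prefix:
  assumes "distinct xs" "set xs \<subseteq> mins w"
  shows "\<exists>t. w \<approx> xs @ t"
  using assms
proof (induction xs arbitrary: w)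
  case (Cons x xs)
  obtain w' where w': "w \<approx> x # w'" using Cons.prems by (auto simp: mins_def)
  have "y \<in> mins w'" if y: "y \<in> set xs" for y
  proof -
    have "y \<in> mins ([x] @ w')" using y Cons.prems(2) mins_teq[OF w'] by auto
    moreover have "y \<noteq> x" using y Cons.prems(1) by auto
    ultimately show ?thesis using mins_subset[of "[x]"] unfolding mins_append by auto
  qed
  hence "set xs \<subseteq> mins w'" by blast
  then obtain t where "w' \<approx> xs @ t" using Cons.IH[of w'] Cons.prems(1) by auto
  hence "x # w' \<approx> (x # xs) @ t" by simp
  thus ?case using w' teq_trans by blast
qed (auto intro: teq_refl)

text \<open>Such a heap is S, listed in any order, below a heap of the remaining size, which
  cancellation determines.\<close>

lemma card_heaps_with_mins:
  assumes "finite V" "S \<in> ind_sets E V" "card S \<le> n"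
  shows "card {H \<in> heaps V n. S \<subseteq> mins (rep H)} = card (heaps V (n - card S))"
proof -
  have fS: "finite S" "S \<subseteq> V" using assms finite_ind_set by (auto simp: ind_sets_def)
  obtain xs where xs: "distinct xs" "set xs = S" using finite_distinct_list[OF fS(1)] by blast
  have lxs: "length xs = card S" using xs distinct_card by metis
  define f where "f T = heap_class E (xs @ rep T)" for T
  have "bij_betw f (heaps V (n - card S)) {H \<in> heaps V n. S \<subseteq> mins (rep H)}"
  proof (rule bij_betw_imageI)
    show "inj_on f (heaps V (n - card S))"
    proof (rule inj_onI)
      fix T T' assume T: "T \<in> heaps V (n - card S)" "T' \<in> heaps V (n - card S)" "f T = f T'"
      hence "rep T \<approx> rep T'" by (simp add: f_def heap_class_eq_iff)
      thus "T = T'" using rep_heaps(1)[OF T(1)] rep_heaps(1)[OF T(2)] heap_class_eq_iff by metis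
    qed
    show "f ` heaps V (n - card S) = {H \<in> heaps V n. S \<subseteq> mins (rep H)}"
    proof (intro equalityI subsetI)
      fix H assume "H \<in> f ` heaps V (n - card S)"
      then obtain T where T: "T \<in> heaps V (n - card S)" "H = f T" by blast
      note rT = rep_heaps[OF T(1)]
      have "H \<in> heaps V n" unfolding T(2) f_def using rT(2,3) xs fS(2) lxs assms(3) by (intro heapsI) auto
      moreover have "x \<in> mins (xs @ rep T)" if x: "x \<in> S" for x
      proof -
        obtain ys zs where ys: "xs = ys @ x # zs" using x xs(2) by (metis split_list)
        have "\<not> dep x c" if "c \<in> set ys" for c
          using that ys xs assms(2) by (auto simp: dep_def ind_sets_def)
        thus ?thesis using ys by (auto simp: mins_iff_split)
      qed
      hence "S \<subseteq> mins (rep H)" using mins_teq[OF rep_teq[of "xs @ rep T"]] T(2) by (auto simp: f_def)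
      ultimately show "H \<in> {H \<in> heaps V n. S \<subseteq> mins (rep H)}" by blast
    next
      fix H assume "H \<in> {H \<in> heaps V n. S \<subseteq> mins (rep H)}"
      hence H: "H \<in> heaps V n" "S \<subseteq> mins (rep H)" by auto
      note rH = rep_heaps[OF H(1)]
      obtain t where t: "rep H \<approx> xs @ t" using mins_list_prefix xs H(2) by metis
      have "set t \<subseteq> V" "length t = n - card S"
        using teq_set[OF t] teq_length[OF t] rH lxs by auto
      hence "heap_class E t \<in> heaps V (n - card S)" by (rule heapsI)
      moreover have "f (heap_class E t) = H"
      proof -
        have "xs @ t \<approx> xs @ rep (heap_class E t)" using rep_teq by simp
        hence "rep H \<approx> xs @ rep (heap_class E t)" using t teq_trans by blast
        thus ?thesis using rH(1) heap_class_eq_iff unfolding f_def by metis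
      qed
      ultimately show "H \<in> f ` heaps V (n - card S)" by blast
    qed
  qed
  thus ?thesis by (rule bij_betw_same_card[symmetric])
qed

text \<open>The subsets of the minimal letters of a heap cancel with signs unless the heap is empty.\<close>
lemma cartier_foata:
  assumes "finite V" "\<And>u. \<not> E u u"
  shows "(\<Sum>S\<in>{S \<in> ind_sets E V. card S \<le> n}. (-1) ^ card S * of_nat (card (heaps V (n - card S))))
    = (if n = 0 then 1 else 0 :: 'b :: comm_ring_1)"
proof -
  have fin: "finite (ind_sets E V)" "finite (heaps V n)"
    using assms(1) finite_ind_sets finite_heaps by auto
  have big: "{H \<in> heaps V n. S \<subseteq> mins (rep H)} = {}" if "\<not> card S \<le> n" for S
  proof -
    have "card S \<le> n" if "H \<in> heaps V n" "S \<subseteq> mins (rep H)" for H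
    proof -
      have "card S \<le> card (set (rep H))" using that mins_subset by (intro card_mono) auto
      also have "\<dots> \<le> length (rep H)" by (rule card_length)
      finally show ?thesis using rep_heaps(3)[OF that(1)] by simp
    qed
    thus ?thesis using that by blast
  qed
  have "(\<Sum>S\<in>{S \<in> ind_sets E V. card S \<le> n}. (-1) ^ card S * of_nat (card (heaps V (n - card S))))
    = (\<Sum>S\<in>{S \<in> ind_sets E V. card S \<le> n}. (-1) ^ card S * (of_nat (card {H \<in> heaps V n. S \<subseteq> mins (rep H)}) :: 'b))"
    by (rule sum.cong) (auto simp: card_heaps_with_mins[OF assms(1)])
  also have "\<dots> = (\<Sum>S\<in>ind_sets E V. (-1) ^ card S * of_nat (card {H \<in> heaps V n. S \<subseteq> mins (rep H)}))"
  proof (rule sum.mono_neutral_left)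
    show "\<forall>S\<in>ind_sets E V - {S \<in> ind_sets E V. card S \<le> n}.
        (-1) ^ card S * (of_nat (card {H \<in> heaps V n. S \<subseteq> mins (rep H)}) :: 'b) = 0"
    proof
      fix S assume "S \<in> ind_sets E V - {S \<in> ind_sets E V. card S \<le> n}"
      hence "\<not> card S \<le> n" by simp
      from big[OF this] show "(-1) ^ card S * (of_nat (card {H \<in> heaps V n. S \<subseteq> mins (rep H)}) :: 'b) = 0"
        by (simp only: card.empty of_nat_0 mult_zero_right)
    qed
  qed (use fin in auto)
  also have "\<dots> = (\<Sum>S\<in>ind_sets E V. \<Sum>H\<in>heaps V n. if S \<subseteq> mins (rep H) then (-1) ^ card S else 0)"
  proof (rule sum.cong[OF refl])
    fix S
    have "(\<Sum>H\<in>heaps V n. if S \<subseteq> mins (rep H) then (-1) ^ card S else 0)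
      = (\<Sum>H\<in>{H \<in> heaps V n. S \<subseteq> mins (rep H)}. (-1) ^ card S :: 'b)"
      using fin(2) by (rule sum.inter_filter[symmetric])
    thus "(-1) ^ card S * of_nat (card {H \<in> heaps V n. S \<subseteq> mins (rep H)})
      = (\<Sum>H\<in>heaps V n. if S \<subseteq> mins (rep H) then (-1) ^ card S else (0 :: 'b))"
      by (simp add: mult.commute)
  qed
  also have "\<dots> = (\<Sum>H\<in>heaps V n. \<Sum>S\<in>ind_sets E V. if S \<subseteq> mins (rep H) then (-1) ^ card S else 0)"
    by (rule sum.swap)
  also have "\<dots> = (\<Sum>H\<in>heaps V n. if n = 0 then 1 else 0)"
  proof (rule sum.cong[OF refl])
    fix H assume H: "H \<in> heaps V n"
    have "S \<in> ind_sets E V" if "S \<subseteq> mins (rep H)" for S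
      using that mins_subset[of "rep H"] rep_heaps(2)[OF H] mins_indep[of _ "rep H"] assms(2)
      unfolding ind_sets_def dep_def by blast
    hence "{S \<in> ind_sets E V. S \<subseteq> mins (rep H)} = Pow (mins (rep H))" by blast
    moreover have "(\<Sum>S\<in>ind_sets E V. if S \<subseteq> mins (rep H) then (-1) ^ card S else (0 :: 'b))
      = (\<Sum>S\<in>{S \<in> ind_sets E V. S \<subseteq> mins (rep H)}. (-1) ^ card S)"
      using fin(1) by (rule sum.inter_filter[symmetric])
    moreover have "mins (rep H) = {} \<longleftrightarrow> n = 0" using rep_heaps(3)[OF H] by auto
    ultimately show "(\<Sum>S\<in>ind_sets E V. if S \<subseteq> mins (rep H) then (-1) ^ card S else (0 :: 'b)) = (if n = 0 then 1 else 0)"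
      by (simp add: sum_Pow_minus_one)
  qed
  also have "\<dots> = (if n = 0 then 1 else 0)"
  proof (cases "n = 0")
    case True
    hence "heaps V n = {heap_class E []}" by (auto simp: heaps_def)
    thus ?thesis using True by simp
  qed simp
  finally show ?thesis .
qed

text \<open>Let s be I(-t), h the heap series and p the pyramid series. From s h = 1 and t h' = p h
  follows t s' = - p s; comparing coefficients and removing the sign (-1)^n gives the claim.\<close>

lemma ind_count_recurrence_pyrs:
  assumes "finite V" "\<And>u. \<not> E u u"
  shows "of_nat n * of_nat (ind_count E V n)
    = (\<Sum>m=1..n. (-1) ^ (m - 1) * of_nat (card (pyrs V m)) * (of_nat (ind_count E V (n - m)) :: rat))"
proof -
  define h where "h = Abs_fps (\<lambda>n. of_nat (card (heaps V n)) :: rat)"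
  define p where "p = Abs_fps (\<lambda>n. of_nat (card (pyrs V n)) :: rat)"
  define s where "s = Abs_fps (\<lambda>n. (-1) ^ n * of_nat (ind_count E V n) :: rat)"
  have p0: "card (pyrs V 0) = 0"
  proof -
    have "pyrs V 0 = {}" by (auto simp: pyrs_def)
    thus ?thesis by simp
  qed
  have sh: "s * h = 1"
  proof (rule fps_ext)
    fix n
    have "(s * h) $ n = (\<Sum>i=0..n. (-1) ^ i * of_nat (ind_count E V i) * of_nat (card (heaps V (n - i))))"
      by (simp add: fps_mult_nth s_def h_def)
    also have "\<dots> = (\<Sum>i=0..n. \<Sum>S\<in>{S \<in> {S \<in> ind_sets E V. card S \<le> n}. card S = i}.
        (-1) ^ card S * of_nat (card (heaps V (n - card S))))"
    proof (rule sum.cong[OF refl])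
      fix i assume "i \<in> {0..n}"
      hence "{S \<in> {S \<in> ind_sets E V. card S \<le> n}. card S = i} = {S \<in> ind_sets E V. card S = i}" by auto
      thus "(-1) ^ i * of_nat (ind_count E V i) * of_nat (card (heaps V (n - i)))
        = (\<Sum>S\<in>{S \<in> {S \<in> ind_sets E V. card S \<le> n}. card S = i}.
          (-1) ^ card S * (of_nat (card (heaps V (n - card S))) :: rat))"
        by (simp add: ind_count_def)
    qed
    also have "\<dots> = (\<Sum>S\<in>{S \<in> ind_sets E V. card S \<le> n}. (-1) ^ card S * of_nat (card (heaps V (n - card S))))"
      by (rule sum.group) (use finite_ind_sets[OF assms(1)] in auto)
    also have "\<dots> = 1 $ n" unfolding cartier_foata[OF assms] by simp
    finally show "(s * h) $ n = 1 $ n" .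
  qed
  have Xh: "fps_X * fps_deriv h = p * h"
  proof (rule fps_ext)
    fix n
    have "(p * h) $ n = (\<Sum>i=0..n. of_nat (card (pyrs V i)) * of_nat (card (heaps V (n - i))))"
      by (simp add: fps_mult_nth p_def h_def)
    also have "\<dots> = (\<Sum>i=1..n. of_nat (card (pyrs V i)) * of_nat (card (heaps V (n - i))))"
      using p0 by (simp add: sum.atLeast_Suc_atMost)
    also have "\<dots> = of_nat (n * card (heaps V n))"
      unfolding pointed_heaps[OF assms(1)] by (simp add: mult.commute)
    also have "\<dots> = (fps_X * fps_deriv h) $ n" by (cases n) (simp_all add: h_def algebra_simps)
    finally show "(fps_X * fps_deriv h) $ n = (p * h) $ n" by simp
  qed
  have "fps_deriv (s * h) = 0" unfolding sh by simp
  hence "fps_deriv s * h = - (s * fps_deriv h)" by (simp add: add_eq_0_iff2 algebra_simps)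
  \<comment> \<open>Multiplying by s and replacing s h by 1 eliminates h without dividing power
    series.\<close>
  hence "s * fps_X * (fps_deriv s * h) = s * fps_X * - (s * fps_deriv h)" by simp
  hence "(s * h) * (fps_X * fps_deriv s) = - (s * s * (fps_X * fps_deriv h))"
    by (simp add: algebra_simps)
  also have "\<dots> = - ((s * h) * (p * s))" unfolding Xh by (simp add: algebra_simps)
  finally have Xs: "fps_X * fps_deriv s = - (p * s)" using sh by simp
  have "(fps_X * fps_deriv s) $ n = of_nat n * s $ n" by (cases n) simp_all
  hence "of_nat n * s $ n = - (\<Sum>i=0..n. p $ i * s $ (n - i))" by (simp add: Xs fps_mult_nth)
  also have "\<dots> = - (\<Sum>i=1..n. p $ i * s $ (n - i))"
    using p0 by (simp add: sum.atLeast_Suc_atMost p_def)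
  finally have "(-1) ^ n * (of_nat n * s $ n) = (\<Sum>i=1..n. - ((-1) ^ n) * (p $ i * s $ (n - i)))"
    by (simp add: sum_distrib_left sum_negf)
  also have "(-1) ^ n * (of_nat n * s $ n) = of_nat n * of_nat (ind_count E V n)"
    by (simp add: s_def mult_ac flip: power_mult_distrib)
  also have "(\<Sum>i=1..n. - ((-1) ^ n) * (p $ i * s $ (n - i)))
    = (\<Sum>m=1..n. (-1) ^ (m - 1) * of_nat (card (pyrs V m)) * of_nat (ind_count E V (n - m)))"
  proof (rule sum.cong[OF refl])
    fix m assume m: "m \<in> {1..n}"
    then obtain d where n: "n = m + d" using le_Suc_ex[of m n] by auto
    obtain m' where m': "m = Suc m'" using m by (cases m) auto
    have "- ((-1) ^ n) * (-1 :: rat) ^ d = (-1) ^ (m - 1)"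
      by (simp add: n m' power_add mult.assoc flip: power_mult_distrib)
    moreover have "- ((-1) ^ n) * (p $ m * s $ (n - m))
      = (- ((-1) ^ n) * (-1) ^ d) * (of_nat (card (pyrs V m)) * of_nat (ind_count E V (n - m)))"
      by (simp add: n p_def s_def)
    ultimately show "- ((-1) ^ n) * (p $ m * s $ (n - m))
      = (-1) ^ (m - 1) * of_nat (card (pyrs V m)) * of_nat (ind_count E V (n - m))"
      by simp
  qed
  finally show ?thesis .
qed

end

subsection \<open>Counting Lyndon heaps\<close>

locale ordered_dependence = dependence E for E :: "'a :: linorder \<Rightarrow> 'a \<Rightarrow> bool"
begin

lemma std_word_in_heap_class: "std_word (heap_class E w) \<in> heap_class E w"
proof (rule std_word_mem)
  have "heap_class E w \<subseteq> {v. set v \<subseteq> set w \<and> length v = length w}"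
    using teq_set teq_length by (auto simp: mem_heap_class_iff)
  thus "finite (heap_class E w)" using finite_lists_length_eq[of "set w"] finite_subset by blast
  show "heap_class E w \<noteq> {}" using mem_heap_class_iff teq_refl by blast
qed

lemma std_word_heap_class_inject:
  assumes "std_word (heap_class E u) = std_word (heap_class E v)"
  shows "heap_class E u = heap_class E v"
  using std_word_in_heap_class[of u] std_word_in_heap_class[of v] assms
  by (metis heap_class_eq_iff mem_heap_class_iff teq_sym teq_trans)

lemma rotation_class_refl: "mins h = {v} \<Longrightarrow> heap_class E h \<in> rotation_class h"
  unfolding rotation_class_def using conj_by_Nil teq_refl by blast

lemma rotation_class_eq:
  assumes "heap_class E q \<in> rotation_class h"
  shows "rotation_class q = rotation_class h"
proof -
  obtain q' X where q': "q \<approx> q'" "conj_by X h q'"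
    using assms unfolding rotation_class_def by (auto simp: heap_class_eq_iff)
  have X: "conj_by X h q" using conj_by_teq_right[OF q'(2)] q'(1) teq_sym by blast
  obtain Z where Z: "conj_by Z q h" using conj_by_sym[OF X] by blast
  show ?thesis unfolding rotation_class_def using conj_by_trans[OF X] conj_by_trans[OF Z] by blast
qed

lemma lyndon_iff:
  assumes "mins h = {v}" "\<not> per h"
  shows "lyndon E (heap_class E h) \<longleftrightarrow>
    (\<forall>Q\<in>rotation_class h. lex_le (std_word (heap_class E h)) (std_word Q))"
proof -
  have "pyramid E (heap_class E h)" using assms(1) pyramid_iff by blast
  moreover have "\<not> periodic E (heap_class E h)" using assms(2) periodic_iff by simp
  ultimately show ?thesis unfolding lyndon_def Ball_def rotation_class_iff[OF assms(1)] by simp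
qed

text \<open>Taken for the relation of the locale; instantiating the locale with
  \<open>induced E W\<close> turns \<open>lyndons W k\<close> into
  \<open>lyndon_heaps E W k\<close>.\<close>

definition lyndons :: "'a set \<Rightarrow> nat \<Rightarrow> 'a list set set" where
  "lyndons V k = {H. \<exists>w. set w \<subseteq> V \<and> length w = k \<and> H = heap_class E w \<and> lyndon E H}"

lemma lyndons_subset: "lyndons V k \<subseteq> aperiodic_pyrs V k"
proof
  fix H assume "H \<in> lyndons V k"
  then obtain w where w: "set w \<subseteq> V" "length w = k" "H = heap_class E w" "lyndon E H"
    by (auto simp: lyndons_def)
  then obtain v where "mins w = {v}" "\<not> per w"
    using pyramid_iff periodic_iff by (auto simp: lyndon_def)
  thus "H \<in> aperiodic_pyrs V k" using w aperiodic_pyrsI by blast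
qed

text \<open>Each rotation class is finite, so some standard word in it is least; a standard word
  lies in its heap and determines it, so the class contains exactly one Lyndon heap. Each class has
  k members by \<open>card_rotation_class\<close>.\<close>

lemma card_aperiodic_pyrs:
  assumes "finite V"
  shows "card (aperiodic_pyrs V k) = k * card (lyndons V k)"
proof -
  have fin: "finite (lyndons V k)"
    by (rule finite_subset[OF lyndons_subset finite_aperiodic_pyrs[OF assms]])
  have "aperiodic_pyrs V k = (\<Union>L\<in>lyndons V k. rotation_class (rep L))"
  proof (intro equalityI subsetI)
    fix H assume "H \<in> aperiodic_pyrs V k"
    note H = rep_aperiodic_pyrs[OF this]
    obtain v where v: "mins (rep H) = {v}" using H(4) by blast
    have HH: "H \<in> rotation_class (rep H)" using rotation_class_refl[OF v] H(1) by simp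
    \<comment> \<open>Finiteness, needed to choose a minimum, is read off from the positive
      cardinality.\<close>
    hence "card (rotation_class (rep H)) > 0"
      using card_rotation_class[OF v H(5)] v mins_Nil by (cases "rep H") simp_all
    hence "finite (rotation_class (rep H))" by (rule card_ge_0_finite)
    then obtain L where L: "L \<in> rotation_class (rep H)"
      "\<forall>Q\<in>rotation_class (rep H). lex_le (std_word L) (std_word Q)"
      using finite_lex_min[of "rotation_class (rep H)" std_word] HH by blast
    then obtain q u X where q: "L = heap_class E q" "mins q = {u}" "conj_by X (rep H) q"
      unfolding rotation_class_def by blast
    have eq: "rotation_class q = rotation_class (rep H)" using rotation_class_eq L(1) q(1) by simp
    have "\<not> per q"
      using conj_by_sym[OF q(3)] conj_by_per H(5) by metis
    hence "lyndon E L" using lyndon_iff[OF q(2)] L(2) q(1) eq by simp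
    moreover have "set q \<subseteq> V" "length q = k"
      using conj_by_set[OF q(3)] conj_by_mset[OF q(3)] H(2,3) by (simp, metis size_mset)
    ultimately have "L \<in> lyndons V k" using q(1) unfolding lyndons_def by blast
    moreover have "rotation_class (rep L) = rotation_class (rep H)"
    proof (rule rotation_class_eq)
      have "heap_class E (rep L) = L" using rep_teq[of q] q(1) heap_class_eq_iff by metis
      thus "heap_class E (rep L) \<in> rotation_class (rep H)" using L(1) by simp
    qed
    ultimately show "H \<in> (\<Union>L\<in>lyndons V k. rotation_class (rep L))" using HH by blast
  next
    fix H assume "H \<in> (\<Union>L\<in>lyndons V k. rotation_class (rep L))"
    then obtain L where L: "L \<in> lyndons V k" "H \<in> rotation_class (rep L)" by blast
    have "L \<in> aperiodic_pyrs V k" using L(1) lyndons_subset by blast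
    note rL = rep_aperiodic_pyrs[OF this]
    obtain q u X where q: "H = heap_class E q" "mins q = {u}" "conj_by X (rep L) q"
      using L(2) unfolding rotation_class_def by blast
    have "\<not> per q" using conj_by_sym[OF q(3)] conj_by_per rL(5) by metis
    moreover have "set q \<subseteq> V" "length q = k"
      using conj_by_set[OF q(3)] conj_by_mset[OF q(3)] rL(2,3) by (simp, metis size_mset)
    ultimately show "H \<in> aperiodic_pyrs V k" using q(1,2) aperiodic_pyrsI by blast
  qed
  moreover have "card (rotation_class (rep L)) = k" if "L \<in> lyndons V k" for L
  proof -
    have "L \<in> aperiodic_pyrs V k" using that lyndons_subset by blast
    note rL = rep_aperiodic_pyrs[OF this]
    show ?thesis using rL(4) card_rotation_class[OF _ rL(5)] rL(3) by blast
  qed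
  moreover have "L = L'"
    if L: "L \<in> lyndons V k" "L' \<in> lyndons V k" and Q: "Q \<in> rotation_class (rep L)" "Q \<in> rotation_class (rep L')"
    for L L' Q
  proof -
    have "L \<in> aperiodic_pyrs V k" "L' \<in> aperiodic_pyrs V k" using L lyndons_subset by blast+
    note rL = rep_aperiodic_pyrs[OF this(1)] and rL' = rep_aperiodic_pyrs[OF this(2)]
    obtain v v' where v: "mins (rep L) = {v}" "mins (rep L') = {v'}" using rL(4) rL'(4) by blast
    obtain q where q: "Q = heap_class E q" using Q(1) unfolding rotation_class_def by blast
    have eq: "rotation_class (rep L) = rotation_class (rep L')"
      using rotation_class_eq[of q] Q q by metis
    have "lyndon E (heap_class E (rep L))" "lyndon E (heap_class E (rep L'))"
      using L rL(1) rL'(1) unfolding lyndons_def by auto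
    hence min: "\<forall>Q\<in>rotation_class (rep L). lex_le (std_word (heap_class E (rep L))) (std_word Q)"
      "\<forall>Q\<in>rotation_class (rep L'). lex_le (std_word (heap_class E (rep L'))) (std_word Q)"
      using lyndon_iff v rL(5) rL'(5) by blast+
    have "std_word (heap_class E (rep L)) = std_word (heap_class E (rep L'))"
      using min rotation_class_refl[OF v(1)] rotation_class_refl[OF v(2)] eq
      by (intro lex_le_antisym) auto
    thus ?thesis using std_word_heap_class_inject rL(1) rL'(1) by metis
  qed
  hence "\<forall>L\<in>lyndons V k. \<forall>L'\<in>lyndons V k. L \<noteq> L' \<longrightarrow> rotation_class (rep L) \<inter> rotation_class (rep L') = {}"
    by blast
  moreover have "finite (rotation_class (rep L))" if L: "L \<in> lyndons V k" for L
    by (rule finite_subset[OF _ finite_aperiodic_pyrs[OF assms, of k]])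
      (use calculation(1) L in blast)
  ultimately show ?thesis using fin by (simp add: card_UN_disjoint)
qed

lemma ind_count_recurrence:
  assumes "finite V" "\<And>u. \<not> E u u"
  shows "of_nat n * of_nat (ind_count E V n)
    = (\<Sum>m=1..n. (-1) ^ (m - 1) * (\<Sum>k | k dvd m. of_nat k * of_nat (card (lyndons V k))) *
        (of_nat (ind_count E V (n - m)) :: rat))"
  unfolding ind_count_recurrence_pyrs[OF assms]
  by (rule sum.cong) (auto simp: card_pyrs[OF assms(1)] card_aperiodic_pyrs[OF assms(1)])

end

section \<open>Polynomial functions of infinitely many variables\<close>

text \<open>Polynomial identities in the exponents e k are wanted at negative values but are proved
  by counting at natural ones. Closing constants and coordinates under sums and products is enough:
  the transfer only ever varies one coordinate at a time.\<close>

inductive polyfun :: "(('i \<Rightarrow> 'a :: field_char_0) \<Rightarrow> 'a) \<Rightarrow> bool" where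
  polyfun_const: "polyfun (\<lambda>e. c)"
| polyfun_coord: "polyfun (\<lambda>e. e i)"
| polyfun_add: "polyfun f \<Longrightarrow> polyfun g \<Longrightarrow> polyfun (\<lambda>e. f e + g e)"
| polyfun_mult: "polyfun f \<Longrightarrow> polyfun g \<Longrightarrow> polyfun (\<lambda>e. f e * g e)"

lemma polyfun_sum: "(\<And>x. x \<in> A \<Longrightarrow> polyfun (f x)) \<Longrightarrow> polyfun (\<lambda>e. \<Sum>x\<in>A. f x e)"
  by (induction A rule: infinite_finite_induct) (auto intro: polyfun.intros)

lemma polyfun_prod: "(\<And>x. x \<in> A \<Longrightarrow> polyfun (f x)) \<Longrightarrow> polyfun (\<lambda>e. \<Prod>x\<in>A. f x e)"
  by (induction A rule: infinite_finite_induct) (auto intro: polyfun.intros)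

lemma polyfun_gbinomial: "polyfun (\<lambda>e. e i gchoose m)"
proof -
  have "polyfun (\<lambda>e. (\<Prod>j = 0..<m. e i + (- of_nat j)) * inverse (fact m))"
    by (intro polyfun.intros polyfun_prod)
  thus ?thesis by (simp add: gbinomial_prod_rev field_simps)
qed

lemma polyfun_slice:
  assumes "polyfun f"
  shows "\<exists>p. \<forall>x. f (e(i := x)) = poly p x"
  using assms
proof induction
  case (polyfun_const c)
  have "\<forall>x. c = poly [:c:] x" by simp
  thus ?case by blast
next
  case (polyfun_coord j)
  show ?case
  proof (cases "j = i")
    case True
    hence "\<forall>x. (e(i := x)) j = poly [:0, 1:] x" by simp
    thus ?thesis by blast
  next
    case False
    hence "\<forall>x. (e(i := x)) j = poly [:e j:] x" by simp
    thus ?thesis by blast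
  qed
next
  case (polyfun_add f g)
  thus ?case by (metis poly_add)
next
  case (polyfun_mult f g)
  thus ?case by (metis poly_mult)
qed

text \<open>Induction on the set of coordinates that may leave the naturals: as a function of one
  such coordinate, f is a univariate polynomial with every natural number as a root, hence
  zero.\<close>

lemma polyfun_vanish:
  assumes "polyfun f" "\<And>n :: 'i \<Rightarrow> nat. f (\<lambda>i. of_nat (n i)) = 0" "finite K" "\<forall>i. i \<notin> K \<longrightarrow> e i \<in> \<nat>"
  shows "f e = (0 :: 'a :: field_char_0)"
  using assms(3,4)
proof (induction K arbitrary: e rule: finite_induct)
  case empty
  hence "\<forall>i. \<exists>n. e i = of_nat n" by (auto simp: Nats_def)
  then obtain n where "\<And>i. e i = of_nat (n i)" by metis
  hence "e = (\<lambda>i. of_nat (n i))" by auto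
  thus ?case using assms(2) by simp
next
  case (insert i K)
  obtain p where p: "\<And>x. f (e(i := x)) = poly p x" using polyfun_slice[OF assms(1)] by blast
  have "poly p (of_nat n) = 0" for n
  proof -
    have "\<forall>j. j \<notin> K \<longrightarrow> (e(i := of_nat n)) j \<in> \<nat>" using insert.prems by auto
    thus ?thesis using insert.IH p by metis
  qed
  hence "range of_nat \<subseteq> {x. poly p x = 0}" by auto
  moreover have "infinite (range (of_nat :: nat \<Rightarrow> 'a))"
    using finite_imageD[OF _ inj_of_nat] by blast
  ultimately have "p = 0" using poly_roots_finite finite_subset by blast
  thus ?case using p[of "e i"] by simp
qed

lemma polyfun_eqI:
  assumes "polyfun f" "polyfun g" "\<And>n :: 'i \<Rightarrow> nat. f (\<lambda>i. of_nat (n i)) = g (\<lambda>i. of_nat (n i))"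
    and "finite K" "\<forall>i. i \<notin> K \<longrightarrow> e i \<in> \<nat>"
  shows "f e = (g e :: 'a :: field_char_0)"
proof -
  have "polyfun (\<lambda>e. f e + (- 1) * g e)" using assms by (intro polyfun.intros)
  hence "f e + (- 1) * g e = 0"
    by (rule polyfun_vanish[OF _ _ assms(4,5)]) (simp add: assms(3))
  thus ?thesis by simp
qed

section \<open>Sums over partitions\<close>

definition parts_eq :: "nat \<Rightarrow> nat list set" where
  "parts_eq n = {\<mu>. is_partition \<mu> \<and> sum_list \<mu> = n}"

definition parts_le :: "nat \<Rightarrow> nat list set" where
  "parts_le n = {\<mu>. is_partition \<mu> \<and> sum_list \<mu> \<le> n}"

text \<open>By the binomial series, the coefficient of the \<open>pbar\<close> product indexed by
  \<mu> in the product over k of (1 + pbar_k)^(e k).\<close>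

definition pweight :: "(nat \<Rightarrow> rat) \<Rightarrow> nat list \<Rightarrow> rat" where
  "pweight e \<mu> = (\<Prod>k\<in>set \<mu>. e k gchoose mult_part k \<mu>)"

text \<open>The coefficient of t^n in the product over k of (1 + t^k)^(e k), a polynomial in
  finitely many of the e k.\<close>

definition psum :: "(nat \<Rightarrow> rat) \<Rightarrow> nat \<Rightarrow> rat" where
  "psum e n = (\<Sum>\<mu>\<in>parts_eq n. pweight e \<mu>)"

lemma mult_part_notin [simp]: "k \<notin> set \<mu> \<Longrightarrow> mult_part k \<mu> = 0"
  by (simp add: mult_part_def)

lemma parts_set: "is_partition \<mu> \<Longrightarrow> sum_list \<mu> \<le> n \<Longrightarrow> set \<mu> \<subseteq> {1..n}"
proof
  fix k assume "is_partition \<mu>" "sum_list \<mu> \<le> n" "k \<in> set \<mu>"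
  moreover from this have "k \<le> sum_list \<mu>" by (intro member_le_sum_list) auto
  ultimately show "k \<in> {1..n}" by (cases k) (auto simp: is_partition_def)
qed

lemma length_le_sum_list: "0 \<notin> set \<mu> \<Longrightarrow> length \<mu> \<le> sum_list (\<mu> :: nat list)"
  by (induction \<mu>) auto

lemma finite_parts_le [simp]: "finite (parts_le n)"
proof (rule finite_subset)
  show "parts_le n \<subseteq> {\<mu>. set \<mu> \<subseteq> {1..n} \<and> length \<mu> \<le> n}"
  proof
    fix \<mu> assume \<mu>: "\<mu> \<in> parts_le n"
    hence "length \<mu> \<le> sum_list \<mu>" by (intro length_le_sum_list) (simp add: parts_le_def is_partition_def)
    thus "\<mu> \<in> {\<mu>. set \<mu> \<subseteq> {1..n} \<and> length \<mu> \<le> n}" using \<mu> parts_set[of \<mu> n] by (simp add: parts_le_def)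
  qed
  show "finite {\<mu>. set \<mu> \<subseteq> {1..n} \<and> length \<mu> \<le> n}" by (rule finite_lists_length_le) simp
qed

lemma parts_eq_subset: "n \<le> d \<Longrightarrow> parts_eq n \<subseteq> parts_le d"
  by (auto simp: parts_eq_def parts_le_def)

lemma finite_parts_eq [simp]: "finite (parts_eq n)"
  using finite_subset[OF parts_eq_subset[OF order_refl] finite_parts_le] .

lemma pweight_eq: "finite K \<Longrightarrow> set \<mu> \<subseteq> K \<Longrightarrow> pweight e \<mu> = (\<Prod>k\<in>K. e k gchoose mult_part k \<mu>)"
  unfolding pweight_def by (rule prod.mono_neutral_left) auto

lemma pweight_cong: "(\<And>k. k \<in> set \<mu> \<Longrightarrow> e k = e' k) \<Longrightarrow> pweight e \<mu> = pweight e' \<mu>"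
  unfolding pweight_def by (rule prod.cong) auto

lemma polyfun_pweight: "polyfun (\<lambda>e. pweight e \<mu>)"
  unfolding pweight_def by (intro polyfun_prod polyfun_gbinomial)

lemma polyfun_psum: "polyfun (\<lambda>e. psum e n)"
  unfolding psum_def by (intro polyfun_sum polyfun_pweight)

lemma partition_eq_iff:
  assumes "is_partition \<mu>"
  shows "rev (sorted_list_of_multiset M) = \<mu> \<longleftrightarrow> M = mset \<mu>"
proof
  assume "rev (sorted_list_of_multiset M) = \<mu>"
  thus "M = mset \<mu>" by (metis mset_rev mset_sorted_list_of_multiset)
next
  assume M: "M = mset \<mu>"
  have "sorted (rev \<mu>)" using assms by (simp add: is_partition_def sorted_wrt_rev)
  hence "sort \<mu> = rev \<mu>" by (metis mset_rev properties_for_sort)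
  thus "rev (sorted_list_of_multiset M) = \<mu>" by (simp add: M)
qed

text \<open>For an integer vector e, a box (k, i) with i < e k stands for one factor 1 + pbar_k.\<close>

definition boxes :: "(nat \<Rightarrow> nat) \<Rightarrow> nat \<Rightarrow> (nat \<times> nat) set" where
  "boxes e d = (SIGMA k:{1..d}. {..<e k})"

definition shape :: "(nat \<times> nat) set \<Rightarrow> nat list" where
  "shape J = rev (sorted_list_of_multiset (image_mset fst (mset_set J)))"

lemma finite_boxes [simp]: "finite (boxes e d)"
  by (simp add: boxes_def)

lemma boxes_pos: "J \<subseteq> boxes e d \<Longrightarrow> x \<in> J \<Longrightarrow> fst x > 0"
  by (auto simp: boxes_def)

lemma mset_shape [simp]: "mset (shape J) = image_mset fst (mset_set J)"
  by (simp add: shape_def)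

lemma sum_list_shape: "sum_list (shape J) = (\<Sum>x\<in>J. fst x)"
  by (metis mset_shape sum_mset_sum_list sum_unfold_sum_mset)

lemma shape_partition:
  assumes "J \<subseteq> boxes e d"
  shows "is_partition (shape J)"
proof -
  have "finite J" using assms finite_boxes finite_subset by blast
  moreover have "set (shape J) = fst ` set_mset (mset_set J)"
    by (metis mset_shape set_image_mset set_mset_mset)
  ultimately have "0 \<notin> set (shape J)" using boxes_pos[OF assms] by force
  moreover have "sorted_wrt (\<ge>) (shape J)" unfolding shape_def by (simp add: sorted_wrt_rev)
  ultimately show ?thesis by (simp add: is_partition_def)
qed

lemma count_image_fst: "finite J \<Longrightarrow> count (image_mset fst (mset_set J)) k = card {i. (k, i) \<in> J}"
proof -
  assume fin: "finite J"
  have "count (image_mset fst (mset_set J)) k = card {x \<in> J. fst x = k}"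
    using fin by (simp add: count_image_mset' eq_commute[of k])
  also have "{x \<in> J. fst x = k} = Pair k ` {i. (k, i) \<in> J}" by auto
  finally show ?thesis by (simp add: card_image inj_on_def)
qed

text \<open>Boxes are chosen row by row: the multiplicity of k in \<mu> prescribes how many of the e
  k boxes of row k are taken.\<close>

lemma card_shape:
  assumes "is_partition \<mu>" "set \<mu> \<subseteq> {1..d}"
  shows "card {J \<in> Pow (boxes e d). shape J = \<mu>} = (\<Prod>k\<in>{1..d}. e k choose mult_part k \<mu>)"
proof -
  define B where "B = (\<Pi>\<^sub>E k\<in>{1..d}. {A. A \<subseteq> {..<e k} \<and> card A = mult_part k \<mu>})"
  define f where "f J = (\<lambda>k\<in>{1..d}. {i. (k, i) \<in> J})" for J :: "(nat \<times> nat) set"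
  have shape_iff: "shape J = \<mu> \<longleftrightarrow> (\<forall>k\<in>{1..d}. card {i. (k, i) \<in> J} = mult_part k \<mu>)"
    if "J \<subseteq> boxes e d" for J
  proof -
    have fin: "finite J" using that finite_boxes finite_subset by blast
    have "shape J = \<mu> \<longleftrightarrow> (\<forall>k. card {i. (k, i) \<in> J} = mult_part k \<mu>)"
      unfolding shape_def partition_eq_iff[OF assms(1)] multiset_eq_iff count_image_fst[OF fin] mult_part_def ..
    also have "\<dots> \<longleftrightarrow> (\<forall>k\<in>{1..d}. card {i. (k, i) \<in> J} = mult_part k \<mu>)"
    proof -
      have "card {i. (k, i) \<in> J} = mult_part k \<mu>" if "k \<notin> {1..d}" for k
      proof -
        have "{i. (k, i) \<in> J} = {}" using \<open>J \<subseteq> boxes e d\<close> that by (auto simp: boxes_def)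
        moreover have "k \<notin> set \<mu>" using assms(2) that by blast
        ultimately show ?thesis by simp
      qed
      thus ?thesis by blast
    qed
    finally show ?thesis .
  qed
  have "bij_betw f {J \<in> Pow (boxes e d). shape J = \<mu>} B"
  proof (rule bij_betwI[where g = "\<lambda>h. SIGMA k:{1..d}. h k"])
    show "f \<in> {J \<in> Pow (boxes e d). shape J = \<mu>} \<rightarrow> B"
    proof
      fix J assume "J \<in> {J \<in> Pow (boxes e d). shape J = \<mu>}"
      hence J: "J \<subseteq> boxes e d" "shape J = \<mu>" by auto
      have "{i. (k, i) \<in> J} \<subseteq> {..<e k}" for k using J(1) by (auto simp: boxes_def)
      thus "f J \<in> B" using shape_iff[OF J(1)] J(2) by (simp add: f_def B_def PiE_iff)
    qed
    show "(\<lambda>h. SIGMA k:{1..d}. h k) \<in> B \<rightarrow> {J \<in> Pow (boxes e d). shape J = \<mu>}"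
    proof
      fix h assume h: "h \<in> B"
      have sub: "(SIGMA k:{1..d}. h k) \<subseteq> boxes e d" using h by (auto simp: B_def boxes_def PiE_iff)
      have "card {i. (k, i) \<in> (SIGMA k:{1..d}. h k)} = mult_part k \<mu>" if k: "k \<in> {1..d}" for k
      proof -
        have "{i. (k, i) \<in> (SIGMA k:{1..d}. h k)} = h k" using k by auto
        thus ?thesis using h k by (simp add: B_def PiE_iff)
      qed
      hence "shape (SIGMA k:{1..d}. h k) = \<mu>" unfolding shape_iff[OF sub] by blast
      thus "(SIGMA k:{1..d}. h k) \<in> {J \<in> Pow (boxes e d). shape J = \<mu>}" using sub by blast
    qed
    show "(SIGMA k:{1..d}. f J k) = J" if "J \<in> {J \<in> Pow (boxes e d). shape J = \<mu>}" for J
      using that by (auto simp: f_def boxes_def)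
    show "f (SIGMA k:{1..d}. h k) = h" if "h \<in> B" for h
      using that by (auto simp: f_def B_def fun_eq_iff PiE_iff extensional_def)
  qed
  hence "card {J \<in> Pow (boxes e d). shape J = \<mu>} = card B" by (rule bij_betw_same_card)
  thus ?thesis by (simp add: B_def card_PiE n_subsets)
qed

text \<open>Groups box sets by shape. Those with total above d may have a shape outside
  \<open>parts_le d\<close>; the vanishing of g disposes of them.\<close>

lemma sum_boxes_shape:
  assumes "\<And>\<mu>. sum_list \<mu> > d \<Longrightarrow> g \<mu> = 0"
  shows "(\<Sum>J\<in>Pow (boxes e d). g (shape J)) = (\<Sum>\<mu>\<in>parts_le d. pweight (\<lambda>k. of_nat (e k)) \<mu> * g \<mu>)"
proof -
  have "(\<Sum>J\<in>Pow (boxes e d). g (shape J)) = (\<Sum>J\<in>{J \<in> Pow (boxes e d). shape J \<in> parts_le d}. g (shape J))"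
  proof (rule sum.mono_neutral_right)
    show "\<forall>J\<in>Pow (boxes e d) - {J \<in> Pow (boxes e d). shape J \<in> parts_le d}. g (shape J) = 0"
    proof
      fix J assume "J \<in> Pow (boxes e d) - {J \<in> Pow (boxes e d). shape J \<in> parts_le d}"
      hence "sum_list (shape J) > d" using shape_partition[of J] by (auto simp: parts_le_def)
      thus "g (shape J) = 0" by (rule assms)
    qed
  qed auto
  also have "\<dots> = (\<Sum>\<mu>\<in>parts_le d. \<Sum>J\<in>{J \<in> {J \<in> Pow (boxes e d). shape J \<in> parts_le d}. shape J = \<mu>}. g (shape J))"
    by (rule sum.group[symmetric]) auto
  also have "\<dots> = (\<Sum>\<mu>\<in>parts_le d. pweight (\<lambda>k. of_nat (e k)) \<mu> * g \<mu>)"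
  proof (rule sum.cong[OF refl])
    fix \<mu> assume \<mu>: "\<mu> \<in> parts_le d"
    hence sub: "set \<mu> \<subseteq> {1..d}" "is_partition \<mu>" using parts_set by (auto simp: parts_le_def)
    have "{J \<in> {J \<in> Pow (boxes e d). shape J \<in> parts_le d}. shape J = \<mu>} = {J \<in> Pow (boxes e d). shape J = \<mu>}"
      using \<mu> by auto
    moreover have "of_nat (card {J \<in> Pow (boxes e d). shape J = \<mu>}) = pweight (\<lambda>k. of_nat (e k)) \<mu>"
      using card_shape[OF sub(2,1), of e] pweight_eq[OF _ sub(1)] by (simp add: binomial_gbinomial)
    ultimately show "(\<Sum>J\<in>{J \<in> {J \<in> Pow (boxes e d). shape J \<in> parts_le d}. shape J = \<mu>}. g (shape J))
      = pweight (\<lambda>k. of_nat (e k)) \<mu> * g \<mu>" by (simp only: mem_Collect_eq) simp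
  qed
  finally show ?thesis .
qed

lemma psum_boxes:
  assumes "n \<le> d"
  shows "psum (\<lambda>k. of_nat (e k)) n = of_nat (card {J \<in> Pow (boxes e d). (\<Sum>x\<in>J. fst x) = n})"
proof -
  have "of_nat (card {J \<in> Pow (boxes e d). (\<Sum>x\<in>J. fst x) = n})
    = (\<Sum>J\<in>Pow (boxes e d). if sum_list (shape J) = n then 1 else 0 :: rat)"
    by (simp add: sum_list_shape Int_def flip: sum.inter_filter)
  also have "\<dots> = (\<Sum>\<mu>\<in>parts_le d. pweight (\<lambda>k. of_nat (e k)) \<mu> * (if sum_list \<mu> = n then 1 else 0))"
    using assms by (intro sum_boxes_shape) auto
  also have "\<dots> = (\<Sum>\<mu>\<in>parts_le d. if sum_list \<mu> = n then pweight (\<lambda>k. of_nat (e k)) \<mu> else 0)"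
    by (rule sum.cong) auto
  also have "\<dots> = (\<Sum>\<mu>\<in>{\<mu> \<in> parts_le d. sum_list \<mu> = n}. pweight (\<lambda>k. of_nat (e k)) \<mu>)"
    by (rule sum.inter_filter[symmetric]) simp
  also have "{\<mu> \<in> parts_le d. sum_list \<mu> = n} = parts_eq n"
    using assms by (auto simp: parts_eq_def parts_le_def)
  finally show ?thesis by (simp add: psum_def)
qed

section \<open>Logarithmic derivatives\<close>

text \<open>The series k t^k / (1 + t^k), that is t times the logarithmic derivative of 1 + t^k,
  given by its coefficients.\<close>

definition log_deriv :: "nat \<Rightarrow> rat fps" where
  "log_deriv k = Abs_fps (\<lambda>m. if m > 0 \<and> k dvd m then of_nat k * (-1) ^ (m div k - 1) else 0)"

lemma log_deriv:
  assumes "k > 0"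
  shows "fps_X * fps_deriv (1 + fps_X ^ k) = (1 + fps_X ^ k) * log_deriv k"
proof -
  have "(1 + fps_X ^ k) * log_deriv k = of_nat k * fps_X ^ k"
  proof (rule fps_ext)
    fix m
    have eq: "((1 + fps_X ^ k) * log_deriv k) $ m = log_deriv k $ m + (if m < k then 0 else log_deriv k $ (m - k))"
      by (simp add: distrib_right fps_X_power_mult_nth)
    also have "\<dots> = (of_nat k * fps_X ^ k) $ m"
    proof (cases "k dvd m")
      case False
      thus ?thesis by (auto simp: log_deriv_def fps_X_power_nth dvd_minus_self)
    next
      case True
      then obtain q where q: "m = k * q" by blast
      consider "q = 0" | "q = 1" | j where "q = Suc (Suc j)"
        by (metis One_nat_def not0_implies_Suc)
      thus ?thesis
      proof cases
        case 3
        have "m - k = k * Suc j" using q 3 by simp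
        thus ?thesis using q 3 assms by (simp add: log_deriv_def fps_X_power_nth)
      qed (use q assms in \<open>simp_all add: log_deriv_def fps_X_power_nth\<close>)
    qed
    finally show "((1 + fps_X ^ k) * log_deriv k) $ m = (of_nat k * fps_X ^ k) $ m" .
  qed
  moreover have "fps_X * fps_deriv (1 + fps_X ^ k) = (of_nat k * fps_X ^ k :: rat fps)"
  proof (rule fps_ext)
    fix m
    show "(fps_X * fps_deriv (1 + fps_X ^ k)) $ m = (of_nat k * fps_X ^ k :: rat fps) $ m"
      using assms by (cases m) (auto simp: fps_X_power_nth simp del: fps_deriv_add)
  qed
  ultimately show ?thesis by simp
qed

text \<open>For natural exponents F is a finite product with one factor per box, and its logarithmic
  derivative is a sum over boxes. Leaving out the rows above n does not change coefficients up to
  degree n.\<close>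

lemma psum_recurrence_nat:
  fixes e :: "nat \<Rightarrow> nat"
  shows "of_nat n * psum (\<lambda>k. of_nat (e k)) n
    = (\<Sum>m=1..n. (\<Sum>k | k dvd m. of_nat k * of_nat (e k) * (-1) ^ (m div k - 1)) * psum (\<lambda>k. of_nat (e k)) (n - m))"
proof -
  define F where "F = (\<Prod>x\<in>boxes e n. 1 + fps_X ^ fst x :: rat fps)"
  have coeff: "F $ m = psum (\<lambda>k. of_nat (e k)) m" if "m \<le> n" for m
  proof -
    have "F = (\<Sum>T\<in>Pow (boxes e n). \<Prod>x\<in>T. fps_X ^ fst x)"
      unfolding F_def by (subst add.commute, subst prod_add) simp_all
    also have "\<dots> = (\<Sum>T\<in>Pow (boxes e n). fps_X ^ (\<Sum>x\<in>T. fst x))" by (simp add: power_sum)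
    finally have "F $ m = (\<Sum>T\<in>Pow (boxes e n). if m = (\<Sum>x\<in>T. fst x) then 1 else 0)"
      by (simp add: fps_sum_nth fps_X_power_nth)
    also have "\<dots> = of_nat (card {T \<in> Pow (boxes e n). (\<Sum>x\<in>T. fst x) = m})"
      by (simp add: Int_def eq_commute[of m] flip: sum.inter_filter)
    finally show ?thesis using psum_boxes[OF that] by simp
  qed
  have deriv: "fps_X * fps_deriv (\<Prod>x\<in>I. 1 + fps_X ^ fst x)
    = (\<Prod>x\<in>I. 1 + fps_X ^ fst x) * (\<Sum>x\<in>I. log_deriv (fst x))" if "finite I" "\<forall>x\<in>I. fst x > 0" for I :: "(nat \<times> nat) set"
    using that
  proof (induction I rule: finite_induct)
    case (insert x I)
    define P where "P = (\<Prod>x\<in>I. 1 + fps_X ^ fst x :: rat fps)"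
    have "fps_X * fps_deriv ((1 + fps_X ^ fst x) * P)
      = (fps_X * fps_deriv (1 + fps_X ^ fst x)) * P + (1 + fps_X ^ fst x) * (fps_X * fps_deriv P)"
      by (simp only: fps_deriv_mult) (simp only: algebra_simps)
    also have "\<dots> = ((1 + fps_X ^ fst x) * log_deriv (fst x)) * P + (1 + fps_X ^ fst x) * (P * (\<Sum>x\<in>I. log_deriv (fst x)))"
      using log_deriv[of "fst x"] insert by (simp add: P_def)
    also have "\<dots> = ((1 + fps_X ^ fst x) * P) * (log_deriv (fst x) + (\<Sum>x\<in>I. log_deriv (fst x)))"
      by (simp only: algebra_simps)
    finally show ?case using insert.hyps by (simp add: P_def)
  qed simp
  have XF: "fps_X * fps_deriv F = F * (\<Sum>x\<in>boxes e n. log_deriv (fst x))"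
    unfolding F_def by (rule deriv) (use boxes_pos[of "boxes e n" e n] in auto)
  have D: "(\<Sum>x\<in>boxes e n. log_deriv (fst x)) $ m = (\<Sum>k | k dvd m. of_nat k * of_nat (e k) * (-1) ^ (m div k - 1))"
    if m: "m \<in> {1..n}" for m
  proof -
    have "(\<Sum>x\<in>boxes e n. log_deriv (fst x)) $ m = (\<Sum>k\<in>{1..n}. of_nat (e k) * log_deriv k $ m)"
      by (simp add: boxes_def fps_sum_nth sum.Sigma[symmetric, of _ _ "\<lambda>k _. log_deriv k $ m", unfolded case_prod_unfold])
    also have "\<dots> = (\<Sum>k\<in>{k \<in> {1..n}. k dvd m}. of_nat (e k) * log_deriv k $ m)"
      by (rule sum.mono_neutral_right) (auto simp: log_deriv_def)
    also have "{k \<in> {1..n}. k dvd m} = {k. k dvd m}"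
      using m by (auto simp: Suc_le_eq dest: dvd_imp_le intro!: Nat.gr0I)
    also have "(\<Sum>k | k dvd m. of_nat (e k) * log_deriv k $ m)
      = (\<Sum>k | k dvd m. of_nat k * of_nat (e k) * (-1) ^ (m div k - 1))"
      using m by (intro sum.cong) (auto simp: log_deriv_def)
    finally show ?thesis .
  qed
  have D0: "(\<Sum>x\<in>boxes e n. log_deriv (fst x)) $ 0 = 0" by (simp add: fps_sum_nth log_deriv_def)
  have "of_nat n * psum (\<lambda>k. of_nat (e k)) n = (fps_X * fps_deriv F) $ n"
    using coeff[of n] by (cases n) simp_all
  also have "\<dots> = (\<Sum>m=0..n. (\<Sum>x\<in>boxes e n. log_deriv (fst x)) $ m * F $ (n - m))"
    unfolding XF by (subst mult.commute) (simp add: fps_mult_nth)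
  also have "\<dots> = (\<Sum>m=1..n. (\<Sum>x\<in>boxes e n. log_deriv (fst x)) $ m * F $ (n - m))"
    using D0 by (simp add: sum.atLeast_Suc_atMost)
  also have "\<dots> = (\<Sum>m=1..n. (\<Sum>k | k dvd m. of_nat k * of_nat (e k) * (-1) ^ (m div k - 1)) * psum (\<lambda>k. of_nat (e k)) (n - m))"
    by (rule sum.cong) (auto simp: D coeff)
  finally show ?thesis .
qed

lemma psum_cong: "(\<And>k. k \<in> {1..n} \<Longrightarrow> e k = e' k) \<Longrightarrow> psum e n = psum e' n"
  unfolding psum_def using parts_set[of _ n]
  by (intro sum.cong pweight_cong) (auto simp: parts_eq_def subset_iff)

lemma psum_recurrence:
  "of_nat n * psum e n
    = (\<Sum>m=1..n. (\<Sum>k | k dvd m. of_nat k * e k * (-1) ^ (m div k - 1)) * psum e (n - m))"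
proof -
  \<comment> \<open>Only the exponents in 1..n enter the identity. Setting the others to 0 leaves
    finitely many coordinates outside the naturals, as \<open>polyfun_eqI\<close> demands.\<close>
  define e' where "e' k = (if k \<in> {1..n} then e k else 0)" for k
  have "of_nat n * psum e' n
    = (\<Sum>m=1..n. (\<Sum>k | k dvd m. of_nat k * e' k * (-1) ^ (m div k - 1)) * psum e' (n - m))"
  proof (rule polyfun_eqI[where K = "{1..n}" and f = "\<lambda>e. of_nat n * psum e n"
      and g = "\<lambda>e. \<Sum>m=1..n. (\<Sum>k | k dvd m. of_nat k * e k * (-1) ^ (m div k - 1)) * psum e (n - m)"])
    show "polyfun (\<lambda>e. of_nat n * psum e n)" by (intro polyfun.intros polyfun_psum)
    show "polyfun (\<lambda>e. \<Sum>m=1..n. (\<Sum>k | k dvd m. of_nat k * e k * (-1) ^ (m div k - 1)) * psum e (n - m))"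
      by (intro polyfun.intros polyfun_psum polyfun_sum)
    show "\<forall>k. k \<notin> {1..n} \<longrightarrow> e' k \<in> \<nat>" by (auto simp: e'_def)
  qed (simp_all add: psum_recurrence_nat)
  moreover have "psum e' m = psum e m" if "m \<le> n" for m
    using that by (intro psum_cong) (simp add: e'_def)
  moreover have "(\<Sum>k | k dvd m. of_nat k * e' k * (-1) ^ (m div k - 1))
    = (\<Sum>k | k dvd m. of_nat k * e k * (-1) ^ (m div k - 1))" if "m \<in> {1..n}" for m
    using that by (intro sum.cong) (auto simp: e'_def Suc_le_eq dest: dvd_imp_le intro!: Nat.gr0I)
  ultimately show ?thesis by simp
qed

section \<open>Coefficients of the power sums\<close>

text \<open>Each factor contributes its part to the exponent of at least one variable, so no
  monomial has degree below the sum of \<mu>. This justifies cutting expansions off at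
  \<open>mdeg \<alpha>\<close>.\<close>

lemma pbar_coeff_eq_0:
  assumes "monomial \<alpha>" "sum_list \<mu> > mdeg \<alpha>"
  shows "pbar_coeff \<mu> \<alpha> = 0"
proof -
  have "sum_list \<mu> \<le> mdeg \<alpha>"
    if Ss: "length Ss = length \<mu>" "\<forall>S\<in>set Ss. S \<noteq> {} \<and> finite S"
      "\<forall>i. \<alpha> i = (\<Sum>j<length \<mu>. if i \<in> Ss ! j then \<mu> ! j else 0)" for Ss
  proof -
    define A where "A = {i. \<alpha> i \<noteq> 0}"
    have fin: "finite A" using assms(1) by (simp add: monomial_def A_def)
    have "\<mu> ! j \<le> (\<Sum>i\<in>A. if i \<in> Ss ! j then \<mu> ! j else 0)" if j: "j < length \<mu>" for j
    proof (cases "\<mu> ! j = 0")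
      case False
      have "Ss ! j \<noteq> {}" using Ss(1,2) j by simp
      then obtain i where i: "i \<in> Ss ! j" by blast
      have "(if i \<in> Ss ! j then \<mu> ! j else 0) \<le> \<alpha> i"
        unfolding Ss(3)[rule_format] using j by (intro member_le_sum) auto
      hence "i \<in> A" using i False by (simp add: A_def)
      hence "(if i \<in> Ss ! j then \<mu> ! j else 0) \<le> (\<Sum>i\<in>A. if i \<in> Ss ! j then \<mu> ! j else 0)"
        using fin by (intro member_le_sum) auto
      thus ?thesis using i by simp
    qed simp
    hence "(\<Sum>j<length \<mu>. \<mu> ! j) \<le> (\<Sum>j<length \<mu>. \<Sum>i\<in>A. if i \<in> Ss ! j then \<mu> ! j else 0)"
      by (intro sum_mono) auto
    also have "\<dots> = (\<Sum>i\<in>A. \<alpha> i)" by (subst sum.swap) (simp add: Ss(3))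
    finally show ?thesis by (simp add: sum_list_sum_nth mdeg_def A_def atLeast0LessThan)
  qed
  hence "{Ss. length Ss = length \<mu> \<and> (\<forall>S\<in>set Ss. S \<noteq> {} \<and> finite S) \<and>
       (\<forall>i. \<alpha> i = (\<Sum>j<length \<mu>. if i \<in> Ss ! j then \<mu> ! j else 0))} = {}"
    using assms(2) by fastforce
  thus ?thesis by (simp only: pbar_coeff_def card.empty)
qed

lemma le_mdeg: "monomial \<alpha> \<Longrightarrow> \<alpha> i \<le> mdeg \<alpha>"
  unfolding monomial_def mdeg_def
  by (cases "\<alpha> i = 0") (auto intro!: member_le_sum)

text \<open>\<open>pbar_coeff\<close> indexes its sets by list positions; ordering the boxes in this
  way attaches one box to each position of the shape.\<close>

lemma obtain_shape_list:
  assumes "finite J"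
  obtains xs where "distinct xs" "set xs = J" "map fst xs = shape J"
proof -
  obtain ys where ys: "distinct ys" "set ys = J" using finite_distinct_list[OF assms] by blast
  have "sorted (map fst (sort_key fst ys))" by simp
  moreover have "mset (map fst (sort_key fst ys)) = image_mset fst (mset_set J)"
    using ys by (simp add: mset_set_set[symmetric])
  ultimately have "map fst (sort_key fst ys) = sorted_list_of_multiset (image_mset fst (mset_set J))"
    by (metis sorted_list_of_multiset_mset sorted_sort_id)
  hence "map fst (rev (sort_key fst ys)) = shape J" by (simp add: shape_def flip: rev_map)
  moreover have "distinct (rev (sort_key fst ys))" "set (rev (sort_key fst ys)) = J" using ys by simp_all
  ultimately show ?thesis using that by blast
qed

text \<open>Transposing: a family of box sets indexed by the variables is the same as a family of nonempty
  sets of variables indexed by the boxes that are used.\<close>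
lemma pbar_coeff_shape:
  assumes "monomial \<alpha>" "J \<subseteq> boxes e d"
  defines "A \<equiv> {i. \<alpha> i \<noteq> 0}"
  shows "pbar_coeff (shape J) \<alpha>
    = card {T \<in> (\<Pi>\<^sub>E i\<in>A. {T \<in> Pow (boxes e d). (\<Sum>x\<in>T. fst x) = \<alpha> i}). (\<Union>i\<in>A. T i) = J}"
proof -
  have finA: "finite A" using assms(1) by (simp add: monomial_def A_def)
  have finJ: "finite J" using assms(2) finite_boxes finite_subset by blast
  obtain xs where xs: "distinct xs" "set xs = J" "map fst xs = shape J"
    using obtain_shape_list[OF finJ] .
  have len: "length (shape J) = length xs" using xs(3) by (metis length_map)
  have nth: "shape J ! j = fst (xs ! j)" if "j < length xs" for j using xs(3) that by (metis nth_map)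
  define X where "X = {Ss :: nat set list. length Ss = length (shape J) \<and>
       (\<forall>S\<in>set Ss. S \<noteq> {} \<and> finite S) \<and>
       (\<forall>i. \<alpha> i = (\<Sum>j<length (shape J). if i \<in> Ss ! j then shape J ! j else 0))}"
  define Y where "Y = {T \<in> (\<Pi>\<^sub>E i\<in>A. {T \<in> Pow (boxes e d). (\<Sum>x\<in>T. fst x) = \<alpha> i}). (\<Union>i\<in>A. T i) = J}"
  define f where "f T = map (\<lambda>x. {i \<in> A. x \<in> T i}) xs" for T :: "nat \<Rightarrow> (nat \<times> nat) set"
  define g where "g Ss = (\<lambda>i\<in>A. (!) xs ` {j. j < length xs \<and> i \<in> Ss ! j})" for Ss :: "nat set list"
  have wt: "(\<Sum>x\<in>(!) xs ` M. fst x) = (\<Sum>j<length xs. if j \<in> M then shape J ! j else 0)"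
    if "M \<subseteq> {..<length xs}" for M
  proof -
    have "(\<Sum>x\<in>(!) xs ` M. fst x) = (\<Sum>j\<in>M. fst (xs ! j))"
      using that xs(1) by (intro sum.reindex[unfolded o_def] inj_on_nth) auto
    also have "\<dots> = (\<Sum>j\<in>M. shape J ! j)" using that nth by (intro sum.cong) auto
    also have "\<dots> = (\<Sum>j<length xs. if j \<in> M then shape J ! j else 0)"
      using that by (simp add: sum.If_cases Int_absorb1)
    finally show ?thesis .
  qed
  have img: "(!) xs ` {j. j < length xs \<and> xs ! j \<in> S} = S" if "S \<subseteq> J" for S
  proof -
    have "(!) xs ` {j. j < length xs \<and> xs ! j \<in> S} = set xs \<inter> S"
      unfolding image_def set_conv_nth by blast
    thus ?thesis using that xs(2) by blast
  qed
  \<comment> \<open>All parts of a shape are positive, so a set assigned to a part contains only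
    variables that occur in the monomial.\<close>
  have subA: "Ss ! j \<subseteq> A" if Ss: "Ss \<in> X" and j: "j < length xs" for Ss j
  proof
    fix i assume i: "i \<in> Ss ! j"
    have "(if i \<in> Ss ! j then shape J ! j else 0) \<le> (\<Sum>j<length xs. if i \<in> Ss ! j then shape J ! j else 0)"
      using j by (intro member_le_sum) auto
    also have "\<dots> = \<alpha> i" using Ss len by (simp add: X_def)
    finally have "shape J ! j \<le> \<alpha> i" using i by simp
    moreover have "shape J ! j > 0" using nth[OF j] boxes_pos[OF assms(2)] xs(2) j by (metis nth_mem)
    ultimately show "i \<in> A" by (simp add: A_def)
  qed
  have "bij_betw f Y X"
  proof (rule bij_betwI)
    show "f \<in> Y \<rightarrow> X"
    proof
      fix T assume T: "T \<in> Y"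
      have "\<alpha> i = (\<Sum>j<length xs. if i \<in> f T ! j then shape J ! j else 0)" for i
      proof (cases "i \<in> A")
        case True
        define M where "M = {j. j < length xs \<and> xs ! j \<in> T i}"
        have "T i \<subseteq> J" using T True by (auto simp: Y_def)
        hence "T i = (!) xs ` M" using img by (simp add: M_def)
        moreover have "(\<Sum>x\<in>T i. fst x) = \<alpha> i" using T True by (auto simp: Y_def PiE_iff)
        ultimately have "\<alpha> i = (\<Sum>j<length xs. if j \<in> M then shape J ! j else 0)"
          using wt[of M] by (auto simp: M_def)
        also have "\<dots> = (\<Sum>j<length xs. if i \<in> f T ! j then shape J ! j else 0)"
          using True by (intro sum.cong) (auto simp: M_def f_def)
        finally show ?thesis .
      next
        case False
        hence "(\<Sum>j<length xs. if i \<in> f T ! j then shape J ! j else 0) = 0"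
          by (intro sum.neutral) (auto simp: f_def)
        thus ?thesis using False by (simp add: A_def)
      qed
      moreover have "{i \<in> A. x \<in> T i} \<noteq> {}" if "x \<in> set xs" for x
        using that T xs(2) by (auto simp: Y_def)
      ultimately show "f T \<in> X" using finA by (auto simp: X_def len f_def)
    qed
    show "g \<in> X \<rightarrow> Y"
    proof
      fix Ss assume Ss: "Ss \<in> X"
      have sub: "g Ss i \<subseteq> J" if "i \<in> A" for i
        using that xs(2) by (auto simp: g_def)
      have "(\<Sum>x\<in>g Ss i. fst x) = \<alpha> i" if "i \<in> A" for i
      proof -
        have "(\<Sum>x\<in>g Ss i. fst x) = (\<Sum>j<length xs. if j \<in> {j. j < length xs \<and> i \<in> Ss ! j} then shape J ! j else 0)"
          using that wt[of "{j. j < length xs \<and> i \<in> Ss ! j}"] by (auto simp: g_def)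
        also have "\<dots> = (\<Sum>j<length xs. if i \<in> Ss ! j then shape J ! j else 0)"
          by (intro sum.cong) auto
        also have "\<dots> = \<alpha> i" using Ss len by (simp add: X_def)
        finally show ?thesis .
      qed
      moreover have "x \<in> (\<Union>i\<in>A. g Ss i)" if "x \<in> J" for x
      proof -
        obtain j where j: "j < length xs" "x = xs ! j" using \<open>x \<in> J\<close> xs(2) by (metis in_set_conv_nth)
        have "Ss ! j \<noteq> {}" using Ss j len by (auto simp: X_def)
        then obtain i where "i \<in> Ss ! j" by blast
        moreover from this have "i \<in> A" using subA[OF Ss j(1)] by blast
        ultimately show ?thesis using j by (auto simp: g_def)
      qed
      moreover have "g Ss \<in> extensional A" by (simp add: g_def)
      ultimately show "g Ss \<in> Y" using sub assms(2) unfolding Y_def PiE_iff by blast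
    qed
    show "g (f T) = T" if T: "T \<in> Y" for T
    proof
      fix i
      show "g (f T) i = T i"
      proof (cases "i \<in> A")
        case True
        have "T i \<subseteq> J" using T True by (auto simp: Y_def)
        hence "T i = (!) xs ` {j. j < length xs \<and> xs ! j \<in> T i}" using img by simp
        moreover have "{j. j < length xs \<and> i \<in> f T ! j} = {j. j < length xs \<and> xs ! j \<in> T i}"
          using True by (auto simp: f_def)
        ultimately show ?thesis using True by (simp add: g_def)
      next
        case False
        thus ?thesis using T by (simp add: g_def Y_def PiE_iff extensional_def)
      qed
    qed
    show "f (g Ss) = Ss" if Ss: "Ss \<in> X" for Ss
    proof (rule nth_equalityI)
      show "length (f (g Ss)) = length Ss" using Ss len by (simp add: f_def X_def)
      fix j assume "j < length (f (g Ss))"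
      hence j: "j < length xs" by (simp add: f_def)
      have "xs ! j \<in> g Ss i \<longleftrightarrow> i \<in> Ss ! j" if "i \<in> A" for i
        using that j xs(1) by (auto simp: g_def nth_eq_iff_index_eq)
      thus "f (g Ss) ! j = Ss ! j" using j subA[OF Ss j] by (auto simp: f_def)
    qed
  qed
  thus ?thesis unfolding pbar_coeff_def X_def[symmetric] Y_def[symmetric] by (rule bij_betw_same_card[symmetric])
qed

text \<open>The right side counts families that give each variable i of the monomial a box set of
  total \<alpha> i. Grouped by the union J of their box sets, they are counted by the
  \<open>pbar\<close> coefficient of the shape of J.\<close>

lemma sum_pbar_coeff_nat:
  fixes e :: "nat \<Rightarrow> nat"
  assumes "monomial \<alpha>"
  shows "(\<Sum>\<mu>\<in>parts_le (mdeg \<alpha>). pweight (\<lambda>k. of_nat (e k)) \<mu> * of_nat (pbar_coeff \<mu> \<alpha>))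
    = (\<Prod>i\<in>{i. \<alpha> i \<noteq> 0}. psum (\<lambda>k. of_nat (e k)) (\<alpha> i))"
proof -
  define A where "A = {i. \<alpha> i \<noteq> 0}"
  define d where "d = mdeg \<alpha>"
  have finA: "finite A" using assms by (simp add: monomial_def A_def)
  define F where "F = (\<Pi>\<^sub>E i\<in>A. {T \<in> Pow (boxes e d). (\<Sum>x\<in>T. fst x) = \<alpha> i})"
  have finF: "finite F" unfolding F_def using finA by (intro finite_PiE) auto
  have "(\<Sum>\<mu>\<in>parts_le d. pweight (\<lambda>k. of_nat (e k)) \<mu> * of_nat (pbar_coeff \<mu> \<alpha>))
    = (\<Sum>J\<in>Pow (boxes e d). of_nat (pbar_coeff (shape J) \<alpha>))"
    using pbar_coeff_eq_0[OF assms] by (intro sum_boxes_shape[symmetric]) (simp add: d_def)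
  also have "\<dots> = (\<Sum>J\<in>Pow (boxes e d). of_nat (card {T \<in> F. (\<Union>i\<in>A. T i) = J}))"
    using pbar_coeff_shape[OF assms] by (intro sum.cong) (auto simp: F_def A_def)
  also have "\<dots> = of_nat (\<Sum>J\<in>Pow (boxes e d). \<Sum>T\<in>{T \<in> F. (\<Union>i\<in>A. T i) = J}. 1 :: nat)" by simp
  also have "(\<Sum>J\<in>Pow (boxes e d). \<Sum>T\<in>{T \<in> F. (\<Union>i\<in>A. T i) = J}. 1) = (\<Sum>T\<in>F. 1 :: nat)"
    by (rule sum.group) (use finF in \<open>auto simp: F_def PiE_iff\<close>)
  also have "of_nat (\<Sum>T\<in>F. 1 :: nat) = (\<Prod>i\<in>A. rat_of_nat (card {T \<in> Pow (boxes e d). (\<Sum>x\<in>T. fst x) = \<alpha> i}))"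
    using finA by (simp add: F_def card_PiE)
  also have "\<dots> = (\<Prod>i\<in>A. psum (\<lambda>k. of_nat (e k)) (\<alpha> i))"
    by (intro prod.cong[OF refl] psum_boxes[symmetric]) (simp add: d_def le_mdeg assms)
  finally show ?thesis by (simp add: A_def d_def)
qed

lemma sum_pbar_coeff:
  assumes "monomial \<alpha>"
  shows "(\<Sum>\<mu>\<in>parts_le (mdeg \<alpha>). pweight e \<mu> * of_nat (pbar_coeff \<mu> \<alpha>)) = (\<Prod>i\<in>{i. \<alpha> i \<noteq> 0}. psum e (\<alpha> i))"
proof -
  \<comment> \<open>The same truncation as for the recurrence: all partitions involved have parts at
    most \<open>mdeg \<alpha>\<close>.\<close>
  define e' where "e' k = (if k \<in> {1..mdeg \<alpha>} then e k else 0)" for k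
  have "(\<Sum>\<mu>\<in>parts_le (mdeg \<alpha>). pweight e' \<mu> * of_nat (pbar_coeff \<mu> \<alpha>)) = (\<Prod>i\<in>{i. \<alpha> i \<noteq> 0}. psum e' (\<alpha> i))"
  proof (rule polyfun_eqI[where K = "{1..mdeg \<alpha>}"
      and f = "\<lambda>e. \<Sum>\<mu>\<in>parts_le (mdeg \<alpha>). pweight e \<mu> * of_nat (pbar_coeff \<mu> \<alpha>)"
      and g = "\<lambda>e. \<Prod>i\<in>{i. \<alpha> i \<noteq> 0}. psum e (\<alpha> i)"])
    show "polyfun (\<lambda>e. \<Sum>\<mu>\<in>parts_le (mdeg \<alpha>). pweight e \<mu> * of_nat (pbar_coeff \<mu> \<alpha>))"
      by (intro polyfun.intros polyfun_pweight polyfun_sum)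
    show "polyfun (\<lambda>e. \<Prod>i\<in>{i. \<alpha> i \<noteq> 0}. psum e (\<alpha> i))"
      by (intro polyfun_psum polyfun_prod)
    show "\<forall>k. k \<notin> {1..mdeg \<alpha>} \<longrightarrow> e' k \<in> \<nat>" by (auto simp: e'_def)
  qed (simp_all add: sum_pbar_coeff_nat[OF assms])
  moreover have "psum e' (\<alpha> i) = psum e (\<alpha> i)" for i
    using le_mdeg[OF assms, of i] by (intro psum_cong) (simp add: e'_def)
  moreover have "pweight e' \<mu> = pweight e \<mu>" if "\<mu> \<in> parts_le (mdeg \<alpha>)" for \<mu>
    using that parts_set[of \<mu> "mdeg \<alpha>"] by (intro pweight_cong) (auto simp: e'_def parts_le_def)
  ultimately show ?thesis by simp
qed

section \<open>The exponents of the independence polynomial\<close>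

text \<open>\<open>2 ^ (j + 1) dvd k\<close> says at once that k / 2^j is an integer and that it is
  even, as in condition (ii). At k = 0 the index set is infinite and the sum is 0.\<close>

definition even_total :: "(nat \<Rightarrow> nat) \<Rightarrow> nat \<Rightarrow> nat" where
  "even_total L k = (\<Sum>j | 2 ^ (j + 1) dvd k. L (k div 2 ^ j))"

text \<open>The exponent of 1 + t^k in I(t). For odd k, 1 - (-t)^k is 1 + t^k. For even l, 1 - t^l
  is the inverse of the product of the 1 + t^(l 2^j), so every L l with k = l 2^j enters negatively
  at k.\<close>

definition exponent :: "(nat \<Rightarrow> nat) \<Rightarrow> nat \<Rightarrow> rat" where
  "exponent L k = (if odd k then of_nat (L k) else - of_nat (even_total L k))"

lemma finite_two_power_dvd: "m > 0 \<Longrightarrow> finite {j. 2 ^ j dvd (m :: nat)}"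
proof -
  assume m: "m > 0"
  have "j \<le> m" if "2 ^ j dvd m" for j
    using less_exp[of j] dvd_imp_le[OF that m] by linarith
  hence "{j. 2 ^ j dvd m} \<subseteq> {..m}" by auto
  thus ?thesis using finite_subset by blast
qed

text \<open>The N-th coefficient of the logarithmic derivative of 1 / (1 - t) = (1 + t) (1 + t^2) (1 + t^4) ...\<close>
lemma sum_two_power_dvd:
  assumes "N > 0"
  shows "(\<Sum>j | 2 ^ j dvd N. 2 ^ j * (-1) ^ (N div 2 ^ j - 1)) = (1 :: rat)"
  using assms
proof (induction N rule: less_induct)
  case (less N)
  show ?case
  proof (cases "odd N")
    case True
    have "{j. 2 ^ j dvd N} = {0}"
    proof -
      have "j = 0" if "2 ^ j dvd N" for j
        using that True by (cases j) (auto dest: dvd_mult_left)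
      thus ?thesis by auto
    qed
    thus ?thesis using True by simp
  next
    case False
    then obtain N' where N: "N = 2 * N'" by (auto elim: evenE)
    have N': "N' > 0" "N' < N" using N less.prems by auto
    have set: "{j. 2 ^ j dvd N} = insert 0 (Suc ` {j. 2 ^ j dvd N'})"
    proof -
      have "2 ^ j dvd N \<longleftrightarrow> j = 0 \<or> (\<exists>i. j = Suc i \<and> 2 ^ i dvd N')" for j
        by (cases j) (auto simp: N)
      thus ?thesis by auto
    qed
    have "(\<Sum>j | 2 ^ j dvd N. 2 ^ j * (-1) ^ (N div 2 ^ j - 1))
      = (-1) ^ (N - 1) + (\<Sum>j\<in>Suc ` {j. 2 ^ j dvd N'}. 2 ^ j * (-1) ^ (N div 2 ^ j - 1) :: rat)"
      unfolding set using finite_two_power_dvd[OF N'(1)] by (subst sum.insert) auto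
    \<comment> \<open>The term for j = 0 is -1 and the others add up to twice the sum for N / 2, in
      total 2 - 1 = 1.\<close>
    also have "(-1) ^ (N - 1) = (-1 :: rat)" using False less.prems by (simp add: uminus_power_if)
    also have "(\<Sum>j\<in>Suc ` {j. 2 ^ j dvd N'}. 2 ^ j * (-1) ^ (N div 2 ^ j - 1) :: rat)
      = 2 * (\<Sum>j | 2 ^ j dvd N'. 2 ^ j * (-1) ^ (N' div 2 ^ j - 1))"
      by (subst sum.reindex) (auto simp: N sum_distrib_left mult_ac)
    finally show ?thesis using less.IH[OF N'(2,1)] by simp
  qed
qed

text \<open>Writing k = l 2^j with l the size of the heaps turns the double sum into one over l,
  whose inner sum over j is 1 by \<open>sum_two_power_dvd\<close>.\<close>

lemma sum_even_total:
  assumes "m > 0"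
  shows "(\<Sum>k | k dvd m \<and> even k. of_nat k * of_nat (even_total L k) * (-1) ^ (m div k - 1))
    = (\<Sum>k | k dvd m \<and> even k. of_nat k * of_nat (L k) :: rat)"
proof -
  define K where "K = {k. k dvd m \<and> even k}"
  have finK: "finite K" using assms by (simp add: K_def)
  have fin1: "finite {j. 2 ^ (j + 1) dvd k}" if "k \<in> K" for k
    using that assms finite_two_power_dvd[of k]
    by (intro finite_subset[OF _ finite_two_power_dvd[of k]])
      (auto simp: K_def dest: dvd_mult_right intro!: Nat.gr0I)
  have fin2: "finite {j. 2 ^ j dvd m div l}" if "l \<in> K" for l
    using that assms by (intro finite_two_power_dvd) (auto simp: K_def div_greater_zero_iff dvd_imp_le intro!: Nat.gr0I)
  have "(\<Sum>k\<in>K. of_nat k * of_nat (even_total L k) * (-1) ^ (m div k - 1))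
    = (\<Sum>k\<in>K. \<Sum>j | 2 ^ (j + 1) dvd k. of_nat k * of_nat (L (k div 2 ^ j)) * (-1) ^ (m div k - 1) :: rat)"
    by (simp add: even_total_def sum_distrib_left sum_distrib_right)
  also have "\<dots> = (\<Sum>(k, j)\<in>(SIGMA k:K. {j. 2 ^ (j + 1) dvd k}). of_nat k * of_nat (L (k div 2 ^ j)) * (-1) ^ (m div k - 1))"
    using finK fin1 by (subst sum.Sigma) auto
  also have "\<dots> = (\<Sum>(l, j)\<in>(SIGMA l:K. {j. 2 ^ j dvd m div l}).
      of_nat (l * 2 ^ j) * of_nat (L l) * (-1) ^ (m div (l * 2 ^ j) - 1))"
  proof (rule sum.reindex_bij_witness[where i = "\<lambda>(l, j). (l * 2 ^ j, j)" and j = "\<lambda>(k, j). (k div 2 ^ j, j)"])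
    fix a assume a: "a \<in> (SIGMA k:K. {j. 2 ^ (j + 1) dvd k})"
    obtain k j where kj: "a = (k, j)" "k \<in> K" "2 ^ (j + 1) dvd k" using a by auto
    obtain q where q: "k = 2 ^ (j + 1) * q" using kj(3) by blast
    have l: "k div 2 ^ j = 2 * q" using q by simp
    have "k dvd m" using kj(2) by (simp add: K_def)
    then obtain r where r: "m = k * r" by blast
    have pos: "q > 0" "r > 0" using assms q r by auto
    have "m div (2 * q) = 2 ^ j * r" using r q pos by simp
    moreover have "2 * q dvd m" using r q by simp
    ultimately show "(case a of (k, j) \<Rightarrow> (k div 2 ^ j, j)) \<in> (SIGMA l:K. {j. 2 ^ j dvd m div l})"
      using kj(1) l by (simp add: K_def)
    show "(case (case a of (k, j) \<Rightarrow> (k div 2 ^ j, j)) of (l, j) \<Rightarrow> (l * 2 ^ j, j)) = a"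
      using kj(1) l q by simp
    show "(case (case a of (k, j) \<Rightarrow> (k div 2 ^ j, j)) of (l, j) \<Rightarrow>
        of_nat (l * 2 ^ j) * of_nat (L l) * (-1) ^ (m div (l * 2 ^ j) - 1))
      = (case a of (k, j) \<Rightarrow> of_nat k * of_nat (L (k div 2 ^ j)) * (-1 :: rat) ^ (m div k - 1))"
      using kj(1) l q by (simp add: mult_ac)
  next
    fix b assume b: "b \<in> (SIGMA l:K. {j. 2 ^ j dvd m div l})"
    obtain l j where lj: "b = (l, j)" "l \<in> K" "2 ^ j dvd m div l" using b by auto
    show "(case (case b of (l, j) \<Rightarrow> (l * 2 ^ j, j)) of (k, j) \<Rightarrow> (k div 2 ^ j, j)) = b"
      using lj(1) by simp
    have "l dvd m" "even l" using lj(2) by (auto simp: K_def)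
    hence "l * 2 ^ j dvd m" using lj(3) assms by (metis dvd_mult_div_cancel mult_dvd_mono dvd_refl)
    moreover have "2 ^ (j + 1) dvd l * 2 ^ j" using \<open>even l\<close> by (simp add: mult.commute)
    ultimately show "(case b of (l, j) \<Rightarrow> (l * 2 ^ j, j)) \<in> (SIGMA k:K. {j. 2 ^ (j + 1) dvd k})"
      using lj(1) \<open>even l\<close> by (simp add: K_def)
  qed
  also have "\<dots> = (\<Sum>l\<in>K. \<Sum>j | 2 ^ j dvd m div l. of_nat (l * 2 ^ j) * of_nat (L l) * (-1) ^ (m div (l * 2 ^ j) - 1))"
    using finK fin2 by (subst sum.Sigma) auto
  also have "\<dots> = (\<Sum>l\<in>K. of_nat l * of_nat (L l))"
  proof (rule sum.cong[OF refl])
    fix l assume l: "l \<in> K"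
    hence pos: "m div l > 0" using assms by (auto simp: K_def div_greater_zero_iff dvd_imp_le intro!: Nat.gr0I)
    have "(\<Sum>j | 2 ^ j dvd m div l. of_nat (l * 2 ^ j) * of_nat (L l) * (-1) ^ (m div (l * 2 ^ j) - 1))
      = of_nat l * of_nat (L l) * (\<Sum>j | 2 ^ j dvd m div l. 2 ^ j * (-1) ^ (m div l div 2 ^ j - 1) :: rat)"
      by (simp add: sum_distrib_left mult_ac div_mult2_eq)
    thus "(\<Sum>j | 2 ^ j dvd m div l. of_nat (l * 2 ^ j) * of_nat (L l) * (-1) ^ (m div (l * 2 ^ j) - 1))
      = (of_nat l * of_nat (L l) :: rat)" using sum_two_power_dvd[OF pos] by simp
  qed
  finally show ?thesis by (simp add: K_def)
qed

text \<open>Compares logarithmic derivatives: the left side belongs to the product of (1 +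
  t^k)^(exponent L k), the right side to that of (1 - (-t)^k)^(L k). For even m an odd divisor has
  an even cofactor, which gives a minus sign, and the even divisors are collected by
  \<open>sum_even_total\<close>.\<close>

lemma sum_exponent:
  assumes "m > 0"
  shows "(\<Sum>k | k dvd m. of_nat k * exponent L k * (-1) ^ (m div k - 1))
    = (-1) ^ (m - 1) * (\<Sum>k | k dvd m. of_nat k * of_nat (L k))"
proof (cases "odd m")
  case True
  have "odd k \<and> odd (m div k)" if "k dvd m" for k
    using that True by (metis dvd_mult_div_cancel even_mult_iff)
  hence "(\<Sum>k | k dvd m. of_nat k * exponent L k * (-1) ^ (m div k - 1)) = (\<Sum>k | k dvd m. of_nat k * of_nat (L k))"
    by (intro sum.cong) (auto simp: exponent_def)
  thus ?thesis using True by simp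
next
  case False
  have fin: "finite {k. k dvd m}" using assms by simp
  have split: "(\<Sum>k | k dvd m. f k) = (\<Sum>k | k dvd m \<and> odd k. f k) + (\<Sum>k | k dvd m \<and> even k. f k)"
    for f :: "nat \<Rightarrow> rat"
  proof -
    have "{k. k dvd m} \<inter> {k. odd k} = {k. k dvd m \<and> odd k}"
      "{k. k dvd m} - {k. odd k} = {k. k dvd m \<and> even k}" by auto
    thus ?thesis using sum.Int_Diff[OF fin, of f "{k. odd k}"] by simp
  qed
  have "(\<Sum>k | k dvd m \<and> odd k. of_nat k * exponent L k * (-1) ^ (m div k - 1)) = (\<Sum>k | k dvd m \<and> odd k. - (of_nat k * of_nat (L k)))"
  proof (rule sum.cong[OF refl])
    fix k assume "k \<in> {k. k dvd m \<and> odd k}"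
    hence k: "k dvd m" "odd k" by auto
    hence "even (m div k)" using False by (metis dvd_mult_div_cancel even_mult_iff)
    moreover have "m div k > 0" using k assms by (auto simp: div_greater_zero_iff dvd_imp_le intro!: Nat.gr0I)
    ultimately have "odd (m div k - 1)" by simp
    thus "of_nat k * exponent L k * (-1) ^ (m div k - 1) = - (of_nat k * of_nat (L k))"
      using k(2) by (simp add: exponent_def)
  qed
  moreover have "(\<Sum>k | k dvd m \<and> even k. of_nat k * exponent L k * (-1) ^ (m div k - 1))
    = - (\<Sum>k | k dvd m \<and> even k. of_nat k * of_nat (L k))"
    unfolding sum_even_total[OF assms, symmetric] sum_negf[symmetric]
    by (rule sum.cong) (auto simp: exponent_def)
  moreover have "(-1 :: rat) ^ (m - 1) = -1" using False assms by (simp add: uminus_power_if)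
  ultimately show ?thesis
    unfolding split[of "\<lambda>k. of_nat k * exponent L k * (-1) ^ (m div k - 1)"]
      split[of "\<lambda>k. of_nat k * of_nat (L k)"]
    by (simp add: sum_negf)
qed

lemma ind_count_0 [simp]: "finite V \<Longrightarrow> ind_count E V 0 = 1"
proof -
  assume "finite V"
  hence "{S \<in> ind_sets E V. card S = 0} = {{}}"
    using finite_ind_set[of V] by (auto simp: ind_sets_def)
  thus ?thesis by (simp add: ind_count_def)
qed

lemma psum_0 [simp]: "psum e 0 = 1"
proof -
  have "parts_eq 0 = {[]}"
    by (auto simp: parts_eq_def is_partition_def) (metis all_not_in_conv set_empty)
  thus ?thesis by (simp add: psum_def pweight_def)
qed

text \<open>Both sequences start with 1 and satisfy the same recurrence, which determines n times
  the n-th term from the earlier ones.\<close>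

lemma (in ordered_dependence) ind_count_eq_psum:
  assumes "finite V" "\<And>u. \<not> E u u"
  shows "of_nat (ind_count E V n) = psum (exponent (\<lambda>k. card (lyndons V k))) n"
proof (induction n rule: less_induct)
  case (less n)
  define L where "L = (\<lambda>k. card (lyndons V k))"
  show ?case
  proof (cases "n = 0")
    case False
    have "of_nat n * of_nat (ind_count E V n) = (\<Sum>m=1..n. (-1) ^ (m - 1) *
        (\<Sum>k | k dvd m. of_nat k * of_nat (L k)) * (of_nat (ind_count E V (n - m)) :: rat))"
      unfolding L_def by (rule ind_count_recurrence[OF assms])
    also have "\<dots> = (\<Sum>m=1..n. (\<Sum>k | k dvd m. of_nat k * exponent L k * (-1) ^ (m div k - 1)) * psum (exponent L) (n - m))"
    proof (rule sum.cong[OF refl])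
      fix m assume m: "m \<in> {1..n}"
      hence "of_nat (ind_count E V (n - m)) = psum (exponent L) (n - m)"
        using less[of "n - m"] False by (simp add: L_def)
      thus "(-1) ^ (m - 1) * (\<Sum>k | k dvd m. of_nat k * of_nat (L k)) * of_nat (ind_count E V (n - m))
        = (\<Sum>k | k dvd m. of_nat k * exponent L k * (-1) ^ (m div k - 1)) * psum (exponent L) (n - m)"
        using sum_exponent[of m L] m by simp
    qed
    also have "\<dots> = of_nat n * psum (exponent L) n" by (rule psum_recurrence[symmetric])
    finally show ?thesis using False by (simp add: L_def)
  qed (simp add: assms)
qed

section \<open>Inclusion-exclusion over vertex subsets\<close>

text \<open>Serves twice: for colorings, with u the set of coloured vertices, and for families of
  Lyndon heaps, with u the set of used vertices.\<close>

lemma inclusion_exclusion_image: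
  assumes "finite V" "finite F"
  shows "(\<Sum>W\<in>Pow V. (-1) ^ card (V - W) * of_nat (card {m \<in> F. u m \<subseteq> W}))
    = (of_nat (card {m \<in> F. u m = V}) :: 'b :: comm_ring_1)"
proof -
  have "of_nat (card {m \<in> F. u m \<subseteq> S}) = (\<Sum>W\<in>Pow S. of_nat (card {m \<in> F. u m = W}) :: 'b)"
    if "finite S" for S
  proof -
    have "card {m \<in> F. u m \<subseteq> S} = (\<Sum>m\<in>{m \<in> F. u m \<subseteq> S}. 1)" by simp
    also have "\<dots> = (\<Sum>W\<in>Pow S. \<Sum>m\<in>{m \<in> {m \<in> F. u m \<subseteq> S}. u m = W}. 1)"
      by (rule sum.group[symmetric]) (use assms that in auto)
    also have "\<dots> = (\<Sum>W\<in>Pow S. card {m \<in> F. u m = W})"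
    proof (rule sum.cong[OF refl])
      fix W assume "W \<in> Pow S"
      hence "{m \<in> {m \<in> F. u m \<subseteq> S}. u m = W} = {m \<in> F. u m = W}" by auto
      thus "(\<Sum>m\<in>{m \<in> {m \<in> F. u m \<subseteq> S}. u m = W}. 1) = card {m \<in> F. u m = W}" by simp
    qed
    finally show ?thesis by simp
  qed
  from inclusion_exclusion_mobius[OF this assms(1)]
  have "of_nat (card {m \<in> F. u m = V})
    = (\<Sum>W\<in>Pow V. (-1) ^ (card V - card W) * (of_nat (card {m \<in> F. u m \<subseteq> W}) :: 'b))" .
  also have "\<dots> = (\<Sum>W\<in>Pow V. (-1) ^ card (V - W) * of_nat (card {m \<in> F. u m \<subseteq> W}))"
    using assms(1) by (intro sum.cong) (auto simp: card_Diff_subset finite_subset)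
  finally show ?thesis by simp
qed

text \<open>A coloring is transposed into its colour classes: independent sets, one for each
  variable of the monomial, whose union is V because no vertex has an empty set. Families with union
  inside W consist of independent sets of W, so their number is a product over the
  variables.\<close>

lemma kromatic_coeff_eq:
  assumes "finite V" "monomial \<alpha>"
  shows "of_nat (kromatic_coeff V E \<alpha>)
    = (\<Sum>W\<in>Pow V. (-1) ^ card (V - W) * (\<Prod>i\<in>{i. \<alpha> i \<noteq> 0}. of_nat (ind_count E W (\<alpha> i)) :: 'b :: comm_ring_1))"
proof -
  define A where "A = {i. \<alpha> i \<noteq> 0}"
  have finA: "finite A" using assms(2) by (simp add: monomial_def A_def)
  define F where "F = (\<Pi>\<^sub>E i\<in>A. {S \<in> ind_sets E V. card S = \<alpha> i})"
  define u where "u S = (\<Union>i\<in>A. S i)" for S :: "nat \<Rightarrow> 'a set"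
  have finF: "finite F"
    unfolding F_def using finA finite_ind_sets[OF assms(1), of E] by (intro finite_PiE) auto
  define C where "C = {\<kappa>. proper_set_coloring V E \<kappa> \<and> (\<forall>i. card {v\<in>V. i \<in> \<kappa> v} = \<alpha> i)}"
  define f where "f \<kappa> = (\<lambda>i\<in>A. {v \<in> V. i \<in> \<kappa> v})" for \<kappa> :: "'a \<Rightarrow> nat set"
  define g where "g S = (\<lambda>v. {i \<in> A. v \<in> S i})" for S :: "nat \<Rightarrow> 'a set"
  have sub: "S i \<subseteq> V" if "S \<in> F" "i \<in> A" for S i
    using that by (auto simp: F_def PiE_iff ind_sets_def)
  have \<kappa>A: "\<kappa> v \<subseteq> A" if "\<kappa> \<in> C" for \<kappa> v
  proof
    fix i assume i: "i \<in> \<kappa> v"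
    hence "v \<in> V" using that by (auto simp: C_def proper_set_coloring_def)
    hence "card {v\<in>V. i \<in> \<kappa> v} \<noteq> 0" using i assms(1) by auto
    thus "i \<in> A" using that by (auto simp: C_def A_def)
  qed
  have "bij_betw f C {S \<in> F. u S = V}"
  proof (rule bij_betwI)
    show "f \<in> C \<rightarrow> {S \<in> F. u S = V}"
    proof
      fix \<kappa> assume \<kappa>: "\<kappa> \<in> C"
      have "{v \<in> V. i \<in> \<kappa> v} \<in> ind_sets E V" for i
        using \<kappa> unfolding C_def proper_set_coloring_def ind_sets_def by blast
      moreover have "card {v \<in> V. i \<in> \<kappa> v} = \<alpha> i" for i using \<kappa> by (simp add: C_def)
      ultimately have "f \<kappa> \<in> F" by (simp add: F_def f_def PiE_iff)
      moreover have "v \<in> u (f \<kappa>)" if "v \<in> V" for v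
      proof -
        have "\<kappa> v \<noteq> {}" using \<kappa> \<open>v \<in> V\<close> by (simp add: C_def proper_set_coloring_def)
        then obtain i where "i \<in> \<kappa> v" by blast
        thus ?thesis using \<kappa>A[OF \<kappa>] \<open>v \<in> V\<close> by (auto simp: u_def f_def)
      qed
      hence "u (f \<kappa>) = V" by (auto simp: u_def f_def)
      ultimately show "f \<kappa> \<in> {S \<in> F. u S = V}" by simp
    qed
    show "g \<in> {S \<in> F. u S = V} \<rightarrow> C"
    proof
      fix S assume S: "S \<in> {S \<in> F. u S = V}"
      have "proper_set_coloring V E (g S)"
        unfolding proper_set_coloring_def
      proof (intro conjI ballI allI impI)
        fix v assume "v \<in> V"
        hence "v \<in> u S" using S by simp
        thus "g S v \<noteq> {}" by (auto simp: u_def g_def)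
      next
        fix v assume "v \<notin> V"
        thus "g S v = {}" using S sub by (auto simp: g_def)
      next
        fix v w assume "E v w"
        thus "g S v \<inter> g S w = {}" using S by (auto simp: g_def F_def PiE_iff ind_sets_def)
      qed
      moreover have "card {v\<in>V. i \<in> g S v} = \<alpha> i" for i
      proof (cases "i \<in> A")
        case True
        hence "{v\<in>V. i \<in> g S v} = S i" using S sub by (auto simp: g_def)
        thus ?thesis using S True by (auto simp: F_def PiE_iff)
      qed (auto simp: g_def A_def)
      ultimately show "g S \<in> C" by (simp add: C_def)
    qed
    show "g (f \<kappa>) = \<kappa>" if "\<kappa> \<in> C" for \<kappa>
    proof
      fix v
      show "g (f \<kappa>) v = \<kappa> v"
        using \<kappa>A[OF that, of v] that
        by (cases "v \<in> V") (auto simp: g_def f_def C_def proper_set_coloring_def)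
    qed
    show "f (g S) = S" if "S \<in> {S \<in> F. u S = V}" for S
    proof
      fix i
      show "f (g S) i = S i"
        using that sub[of S i] by (cases "i \<in> A") (auto simp: g_def f_def F_def PiE_iff extensional_def)
    qed
  qed
  hence "kromatic_coeff V E \<alpha> = card {S \<in> F. u S = V}"
    unfolding kromatic_coeff_def C_def[symmetric] by (rule bij_betw_same_card)
  hence "of_nat (kromatic_coeff V E \<alpha>) = (\<Sum>W\<in>Pow V. (-1) ^ card (V - W) * of_nat (card {S \<in> F. u S \<subseteq> W}) :: 'b)"
    by (simp only: inclusion_exclusion_image[OF assms(1) finF])
  also have "\<dots> = (\<Sum>W\<in>Pow V. (-1) ^ card (V - W) * (\<Prod>i\<in>A. of_nat (ind_count E W (\<alpha> i))))"
  proof (rule sum.cong[OF refl])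
    fix W assume "W \<in> Pow V"
    hence ind: "T \<in> ind_sets E W \<longleftrightarrow> T \<in> ind_sets E V \<and> T \<subseteq> W" for T
      by (auto simp: ind_sets_def)
    have "S \<in> {S \<in> F. u S \<subseteq> W} \<longleftrightarrow> S \<in> (\<Pi>\<^sub>E i\<in>A. {S \<in> ind_sets E W. card S = \<alpha> i})" for S
    proof -
      have "u S \<subseteq> W \<longleftrightarrow> (\<forall>i\<in>A. S i \<subseteq> W)" by (auto simp: u_def)
      thus ?thesis by (simp add: F_def PiE_iff ind) blast
    qed
    hence "{S \<in> F. u S \<subseteq> W} = (\<Pi>\<^sub>E i\<in>A. {S \<in> ind_sets E W. card S = \<alpha> i})" by (rule set_eqI)
    hence "card {S \<in> F. u S \<subseteq> W} = (\<Prod>i\<in>A. ind_count E W (\<alpha> i))"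
      using finA by (simp add: card_PiE ind_count_def)
    thus "(-1) ^ card (V - W) * of_nat (card {S \<in> F. u S \<subseteq> W})
      = (-1) ^ card (V - W) * (\<Prod>i\<in>A. of_nat (ind_count E W (\<alpha> i)) :: 'b)" by simp
  qed
  finally show ?thesis by (simp add: A_def)
qed

section \<open>Uniqueness of the expansion\<close>

text \<open>The test monomial of \<mu>: comparing expansions there isolates the coefficient at \<mu>
  up to partitions treated earlier in the induction.\<close>

definition part_monomial :: "nat list \<Rightarrow> nat \<Rightarrow> nat" where
  "part_monomial \<mu> i = (if i < length \<mu> then \<mu> ! i else 0)"

lemma part_monomial_supp:
  assumes "is_partition \<mu>"
  shows "{i. part_monomial \<mu> i \<noteq> 0} = {..<length \<mu>}"
proof -
  have "\<mu> ! i \<noteq> 0" if "i < length \<mu>" for i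
    using assms that by (metis is_partition_def nth_mem)
  thus ?thesis by (auto simp: part_monomial_def)
qed

lemma monomial_part_monomial: "is_partition \<mu> \<Longrightarrow> monomial (part_monomial \<mu>)"
  by (simp only: monomial_def part_monomial_supp finite_lessThan)

lemma mdeg_part_monomial:
  assumes "is_partition \<mu>"
  shows "mdeg (part_monomial \<mu>) = sum_list \<mu>"
  unfolding mdeg_def part_monomial_supp[OF assms]
  by (simp add: part_monomial_def sum_list_sum_nth atLeast0LessThan)

lemma partition_eqI:
  assumes "is_partition \<mu>" "is_partition \<nu>" "mset \<mu> = mset \<nu>"
  shows "\<mu> = \<nu>"
  using partition_eq_iff[OF assms(1), of "mset \<mu>"] partition_eq_iff[OF assms(2), of "mset \<mu>"] assms(3) by simp

lemma pbar_supp: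
  assumes "is_partition \<nu>" "length Ss = length \<nu>"
    and "\<And>i. \<alpha> i = (\<Sum>j<length \<nu>. if i \<in> Ss ! j then \<nu> ! j else 0)" "j < length \<nu>"
  shows "Ss ! j \<subseteq> {i. \<alpha> i \<noteq> (0 :: nat)}"
proof
  fix i assume i: "i \<in> Ss ! j"
  have "(if i \<in> Ss ! j then \<nu> ! j else 0) \<le> \<alpha> i"
    unfolding assms(3) using assms(4) by (intro member_le_sum) auto
  moreover have "\<nu> ! j \<noteq> 0" using assms(1,4) by (metis is_partition_def nth_mem)
  ultimately show "i \<in> {i. \<alpha> i \<noteq> 0}" using i by auto
qed

text \<open>Giving the j-th part the single variable j is one solution. Finiteness of the set of
  solutions is established too, since \<open>card\<close> of an infinite set would be 0.\<close>

lemma pbar_coeff_self: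
  assumes "is_partition \<mu>"
  shows "pbar_coeff \<mu> (part_monomial \<mu>) > 0"
proof -
  define A where "A = {i. part_monomial \<mu> i \<noteq> 0}"
  define X where "X = {Ss :: nat set list. length Ss = length \<mu> \<and> (\<forall>S\<in>set Ss. S \<noteq> {} \<and> finite S) \<and>
       (\<forall>i. part_monomial \<mu> i = (\<Sum>j<length \<mu>. if i \<in> Ss ! j then \<mu> ! j else 0))}"
  have finA: "finite A" unfolding A_def part_monomial_supp[OF assms] by simp
  have "set Ss \<subseteq> Pow A" if "Ss \<in> X" for Ss
    using that pbar_supp[OF assms, of Ss "part_monomial \<mu>"] unfolding X_def A_def
    by (fastforce simp: in_set_conv_nth)
  hence "X \<subseteq> {Ss. set Ss \<subseteq> Pow A \<and> length Ss = length \<mu>}" by (auto simp: X_def)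
  hence "finite X" using finite_lists_length_eq[of "Pow A" "length \<mu>"] finA finite_subset by blast
  moreover have "map (\<lambda>j. {j}) [0..<length \<mu>] \<in> X"
  proof -
    have "(\<Sum>j<length \<mu>. if i \<in> map (\<lambda>j. {j}) [0..<length \<mu>] ! j then \<mu> ! j else 0)
      = (\<Sum>j<length \<mu>. if i = j then \<mu> ! j else 0)" for i by (intro sum.cong) auto
    thus ?thesis by (auto simp: X_def part_monomial_def)
  qed
  ultimately have "card X > 0" by (auto simp: card_gt_0_iff)
  thus ?thesis by (simp add: pbar_coeff_def X_def)
qed

lemma mset_conv_nth: "mset xs = image_mset ((!) xs) (mset_set {..<length xs})"
  by (metis atLeast0LessThan map_nth mset_map mset_upt)

text \<open>Equality of degrees leaves no room for a part of \<nu> to use two variables, so each set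
  is a singleton and \<mu> arises from \<nu> by adding parts together. If the numbers of parts
  agree, nothing is added and the partitions coincide.\<close>

lemma pbar_coeff_triangular:
  assumes "is_partition \<mu>" "is_partition \<nu>" "sum_list \<nu> = sum_list \<mu>"
    and "pbar_coeff \<nu> (part_monomial \<mu>) \<noteq> 0"
  shows "\<nu> = \<mu> \<or> length \<nu> > length \<mu>"
proof -
  have "{Ss :: nat set list. length Ss = length \<nu> \<and> (\<forall>S\<in>set Ss. S \<noteq> {} \<and> finite S) \<and>
       (\<forall>i. part_monomial \<mu> i = (\<Sum>j<length \<nu>. if i \<in> Ss ! j then \<nu> ! j else 0))} \<noteq> {}"
    using assms(4) unfolding pbar_coeff_def by (metis card.empty)
  then obtain Ss :: "nat set list" where Ss: "length Ss = length \<nu>" "\<forall>S\<in>set Ss. S \<noteq> {} \<and> finite S"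
    and eq: "\<And>i. part_monomial \<mu> i = (\<Sum>j<length \<nu>. if i \<in> Ss ! j then \<nu> ! j else 0)"
    by blast
  have sub: "Ss ! j \<subseteq> {..<length \<mu>}" if "j < length \<nu>" for j
    using pbar_supp[OF assms(2) Ss(1) eq that] part_monomial_supp[OF assms(1)] by simp
  have ne: "Ss ! j \<noteq> {}" "finite (Ss ! j)" if "j < length \<nu>" for j using Ss that by auto
  have pos: "\<nu> ! j > 0" if "j < length \<nu>" for j
    using assms(2) that by (metis is_partition_def nth_mem gr0I)
  have "(\<Sum>j<length \<nu>. \<nu> ! j) = (\<Sum>i<length \<mu>. part_monomial \<mu> i)"
    using assms(3) by (simp add: part_monomial_def sum_list_sum_nth atLeast0LessThan)
  also have "\<dots> = (\<Sum>j<length \<nu>. \<Sum>i<length \<mu>. if i \<in> Ss ! j then \<nu> ! j else 0)"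
    unfolding eq by (rule sum.swap)
  also have "\<dots> = (\<Sum>j<length \<nu>. card (Ss ! j) * \<nu> ! j)"
    using sub by (intro sum.cong) (auto simp: sum.If_cases Int_absorb1)
  finally have total: "(\<Sum>j<length \<nu>. card (Ss ! j) * \<nu> ! j) = (\<Sum>j<length \<nu>. \<nu> ! j)" by simp
  have ge: "\<nu> ! j \<le> card (Ss ! j) * \<nu> ! j" if "j < length \<nu>" for j
    using ne[OF that] by (simp add: Suc_le_eq card_gt_0_iff)
  have "card (Ss ! j) = 1" if j: "j < length \<nu>" for j
  proof (rule ccontr)
    assume "card (Ss ! j) \<noteq> 1"
    moreover have "card (Ss ! j) > 0" using ne[OF j] by (simp add: card_gt_0_iff)
    ultimately have "1 * \<nu> ! j < card (Ss ! j) * \<nu> ! j" using pos[OF j] by (intro mult_less_mono1) auto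
    hence "(\<Sum>j<length \<nu>. \<nu> ! j) < (\<Sum>j<length \<nu>. card (Ss ! j) * \<nu> ! j)"
      using ge j by (intro sum_strict_mono_ex1) auto
    thus False using total by simp
  qed
  hence "\<exists>s. Ss ! j = {s}" if "j < length \<nu>" for j using that by (simp add: card_1_singleton_iff)
  then obtain s where s: "\<And>j. j < length \<nu> \<Longrightarrow> Ss ! j = {s j}" by metis
  have eq': "part_monomial \<mu> i = (\<Sum>j<length \<nu>. if i = s j then \<nu> ! j else 0)" for i
    unfolding eq using s by (intro sum.cong) auto
  have "{..<length \<mu>} \<subseteq> s ` {..<length \<nu>}"
  proof
    fix i assume "i \<in> {..<length \<mu>}"
    hence "part_monomial \<mu> i \<noteq> 0" using part_monomial_supp[OF assms(1)] by blast
    hence "(\<Sum>j<length \<nu>. if i = s j then \<nu> ! j else 0) \<noteq> 0" unfolding eq' .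
    then obtain j where "j \<in> {..<length \<nu>}" "(if i = s j then \<nu> ! j else 0) \<noteq> 0"
      by (rule sum.not_neutral_contains_not_neutral)
    thus "i \<in> s ` {..<length \<nu>}" by (auto split: if_splits)
  qed
  moreover have "s ` {..<length \<nu>} \<subseteq> {..<length \<mu>}" using s sub by fastforce
  ultimately have im: "s ` {..<length \<nu>} = {..<length \<mu>}" by blast
  show ?thesis
  proof (cases "length \<nu> > length \<mu>")
    case False
    moreover have "length \<mu> \<le> length \<nu>" using card_image_le[of "{..<length \<nu>}" s] im by simp
    ultimately have len: "length \<nu> = length \<mu>" by simp
    hence inj: "inj_on s {..<length \<nu>}" using im by (intro eq_card_imp_inj_on) simp_all
    have "\<nu> ! j = \<mu> ! s j" if j: "j < length \<nu>" for j
    proof -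
      have "s j < length \<mu>" using im j by blast
      hence "\<mu> ! s j = (\<Sum>k<length \<nu>. if s j = s k then \<nu> ! k else 0)"
        using eq'[of "s j"] by (simp add: part_monomial_def)
      also have "\<dots> = (\<Sum>k<length \<nu>. if j = k then \<nu> ! k else 0)"
        using inj j by (intro sum.cong) (auto dest: inj_onD)
      finally show ?thesis using j by simp
    qed
    hence "mset \<nu> = image_mset (\<lambda>j. \<mu> ! s j) (mset_set {..<length \<nu>})"
      unfolding mset_conv_nth[of \<nu>] by (intro image_mset_cong) auto
    also have "\<dots> = image_mset ((!) \<mu>) (image_mset s (mset_set {..<length \<nu>}))"
      by (simp add: image_mset.compositionality o_def)
    also have "image_mset s (mset_set {..<length \<nu>}) = mset_set {..<length \<mu>}"
      using inj im by (simp add: image_mset_mset_set)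
    also have "image_mset ((!) \<mu>) (mset_set {..<length \<mu>}) = mset \<mu>"
      by (rule mset_conv_nth[symmetric])
    finally show ?thesis using partition_eqI assms(1,2) by blast
  qed simp
qed

text \<open>At the monomial of \<mu>, every other contributing \<nu> has a smaller sum or, with
  equal sum, more parts. The induction therefore runs over the sum and then over sum minus length,
  so that longer partitions come first.\<close>

lemma pbar_expansion_unique:
  assumes "is_pbar_expansion V E c" "is_pbar_expansion V E c'" "is_partition \<mu>"
  shows "c \<mu> = c' \<mu>"
  using assms(3)
proof (induction \<mu> rule: wf_induct_rule[OF wf_measures[of "[sum_list, \<lambda>\<mu>. sum_list \<mu> - length \<mu>]"]])
  case (1 \<mu>)
  define \<alpha> where "\<alpha> = part_monomial \<mu>"
  have \<alpha>: "monomial \<alpha>" "mdeg \<alpha> = sum_list \<mu>"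
    using monomial_part_monomial mdeg_part_monomial 1(2) by (auto simp: \<alpha>_def)
  have expand: "of_nat (kromatic_coeff V E \<alpha>) = (\<Sum>\<nu>\<in>parts_le (sum_list \<mu>). d \<nu> * of_nat (pbar_coeff \<nu> \<alpha>))"
    if "is_pbar_expansion V E d" for d
    using that[unfolded is_pbar_expansion_def, rule_format, OF \<alpha>(1)] by (simp only: \<alpha>(2) parts_le_def)
  have "(\<Sum>\<nu>\<in>parts_le (sum_list \<mu>). c \<nu> * of_nat (pbar_coeff \<nu> \<alpha>)) = (\<Sum>\<nu>\<in>parts_le (sum_list \<mu>). c' \<nu> * of_nat (pbar_coeff \<nu> \<alpha>))"
    using expand[OF assms(1)] expand[OF assms(2)] by simp
  hence "(\<Sum>\<nu>\<in>parts_le (sum_list \<mu>). (c \<nu> - c' \<nu>) * of_nat (pbar_coeff \<nu> \<alpha>)) = 0"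
    by (simp add: algebra_simps sum_subtractf)
  moreover have "(c \<nu> - c' \<nu>) * of_nat (pbar_coeff \<nu> \<alpha>) = 0" if \<nu>: "\<nu> \<in> parts_le (sum_list \<mu>)" "\<nu> \<noteq> \<mu>" for \<nu>
  proof (cases "sum_list \<nu> < sum_list \<mu>")
    case True
    hence "c \<nu> = c' \<nu>" using 1(1)[of \<nu>] \<nu>(1) by (simp add: parts_le_def)
    thus ?thesis by simp
  next
    case False
    hence sum: "sum_list \<nu> = sum_list \<mu>" "is_partition \<nu>" using \<nu>(1) by (auto simp: parts_le_def)
    show ?thesis
    proof (cases "pbar_coeff \<nu> \<alpha> = 0")
      case False
      hence "length \<nu> > length \<mu>" using pbar_coeff_triangular[OF 1(2) sum(2,1)] \<nu>(2) by (simp add: \<alpha>_def)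
      moreover have "length \<nu> \<le> sum_list \<nu>" using sum(2) by (intro length_le_sum_list) (simp add: is_partition_def)
      ultimately have "c \<nu> = c' \<nu>" using 1(1)[of \<nu>] sum by simp
      thus ?thesis by simp
    qed simp
  qed
  ultimately have "(\<Sum>\<nu>\<in>{\<mu>}. (c \<nu> - c' \<nu>) * of_nat (pbar_coeff \<nu> \<alpha>)) = 0"
    using 1(2) by (subst (asm) sum.mono_neutral_right[of _ "{\<mu>}"]) (auto simp: parts_le_def finite_parts_le[unfolded parts_le_def])
  thus ?case using pbar_coeff_self[OF 1(2)] by (simp add: \<alpha>_def)
qed

section \<open>Induced subgraphs\<close>

lemma induced_dependence:
  assumes "simple_graph V E"
  shows "ordered_dependence (induced E W)"
  using assms by unfold_locales (auto simp: simple_graph_def induced_def)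

lemma ind_count_induced: "ind_count (induced E W) W = ind_count E W"
proof -
  have "ind_sets (induced E W) W = ind_sets E W" by (auto simp: ind_sets_def induced_def)
  thus ?thesis by (simp add: ind_count_def fun_eq_iff)
qed

definition graph_exponent :: "('a :: linorder \<Rightarrow> 'a \<Rightarrow> bool) \<Rightarrow> 'a set \<Rightarrow> nat \<Rightarrow> rat" where
  "graph_exponent E W = exponent (\<lambda>k. card (lyndon_heaps E W k))"

lemma ind_count_eq_psum_graph:
  assumes "simple_graph V E" "W \<subseteq> V"
  shows "of_nat (ind_count E W n) = psum (graph_exponent E W) n"
proof -
  interpret ordered_dependence "induced E W" by (rule induced_dependence[OF assms(1)])
  have "lyndons W k = lyndon_heaps E W k" for k
    unfolding lyndons_def lyndon_heaps_def ..
  moreover have "finite W" using assms finite_subset by (auto simp: simple_graph_def)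
  moreover have "\<not> induced E W u u" for u using assms(1) by (simp add: induced_def simple_graph_def)
  ultimately show ?thesis
    using ind_count_eq_psum[of W n] by (simp add: graph_exponent_def ind_count_induced)
qed

text \<open>For fixed W, \<open>sum_pbar_coeff\<close> expands the product of independence
  polynomials over the variables; the alternating sum over W restores nonempty colour sets.\<close>

lemma kromatic_pbar_expansion:
  assumes "simple_graph V E"
  shows "is_pbar_expansion V E (\<lambda>\<mu>. \<Sum>W\<in>Pow V. (-1) ^ card (V - W) * pweight (graph_exponent E W) \<mu>)"
  unfolding is_pbar_expansion_def
proof (intro allI impI)
  fix \<alpha> assume \<alpha>: "monomial \<alpha>"
  have fin: "finite V" using assms by (simp add: simple_graph_def)
  have "of_nat (kromatic_coeff V E \<alpha>)
    = (\<Sum>W\<in>Pow V. (-1) ^ card (V - W) * (\<Prod>i\<in>{i. \<alpha> i \<noteq> 0}. of_nat (ind_count E W (\<alpha> i)) :: rat))"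
    by (rule kromatic_coeff_eq[OF fin \<alpha>])
  also have "\<dots> = (\<Sum>W\<in>Pow V. (-1) ^ card (V - W) * (\<Sum>\<mu>\<in>parts_le (mdeg \<alpha>). pweight (graph_exponent E W) \<mu> * of_nat (pbar_coeff \<mu> \<alpha>)))"
    using ind_count_eq_psum_graph[OF assms] sum_pbar_coeff[OF \<alpha>] by (intro sum.cong) auto
  also have "\<dots> = (\<Sum>W\<in>Pow V. \<Sum>\<mu>\<in>parts_le (mdeg \<alpha>). (-1) ^ card (V - W) * pweight (graph_exponent E W) \<mu> * of_nat (pbar_coeff \<mu> \<alpha>))"
    by (simp add: sum_distrib_left mult.assoc)
  also have "\<dots> = (\<Sum>\<mu>\<in>parts_le (mdeg \<alpha>). \<Sum>W\<in>Pow V. (-1) ^ card (V - W) * pweight (graph_exponent E W) \<mu> * of_nat (pbar_coeff \<mu> \<alpha>))"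
    by (rule sum.swap)
  finally show "of_nat (kromatic_coeff V E \<alpha>) = (\<Sum>\<mu>\<in>{\<mu>. is_partition \<mu> \<and> sum_list \<mu> \<le> mdeg \<alpha>}.
      (\<Sum>W\<in>Pow V. (-1) ^ card (V - W) * pweight (graph_exponent E W) \<mu>) * of_nat (pbar_coeff \<mu> \<alpha>))"
    by (simp add: parts_le_def sum_distrib_right)
qed

text \<open>The two dependence relations agree on W. A pair with a letter outside W sees at most one
  letter of a word over W, so its projection is already controlled by the reflexive pair of that
  letter.\<close>

lemma heap_class_induced:
  fixes E :: "'a :: linorder \<Rightarrow> 'a \<Rightarrow> bool"
  assumes "simple_graph V E" "set w \<subseteq> W"
  shows "heap_class (induced E W) w = heap_class E w"
proof -
  interpret D: ordered_dependence E using assms(1) by unfold_locales (auto simp: simple_graph_def)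
  interpret I: ordered_dependence "induced E W" by (rule induced_dependence[OF assms(1)])
  have "w' \<in> heap_class (induced E W) w \<longleftrightarrow> w' \<in> heap_class E w" for w'
  proof -
    have "I.teq w w' \<longleftrightarrow> D.teq w w'" if w': "set w' \<subseteq> W"
    proof
      assume I: "I.teq w w'"
      show "D.teq w w'"
      proof (rule D.teqI)
        fix a b assume ab: "D.dep a b"
        have one: "proj a a w = proj a a w'" for a by (rule I.teqD[OF I]) simp
        have drop: "proj a b v = proj b b v" "proj b a v = proj b b v" if "a \<notin> set v" for a b and v :: "'a list"
          using that by (auto simp: proj_def intro!: filter_cong)
        show "proj a b w = proj a b w'"
        proof (cases "a \<in> W \<and> b \<in> W")
          case True
          hence "I.dep a b" using ab by (auto simp: I.dep_def D.dep_def induced_def)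
          thus ?thesis by (rule I.teqD[OF I])
        next
          case False
          hence "(a \<notin> set w \<and> a \<notin> set w') \<or> (b \<notin> set w \<and> b \<notin> set w')" using assms(2) w' by blast
          thus ?thesis
          proof
            assume "a \<notin> set w \<and> a \<notin> set w'"
            thus ?thesis using one[of b] by (simp add: drop(1))
          next
            assume "b \<notin> set w \<and> b \<notin> set w'"
            thus ?thesis using one[of a] by (simp add: drop(2))
          qed
        qed
      qed
    next
      assume "D.teq w w'"
      thus "I.teq w w'"
        by (auto simp: I.teq_def D.teq_def I.dep_def D.dep_def induced_def)
    qed
    moreover have "set w' \<subseteq> W" if "I.teq w w' \<or> D.teq w w'"
      using that I.teq_set D.teq_set assms(2) by blast
    ultimately show ?thesis
      unfolding I.mem_heap_class_iff D.mem_heap_class_iff by blast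
  qed
  thus ?thesis by blast
qed

text \<open>Conjugators of w are supported on the letters of w, so pyramids, periodicity and the
  whole rotation class of w stay within words over W, where both relations give the same
  heaps.\<close>

lemma lyndon_induced:
  assumes "simple_graph V E" "set w \<subseteq> W"
  shows "lyndon (induced E W) (heap_class E w) \<longleftrightarrow> lyndon E (heap_class E w)"
proof -
  interpret D: ordered_dependence E using assms(1) by unfold_locales (auto simp: simple_graph_def)
  interpret I: ordered_dependence "induced E W" by (rule induced_dependence[OF assms(1)])
  note cls = heap_class_induced[OF assms(1), of _ W]
  have teq: "I.teq u v \<longleftrightarrow> D.teq u v" if "set u \<subseteq> W" for u v
    using cls[OF that] I.mem_heap_class_iff[of v u] D.mem_heap_class_iff[of v u] by simp
  have mins: "I.mins u = D.mins u" if "set u \<subseteq> W" for u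
    unfolding I.mins_def D.mins_def teq[OF that] ..
  have per: "I.per u \<longleftrightarrow> D.per u" if "set u \<subseteq> W" for u
    unfolding I.per_def D.per_def teq[OF that] ..
  have conj_by: "I.conj_by X u q \<longleftrightarrow> D.conj_by X u q" if "set u \<subseteq> W" for X u q
    using that teq[of "u @ X" "X @ q"] unfolding I.conj_by_def D.conj_by_def by auto
  have rotation_class: "I.rotation_class w = D.rotation_class w"
  proof -
    have "set q \<subseteq> W" if "I.conj_by X w q \<or> D.conj_by X w q" for X q
      using that I.conj_by_set D.conj_by_set assms(2) by blast
    hence *: "(heap_class (induced E W) q = Q \<and> (\<exists>v. I.mins q = {v}) \<and> (\<exists>X. I.conj_by X w q))
      \<longleftrightarrow> (heap_class E q = Q \<and> (\<exists>v. D.mins q = {v}) \<and> (\<exists>X. D.conj_by X w q))" for q Q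
      using cls[of q] mins[of q] conj_by[OF assms(2)] by metis
    show ?thesis
    proof (rule set_eqI)
      fix Q
      have "Q \<in> I.rotation_class w \<longleftrightarrow>
          (\<exists>q. heap_class (induced E W) q = Q \<and> (\<exists>v. I.mins q = {v}) \<and> (\<exists>X. I.conj_by X w q))"
        unfolding I.rotation_class_def by auto
      also have "\<dots> \<longleftrightarrow> (\<exists>q. heap_class E q = Q \<and> (\<exists>v. D.mins q = {v}) \<and> (\<exists>X. D.conj_by X w q))"
        by (simp only: *)
      also have "\<dots> \<longleftrightarrow> Q \<in> D.rotation_class w"
        unfolding D.rotation_class_def by auto
      finally show "Q \<in> I.rotation_class w \<longleftrightarrow> Q \<in> D.rotation_class w" .
    qed
  qed
  show ?thesis
  proof (cases "(\<exists>v. D.mins w = {v}) \<and> \<not> D.per w")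
    case True
    then obtain v where v: "D.mins w = {v}" "\<not> D.per w" by blast
    thus ?thesis using D.lyndon_iff[OF v] I.lyndon_iff[of w v] mins[OF assms(2)] per[OF assms(2)]
        rotation_class cls[OF assms(2)] by simp
  next
    case False
    hence "\<not> lyndon E (heap_class E w)"
      unfolding lyndon_def D.pyramid_iff D.periodic_iff by blast
    moreover have "\<not> lyndon (induced E W) (heap_class (induced E W) w)"
      using False mins[OF assms(2)] per[OF assms(2)]
      unfolding lyndon_def I.pyramid_iff I.periodic_iff by auto
    ultimately show ?thesis using cls[OF assms(2)] by simp
  qed
qed

lemma uses_heap_class:
  fixes E :: "'a :: linorder \<Rightarrow> 'a \<Rightarrow> bool"
  assumes "simple_graph V E"
  shows "uses (heap_class E w) v \<longleftrightarrow> v \<in> set w"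
proof -
  interpret D: ordered_dependence E using assms by unfold_locales (auto simp: simple_graph_def)
  show ?thesis unfolding uses_def using D.teq_set D.teq_refl D.mem_heap_class_iff by metis
qed

text \<open>Turns passing to an induced subgraph into a restriction on used vertices, the form that
  inclusion-exclusion needs.\<close>

lemma lyndon_heaps_induced:
  assumes "simple_graph V E" "W \<subseteq> V"
  shows "lyndon_heaps E W k = {H \<in> lyndon_heaps E V k. \<forall>v. uses H v \<longrightarrow> v \<in> W}"
proof -
  have *: "lyndon_heaps E U k = {heap_class E w |w. set w \<subseteq> U \<and> length w = k \<and> lyndon E (heap_class E w)}" for U
    unfolding lyndon_heaps_def
    using heap_class_induced[OF assms(1), of _ U] lyndon_induced[OF assms(1), of _ U] by force
  show ?thesis unfolding * using assms(2) uses_heap_class[OF assms(1)] by blast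
qed

lemma lyndon_heaps_length:
  assumes "simple_graph V E" "H \<in> lyndon_heaps E V k"
  shows "\<exists>w. H = heap_class E w \<and> length w = k \<and> set w \<subseteq> V"
  using assms heap_class_induced[OF assms(1), of _ V] unfolding lyndon_heaps_def by blast

lemma lyndon_heaps_disjoint:
  assumes "simple_graph V E" "W \<subseteq> V" "H \<in> lyndon_heaps E W k" "H \<in> lyndon_heaps E W l"
  shows "k = l"
proof -
  interpret D: ordered_dependence E using assms(1) by unfold_locales (auto simp: simple_graph_def)
  have "H \<in> lyndon_heaps E V k" "H \<in> lyndon_heaps E V l"
    using assms lyndon_heaps_induced[OF assms(1,2)] by auto
  thus ?thesis using lyndon_heaps_length[OF assms(1)] D.teq_length D.heap_class_eq_iff by metis
qed

lemma finite_lyndon_heaps: "finite W \<Longrightarrow> finite (lyndon_heaps E W k)"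
proof (rule finite_subset)
  show "lyndon_heaps E W k \<subseteq> heap_class (induced E W) ` {w. set w \<subseteq> W \<and> length w = k}"
    unfolding lyndon_heaps_def by blast
  show "finite W \<Longrightarrow> finite (heap_class (induced E W) ` {w. set w \<subseteq> W \<and> length w = k})"
    by (intro finite_imageI finite_lists_length_eq)
qed

section \<open>Families of Lyndon heaps\<close>

definition even_heaps :: "('a :: linorder \<Rightarrow> 'a \<Rightarrow> bool) \<Rightarrow> 'a set \<Rightarrow> nat \<Rightarrow> 'a list set set" where
  "even_heaps E W k = (\<Union>j\<in>{j. 2 ^ (j + 1) dvd k}. lyndon_heaps E W (k div 2 ^ j))"

definition part_families :: "('a :: linorder \<Rightarrow> 'a \<Rightarrow> bool) \<Rightarrow> 'a set \<Rightarrow> nat list \<Rightarrow> nat \<Rightarrow> 'a list set multiset set" where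
  "part_families E W la k = (if odd k
    then {M. size M = mult_part k la \<and> (\<forall>H. count M H \<le> 1) \<and> set_mset M \<subseteq> lyndon_heaps E W k}
    else multisets_of_size (even_heaps E W k) (mult_part k la))"

lemma finite_even_index: "k > 0 \<Longrightarrow> finite {j. 2 ^ (j + 1) dvd (k :: nat)}"
  by (rule finite_subset[OF _ finite_two_power_dvd[of k]]) (auto dest: dvd_mult_right)

text \<open>A heap has only one size, and for k > 0 distinct j give distinct sizes k / 2^j, so no
  heap is counted twice.\<close>

lemma card_even_heaps:
  assumes "simple_graph V E" "W \<subseteq> V" "k > 0"
  shows "card (even_heaps E W k) = even_total (\<lambda>k. card (lyndon_heaps E W k)) k"
  unfolding even_heaps_def even_total_def
proof (rule card_UN_disjoint)
  show "finite {j. 2 ^ (j + 1) dvd k}" using finite_even_index[OF assms(3)] .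
  have "finite W" using assms finite_subset by (auto simp: simple_graph_def)
  thus "\<forall>j\<in>{j. 2 ^ (j + 1) dvd k}. finite (lyndon_heaps E W (k div 2 ^ j))"
    using finite_lyndon_heaps by blast
  have "i = j" if i: "2 ^ (i + 1) dvd k" and j: "2 ^ (j + 1) dvd k" and eq: "k div 2 ^ i = k div 2 ^ j" for i j
  proof -
    have "k = k div 2 ^ i * 2 ^ i" "k = k div 2 ^ j * 2 ^ j"
      using dvd_mult_left[of "2 ^ i" 2 k] dvd_mult_left[of "2 ^ j" 2 k] i j by (simp_all add: mult.commute)
    moreover have "k div 2 ^ i \<noteq> 0" using assms(3) calculation(1) by (metis mult_0 less_irrefl)
    ultimately have "2 ^ i = (2 ^ j :: nat)" using eq by (metis mult_left_cancel)
    thus ?thesis by simp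
  qed
  thus "\<forall>i\<in>{j. 2 ^ (j + 1) dvd k}. \<forall>j\<in>{j. 2 ^ (j + 1) dvd k}. i \<noteq> j \<longrightarrow>
      lyndon_heaps E W (k div 2 ^ i) \<inter> lyndon_heaps E W (k div 2 ^ j) = {}"
    using lyndon_heaps_disjoint[OF assms(1,2)] by blast
qed

lemma finite_even_heaps: "finite W \<Longrightarrow> k > 0 \<Longrightarrow> finite (even_heaps E W k)"
  unfolding even_heaps_def using finite_even_index finite_lyndon_heaps by blast

lemma card_sub_multisets:
  assumes "finite A"
  shows "card {M. size M = r \<and> (\<forall>x. count M x \<le> 1) \<and> set_mset M \<subseteq> A} = card A choose r" (is "card ?M = _")
    and "finite {M. size M = r \<and> (\<forall>x. count M x \<le> 1) \<and> set_mset M \<subseteq> A}"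
proof -
  have "bij_betw mset_set {B. B \<subseteq> A \<and> card B = r} ?M"
  proof (rule bij_betwI[where g = set_mset])
    show "mset_set \<in> {B. B \<subseteq> A \<and> card B = r} \<rightarrow> ?M"
    proof
      fix B assume B: "B \<in> {B. B \<subseteq> A \<and> card B = r}"
      hence "finite B" using assms finite_subset by blast
      thus "mset_set B \<in> ?M"
        using B by (simp add: count_mset_set')
    qed
    have *: "mset_set (set_mset M) = M" if "\<forall>x. count M x \<le> 1" for M :: "'a multiset"
    proof (rule multiset_eqI)
      fix x
      have "count M x = 0 \<or> count M x = 1" using that[rule_format, of x] by linarith
      thus "count (mset_set (set_mset M)) x = count M x"
        by (auto simp: count_mset_set' simp flip: count_greater_zero_iff)
    qed
    show "set_mset \<in> ?M \<rightarrow> {B. B \<subseteq> A \<and> card B = r}"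
    proof
      fix M assume M: "M \<in> ?M"
      hence "size (mset_set (set_mset M)) = size M" using *[of M] by simp
      thus "set_mset M \<in> {B. B \<subseteq> A \<and> card B = r}" using M by simp
    qed
    show "mset_set (set_mset M) = M" if "M \<in> ?M" for M
      using that * by blast
    show "set_mset (mset_set B) = B" if "B \<in> {B. B \<subseteq> A \<and> card B = r}" for B
      using that finite_subset[OF _ assms] by simp
  qed
  from bij_betw_same_card[OF this] bij_betw_finite[OF this]
  show "card ?M = card A choose r" and "finite ?M"
    using assms by (simp_all add: n_subsets)
qed

lemma card_part_families:
  assumes "simple_graph V E" "W \<subseteq> V" "k > 0"
  shows "card (part_families E W la k) = (if odd k then card (lyndon_heaps E W k) choose mult_part k la
    else multichoose (even_total (\<lambda>k. card (lyndon_heaps E W k)) k) (mult_part k la))" (is "_ = ?n")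
    and "finite (part_families E W la k)"
proof -
  have finW: "finite W" using assms finite_subset by (auto simp: simple_graph_def)
  show "finite (part_families E W la k)"
    using card_sub_multisets(2)[OF finite_lyndon_heaps[OF finW]] finite_even_heaps[OF finW assms(3)]
    by (auto simp: part_families_def)
  show "card (part_families E W la k) = ?n"
    using card_sub_multisets(1)[OF finite_lyndon_heaps[OF finW, of E k]]
      card_multisets_of_size[OF finite_even_heaps[OF finW assms(3), of E]] card_even_heaps[OF assms]
    by (simp add: part_families_def multichoose_def)
qed

text \<open>Conditions (i) and (ii) without the covering condition (iii). The value is the empty
  multiset off the parts of la, so a family amounts to a choice over the finite set
  \<open>set la\<close>.\<close>

definition all_families :: "('a :: linorder \<Rightarrow> 'a \<Rightarrow> bool) \<Rightarrow> 'a set \<Rightarrow> nat list \<Rightarrow> (nat \<Rightarrow> 'a list set multiset) set" where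
  "all_families E W la = {M. (\<forall>k\<in>set la. M k \<in> part_families E W la k) \<and> (\<forall>k. k \<notin> set la \<longrightarrow> M k = {#})}"

lemma bij_all_families:
  "bij_betw (\<lambda>M. restrict M (set la)) (all_families E W la) (\<Pi>\<^sub>E k\<in>set la. part_families E W la k)"
  by (rule bij_betwI[where g = "\<lambda>M k. if k \<in> set la then M k else {#}"])
    (auto simp: all_families_def fun_eq_iff PiE_iff extensional_def)

lemma card_all_families:
  assumes "simple_graph V E" "W \<subseteq> V" "is_partition la"
  shows "card (all_families E W la) = (\<Prod>k\<in>set la. card (part_families E W la k))"
    and "finite (all_families E W la)"
proof -
  have "k > 0" if "k \<in> set la" for k using assms(3) that by (auto simp: is_partition_def intro: gr0I)
  hence "finite (part_families E W la k)" if "k \<in> set la" for k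
    using card_part_families(2)[OF assms(1,2)] that by blast
  hence "finite (\<Pi>\<^sub>E k\<in>set la. part_families E W la k)" by (intro finite_PiE) auto
  thus "finite (all_families E W la)" using bij_betw_finite[OF bij_all_families] by blast
  show "card (all_families E W la) = (\<Prod>k\<in>set la. card (part_families E W la k))"
    using bij_betw_same_card[OF bij_all_families] by (simp add: card_PiE)
qed

text \<open>If k is not a part, the prescribed size 0 forces \<open>M k\<close> to be empty, which
  reduces the infinitely many indices to \<open>set la\<close>. The covering condition becomes an
  equality of the set of used vertices with V.\<close>

lemma lyndon_families_eq:
  assumes "simple_graph V E"
  shows "lyndon_families V E la = {M \<in> all_families E V la. {v \<in> V. \<exists>k. \<exists>H\<in>#M k. uses H v} = V}"
proof -
  have even_iff: "(\<forall>H\<in>#M. \<exists>j. 2 ^ j dvd k \<and> even (k div 2 ^ j) \<and> H \<in> lyndon_heaps E V (k div 2 ^ j))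
    \<longleftrightarrow> set_mset M \<subseteq> even_heaps E V k" for M k
  proof -
    have "2 ^ j dvd k \<and> even (k div 2 ^ j) \<longleftrightarrow> 2 ^ (j + 1) dvd k" for j
      by (auto simp: dvd_def mult_ac)
    thus ?thesis unfolding even_heaps_def by blast
  qed
  have iff: "(\<forall>k. size (M k) = mult_part k la) \<and>
     (\<forall>k. odd k \<longrightarrow> (\<forall>H. count (M k) H \<le> 1) \<and> (\<forall>H\<in>#M k. H \<in> lyndon_heaps E V k)) \<and>
     (\<forall>k. even k \<longrightarrow> (\<forall>H\<in>#M k. \<exists>j. 2 ^ j dvd k \<and> even (k div 2 ^ j) \<and> H \<in> lyndon_heaps E V (k div 2 ^ j)))
     \<longleftrightarrow> M \<in> all_families E V la" for M
  proof -
    have "(\<forall>k. size (M k) = mult_part k la) \<and>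
     (\<forall>k. odd k \<longrightarrow> (\<forall>H. count (M k) H \<le> 1) \<and> (\<forall>H\<in>#M k. H \<in> lyndon_heaps E V k)) \<and>
     (\<forall>k. even k \<longrightarrow> (\<forall>H\<in>#M k. \<exists>j. 2 ^ j dvd k \<and> even (k div 2 ^ j) \<and> H \<in> lyndon_heaps E V (k div 2 ^ j)))
     \<longleftrightarrow> (\<forall>k. size (M k) = mult_part k la \<and>
       (odd k \<longrightarrow> (\<forall>H. count (M k) H \<le> 1) \<and> (\<forall>H\<in>#M k. H \<in> lyndon_heaps E V k)) \<and>
       (even k \<longrightarrow> set_mset (M k) \<subseteq> even_heaps E V k))"
      unfolding even_iff by (simp only: all_conj_distrib)
    also have "\<dots> \<longleftrightarrow> (\<forall>k. if k \<in> set la then M k \<in> part_families E V la k else M k = {#})"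
    proof (rule arg_cong[of _ _ All], rule ext)
      fix k
      show "(size (M k) = mult_part k la \<and>
         (odd k \<longrightarrow> (\<forall>H. count (M k) H \<le> 1) \<and> (\<forall>H\<in>#M k. H \<in> lyndon_heaps E V k)) \<and>
         (even k \<longrightarrow> set_mset (M k) \<subseteq> even_heaps E V k))
         \<longleftrightarrow> (if k \<in> set la then M k \<in> part_families E V la k else M k = {#})"
        by (auto simp: part_families_def multisets_of_size_def)
    qed
    also have "\<dots> \<longleftrightarrow> M \<in> all_families E V la" by (auto simp: all_families_def)
    finally show ?thesis .
  qed
  show ?thesis
  proof (rule set_eqI)
    fix M :: "nat \<Rightarrow> 'a list set multiset"
    have cover: "(\<forall>v\<in>V. \<exists>k. \<exists>H\<in>#M k. uses H v) \<longleftrightarrow> {v \<in> V. \<exists>k. \<exists>H\<in>#M k. uses H v} = V"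
      by blast
    show "M \<in> lyndon_families V E la \<longleftrightarrow> M \<in> {M \<in> all_families E V la. {v \<in> V. \<exists>k. \<exists>H\<in>#M k. uses H v} = V}"
      unfolding lyndon_families_def mem_Collect_eq iff[symmetric] cover by (simp only: conj_assoc)
  qed
qed

text \<open>Identifies the terms of inclusion-exclusion over used vertices with the families of the
  induced subgraphs.\<close>

lemma all_families_induced:
  assumes "simple_graph V E" "W \<subseteq> V"
  shows "{M \<in> all_families E V la. {v \<in> V. \<exists>k. \<exists>H\<in>#M k. uses H v} \<subseteq> W} = all_families E W la"
proof -
  have usesV: "v \<in> V" if "H \<in> lyndon_heaps E V k" "uses H v" for H k v
    using lyndon_heaps_length[OF assms(1) that(1)] that(2) uses_heap_class[OF assms(1)] by auto
  note L = lyndon_heaps_induced[OF assms]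
  have E: "even_heaps E W k = {H \<in> even_heaps E V k. \<forall>v. uses H v \<longrightarrow> v \<in> W}" for k
    unfolding even_heaps_def L by blast
  have part: "M \<in> part_families E W la k \<longleftrightarrow> M \<in> part_families E V la k \<and> (\<forall>H\<in>#M. \<forall>v. uses H v \<longrightarrow> v \<in> W)" for M k
    unfolding part_families_def multisets_of_size_def L E by auto
  have usesV': "v \<in> V" if "M \<in> all_families E V la" "H \<in># M k" "uses H v" for M H k v
  proof -
    have "M k \<in> part_families E V la k" using that(1,2) by (cases "k \<in> set la") (auto simp: all_families_def)
    hence "H \<in> lyndon_heaps E V k \<or> H \<in> even_heaps E V k"
      using that(2) by (auto simp: part_families_def multisets_of_size_def split: if_splits)
    thus ?thesis using usesV that(3) unfolding even_heaps_def by blast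
  qed
  show ?thesis
  proof (intro equalityI subsetI)
    fix M assume "M \<in> {M \<in> all_families E V la. {v \<in> V. \<exists>k. \<exists>H\<in>#M k. uses H v} \<subseteq> W}"
    hence M: "M \<in> all_families E V la" "{v \<in> V. \<exists>k. \<exists>H\<in>#M k. uses H v} \<subseteq> W" by auto
    hence "v \<in> W" if "H \<in># M k" "uses H v" for H k v using usesV'[OF M(1) that] that by blast
    thus "M \<in> all_families E W la" using M(1) unfolding all_families_def part by blast
  next
    fix M assume M: "M \<in> all_families E W la"
    hence "M \<in> all_families E V la" unfolding all_families_def part by blast
    moreover have "v \<in> W" if "H \<in># M k" "uses H v" for H k v
    proof (cases "k \<in> set la")
      case True
      thus ?thesis using M that unfolding all_families_def part by blast
    next
      case False
      thus ?thesis using M that by (simp add: all_families_def)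
    qed
    ultimately show "M \<in> {M \<in> all_families E V la. {v \<in> V. \<exists>k. \<exists>H\<in>#M k. uses H v} \<subseteq> W}" by blast
  qed
qed

lemma card_lyndon_families:
  assumes "simple_graph V E" "is_partition la"
  shows "of_nat (card (lyndon_families V E la))
    = (\<Sum>W\<in>Pow V. (-1) ^ card (V - W) * (\<Prod>k\<in>set la. of_nat (card (part_families E W la k))) :: rat)"
proof -
  have fin: "finite V" using assms(1) by (simp add: simple_graph_def)
  define u where "u M = {v \<in> V. \<exists>k. \<exists>H\<in>#M k. uses H v}" for M :: "nat \<Rightarrow> 'a list set multiset"
  have "rat_of_nat (card (lyndon_families V E la)) = of_nat (card {M \<in> all_families E V la. u M = V})"
    unfolding lyndon_families_eq[OF assms(1)] u_def ..
  also have "\<dots> = (\<Sum>W\<in>Pow V. (-1) ^ card (V - W) * of_nat (card {M \<in> all_families E V la. u M \<subseteq> W}))"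
    by (rule inclusion_exclusion_image[OF fin card_all_families(2)[OF assms(1) order_refl assms(2)], symmetric])
  also have "\<dots> = (\<Sum>W\<in>Pow V. (-1) ^ card (V - W) * (\<Prod>k\<in>set la. of_nat (card (part_families E W la k))))"
    using all_families_induced[OF assms(1)] card_all_families(1)[OF assms(1) _ assms(2)]
    by (intro sum.cong) (auto simp: u_def)
  finally show ?thesis .
qed

section \<open>Signs and generalised binomial coefficients\<close>

lemma sign_partition:
  assumes "0 \<notin> set la"
  shows "(-1 :: rat) ^ (sum_list la - length la) = (\<Prod>k\<in>set la. ((-1) ^ (k - 1)) ^ mult_part k la)"
proof -
  have "(-1 :: rat) ^ (sum_list la - length la) = (\<Prod>k\<leftarrow>la. (-1) ^ (k - 1))"
    using assms
  proof (induction la)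
    case (Cons x la)
    hence eq: "sum_list (x # la) - length (x # la) = (x - 1) + (sum_list la - length la)"
      using length_le_sum_list[of la] by (cases x) auto
    show ?case unfolding eq power_add using Cons by simp
  qed simp
  \<comment> \<open>Any finite K containing the parts is allowed, so that the index set stays fixed
    while the list shrinks in the induction.\<close>
  also have "\<dots> = (\<Prod>k\<in>K. ((-1) ^ (k - 1)) ^ mult_part k la)" if "finite K" "set la \<subseteq> K" for K
    using that(2)
  proof (induction la)
    case (Cons x la)
    have "(\<Prod>k\<in>K. ((-1 :: rat) ^ (k - 1)) ^ mult_part k (x # la))
      = (\<Prod>k\<in>K. (if k = x then (-1) ^ (k - 1) else 1) * ((-1) ^ (k - 1)) ^ mult_part k la)"
      by (intro prod.cong) (auto simp: mult_part_def)
    also have "\<dots> = (-1) ^ (x - 1) * (\<Prod>k\<in>K. ((-1) ^ (k - 1)) ^ mult_part k la)"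
      using that(1) Cons.prems by (simp add: prod.distrib)
    finally show ?case using Cons by simp
  qed (simp add: mult_part_def)
  from this[of "set la"]
  have "(\<Prod>k\<leftarrow>la. (-1 :: rat) ^ (k - 1)) = (\<Prod>k\<in>set la. ((-1) ^ (k - 1)) ^ mult_part k la)" by simp
  finally show ?thesis .
qed

text \<open>For odd k the sign is 1. For even k each part contributes -1, and negating the upper
  index turns (-1)^r (-S choose r) into the number of multisets of size r.\<close>

lemma signed_gbinomial_exponent:
  assumes "k > 0" "r > 0"
  shows "((-1) ^ (k - 1)) ^ r * (exponent L k gchoose r)
    = of_nat (if odd k then L k choose r else multichoose (even_total L k) r)"
proof (cases "odd k")
  case True
  thus ?thesis by (simp add: exponent_def binomial_gbinomial)
next
  case False
  define S where "S = even_total L k"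
  have "(- of_nat S gchoose r :: rat) = (-1) ^ r * ((of_nat r - - of_nat S - 1) gchoose r)"
    by (rule gbinomial_negated_upper)
  \<comment> \<open>r > 0 makes the truncated subtraction in \<open>multichoose\<close> agree with
    the rational one, also when S = 0.\<close>
  also have "of_nat r - - of_nat S - 1 = (of_nat (S + r - 1) :: rat)"
    using assms(2) by (simp add: of_nat_diff)
  finally have "(-1) ^ r * (- of_nat S gchoose r :: rat) = of_nat ((S + r - 1) choose r)"
    by (simp add: binomial_gbinomial flip: mult.assoc power_mult_distrib)
  moreover have "(-1 :: rat) ^ (k - 1) = -1" using False assms(1) by (simp add: uminus_power_if)
  ultimately show ?thesis using False by (simp add: exponent_def multichoose_def S_def)
qed

lemma signed_pweight:
  assumes "simple_graph V E" "is_partition la" "W \<subseteq> V"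
  shows "(-1) ^ (sum_list la - length la) * pweight (graph_exponent E W) la
    = (\<Prod>k\<in>set la. of_nat (card (part_families E W la k)))"
proof -
  have "0 \<notin> set la" using assms(2) by (simp add: is_partition_def)
  hence "(-1) ^ (sum_list la - length la) * pweight (graph_exponent E W) la
    = (\<Prod>k\<in>set la. ((-1) ^ (k - 1)) ^ mult_part k la * (graph_exponent E W k gchoose mult_part k la))"
    by (simp add: sign_partition pweight_def prod.distrib)
  also have "\<dots> = (\<Prod>k\<in>set la. of_nat (card (part_families E W la k)))"
  proof (rule prod.cong[OF refl])
    fix k assume k: "k \<in> set la"
    hence pos: "k > 0" "mult_part k la > 0" using \<open>0 \<notin> set la\<close> by (auto simp: mult_part_def intro: gr0I)
    show "((-1) ^ (k - 1)) ^ mult_part k la * (graph_exponent E W k gchoose mult_part k la)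
      = of_nat (card (part_families E W la k))"
      unfolding graph_exponent_def signed_gbinomial_exponent[OF pos] card_part_families(1)[OF assms(1,3) pos(1)] ..
  qed
  finally show ?thesis .
qed

lemma prod_part_families:
  assumes "simple_graph V E" "is_partition la" "W \<subseteq> V"
  shows "(\<Prod>k\<in>set la. of_nat (card (part_families E W la k)))
    = (\<Prod>k\<in>{k\<in>set la. odd k}. of_nat (card (lyndon_heaps E W k) choose mult_part k la)) *
      (\<Prod>k\<in>{k\<in>set la. even k}.
        of_nat (multichoose (\<Sum>j\<in>{j. 2 ^ (j + 1) dvd k}. card (lyndon_heaps E W (k div 2 ^ j)))
                            (mult_part k la)) :: rat)"
proof -
  have pos: "k > 0" if "k \<in> set la" for k using assms(2) that by (auto simp: is_partition_def intro: gr0I)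
  have sets: "set la \<inter> {k. odd k} = {k\<in>set la. odd k}" "set la - {k. odd k} = {k\<in>set la. even k}" by auto
  have "(\<Prod>k\<in>set la. rat_of_nat (card (part_families E W la k)))
    = (\<Prod>k\<in>{k\<in>set la. odd k}. of_nat (card (part_families E W la k))) *
      (\<Prod>k\<in>{k\<in>set la. even k}. of_nat (card (part_families E W la k)))"
    using prod.Int_Diff[of "set la" _ "{k. odd k}"] unfolding sets by blast
  also have "(\<Prod>k\<in>{k\<in>set la. odd k}. rat_of_nat (card (part_families E W la k)))
    = (\<Prod>k\<in>{k\<in>set la. odd k}. of_nat (card (lyndon_heaps E W k) choose mult_part k la))"
    by (rule prod.cong) (auto simp: card_part_families(1)[OF assms(1,3) pos])
  also have "(\<Prod>k\<in>{k\<in>set la. even k}. rat_of_nat (card (part_families E W la k)))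
    = (\<Prod>k\<in>{k\<in>set la. even k}.
        of_nat (multichoose (\<Sum>j\<in>{j. 2 ^ (j + 1) dvd k}. card (lyndon_heaps E W (k div 2 ^ j)))
                            (mult_part k la)))"
    by (rule prod.cong) (auto simp: card_part_families(1)[OF assms(1,3) pos] even_total_def)
  finally show ?thesis .
qed

theorem theorem1p2:
  fixes V :: "'a::linorder set" and E :: "'a \<Rightarrow> 'a \<Rightarrow> bool"
    and la :: "nat list" and c :: "nat list \<Rightarrow> rat"
  assumes "simple_graph V E"
    and "is_partition la"
    and "is_pbar_expansion V E c"
  shows "(-1) ^ (sum_list la - length la) * c la = of_nat (card (lyndon_families V E la))
    \<and> (-1) ^ (sum_list la - length la) * c la =
      (\<Sum>W\<in>Pow V. (-1) ^ card (V - W) *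
         (\<Prod>k\<in>{k\<in>set la. odd k}. of_nat (card (lyndon_heaps E W k) choose mult_part k la)) *
         (\<Prod>k\<in>{k\<in>set la. even k}.
            of_nat (multichoose (\<Sum>j\<in>{j. 2 ^ (j + 1) dvd k}. card (lyndon_heaps E W (k div 2 ^ j)))
                                (mult_part k la))))"
proof -
  \<comment> \<open>The given family c is known only through the expansion property, so its value is
    taken from the explicit expansion.\<close>
  have c: "c la = (\<Sum>W\<in>Pow V. (-1) ^ card (V - W) * pweight (graph_exponent E W) la)"
    by (rule pbar_expansion_unique[OF assms(3) kromatic_pbar_expansion[OF assms(1)] assms(2)])
  have "(-1) ^ (sum_list la - length la) * c la
    = (\<Sum>W\<in>Pow V. (-1) ^ card (V - W) * ((-1) ^ (sum_list la - length la) * pweight (graph_exponent E W) la))"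
    unfolding c by (simp add: sum_distrib_left mult_ac)
  also have "\<dots> = (\<Sum>W\<in>Pow V. (-1) ^ card (V - W) * (\<Prod>k\<in>set la. of_nat (card (part_families E W la k))))"
    by (intro sum.cong) (simp_all add: signed_pweight[OF assms(1,2)])
  finally have eq: "(-1) ^ (sum_list la - length la) * c la
    = (\<Sum>W\<in>Pow V. (-1) ^ card (V - W) * (\<Prod>k\<in>set la. of_nat (card (part_families E W la k))))" .
  show ?thesis
    unfolding eq
    by (intro conjI sum.cong)
      (simp_all add: card_lyndon_families[OF assms(1,2)] prod_part_families[OF assms(1,2)] mult.assoc)
qed

end
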